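(* Let $\mathcal{X}$ and $\mathcal{Y}$ be finite sets, let $P_X,P_Y$ be probability distributions whose supports are $\mathcal{X}$ and $\mathcal{Y}$ respectively, and let $c:\mathcal{X}\times\mathcal{Y}\to[0,+\infty)$ be a (finite) cost function. Assume $\alpha_0:=\mathcal{E}(P_X,P_Y)$ satisfies $\min_{x,y}c(x,y)<\alpha_0<\max_{x,y}c(x,y)$. Let $\{a_n\}$ be a positive sequence such that $a_n\to0$ and $na_n\to\infty$ as $n\to\infty$. Then the following hold. 1. If $\Delta<0$, then $$\lim_{n\to\infty}-a_n\log\Bigl(1-\mathcal{G}^{(n)}_{\alpha_0+\Delta/\sqrt{na_n}}(P_X,P_Y)\Bigr)=\tilde f(\Delta),$$ where $$\tilde f(\Delta):=\min_{\beta_X\in\mathbb{S}_X,\,\beta_Y\in\mathbb{S}_Y:\,\theta(\beta_X,\beta_Y)\le\Delta}\max\Bigl\{\frac12\sum_x\frac{\beta_X(x)^2}{P_X(x)},\ \frac12\sum_y\frac{\beta_Y(y)^2}{P_Y(y)}\Bigr\}.$$ 2. If $\Delta>0$, then $$\lim_{\Delta'\uparrow\Delta}\tilde g(\Delta')\le\liminf_{n\to\infty}-a_n\log\mathcal{G}^{(n)}_{\alpha_0+\Delta/\sqrt{na_n}}(P_X,P_Y)\le\limsup_{n\to\infty}-a_n\log\mathcal{G}^{(n)}_{\alpha_0+\Delta/\sqrt{na_n}}(P_X,P_Y)\le\tilde g(\Delta),$$ where $\tilde g(\Delta):=\min\{\tilde g_{P_X,P_Y}(\Delta),\tilde g_{P_Y,P_X}(\Delta)\}$;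 here $\tilde g_{P_X,P_Y}(\Delta)$ is the infimum of $\frac12\sum_x\frac{\beta_X(x)^2}{P_X(x)}$ over all $\beta_X\in\mathbb{S}_X$ such that $$\min_{\beta_Y\in\mathbb{S}_Y:\ \sum_y\frac{\beta_Y(y)^2}{P_Y(y)}\le\sum_x\frac{\beta_X(x)^2}{P_X(x)}}\theta(\beta_X,\beta_Y)>\Delta,$$ and $\tilde g_{P_Y,P_X}(\Delta)$ is the infimum of $\frac12\sum_y\frac{\beta_Y(y)^2}{P_Y(y)}$ over all $\beta_Y\in\mathbb{S}_Y$ such that $$\min_{\beta_X\in\mathbb{S}_X:\ \sum_x\frac{\beta_X(x)^2}{P_X(x)}\le\sum_y\frac{\beta_Y(y)^2}{P_Y(y)}}\theta(\beta_X,\beta_Y)>\Delta.$$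
   Context: $\Pi(P,Q)$ denotes the set of couplings of $P,Q$ (probability measures on the product space with marginals $P$ and $Q$). Optimal transport cost: $\mathcal{E}(Q_X,Q_Y):=\min_{Q_{XY}\in\Pi(Q_X,Q_Y)}\mathbb{E}_{(X,Y)\sim Q_{XY}}[c(X,Y)]$. $c_n(x^n,y^n):=\frac1n\sum_{i=1}^n c(x_i,y_i)$, and $\mathcal{G}_{\alpha}^{(n)}(P_X,P_Y):=\min_{P_{X^nY^n}\in\Pi(P_X^{\otimes n},P_Y^{\otimes n})}\mathbb{P}_{(X^n,Y^n)\sim P_{X^nY^n}}\{c_n(X^n,Y^n)>\alpha\}$. $\mathbb{S}_X:=\{\beta_X\in\mathbb{R}^{|\mathcal{X}|}:\sum_x\beta_X(x)=0\}$ (signed measures on $\mathcal{X}$ of total mass zero), and $\mathbb{S}_Y$ is defined analogously for $\mathcal{Y}$. Fix an optimal coupling $P_{XY}^*$ attaining $\mathcal{E}(P_X,P_Y)$ and let $\mathcal{S}\subseteq\mathcal{X}\times\mathcal{Y}$ be its support. For $\beta_X\in\mathbb{S}_X,\beta_Y\in\mathbb{S}_Y$, $$\theta(\beta_X,\beta_Y):=\min_{\beta_{XY}\in\overline{\Pi}(\beta_X,\beta_Y):\ \{(x,y):\beta_{XY}(x,y)<0\}\subseteq\mathcal{S}}\ \sum_{x,y}\beta_{XY}(x,y)c(x,y),$$ where $\overline{\Pi}(\beta_X,\beta_Y)$ is the set of signed measures on $\mathcal{X}\times\mathcal{Y}$ whose $X$- and $Y$-marginals are $\beta_X$ and $\beta_Y$.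 (The function $\theta$ does not depend on the choice of the optimal coupling $P^*_{XY}$.) $\log$ is the natural logarithm. Conventions: $\inf\emptyset=+\infty$, $-\log0=+\infty$. *)

theory Defs
  imports "HOL-Probability.Probability"
begin

definition couplings :: "'a pmf \<Rightarrow> 'b pmf \<Rightarrow> ('a \<times> 'b) pmf set" where
  "couplings P Q = {R. map_pmf fst R = P \<and> map_pmf snd R = Q}"

(* All minima are written as infima.  For finitely supported P and Q the set of couplings is
   nonempty and compact, so the infimum below and the one in excess_prob are attained. *)
definition transport_cost :: "('a \<times> 'b \<Rightarrow> real) \<Rightarrow> 'a pmf \<Rightarrow> 'b pmf \<Rightarrow> real" where
  "transport_cost c P Q = (INF R\<in>couplings P Q. measure_pmf.expectation R c)"

definition optimal_coupling ::
    "('a \<times> 'b \<Rightarrow> real) \<Rightarrow> 'a pmf \<Rightarrow> 'b pmf \<Rightarrow> ('a \<times> 'b) pmf \<Rightarrow> bool" where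
  "optimal_coupling c P Q R \<longleftrightarrow>
     R \<in> couplings P Q \<and> measure_pmf.expectation R c = transport_cost c P Q"

(* n-tuples are functions on nat that are undefined outside {..<n}. *)
definition product_pmf :: "nat \<Rightarrow> 'a pmf \<Rightarrow> (nat \<Rightarrow> 'a) pmf" where
  "product_pmf n P = Pi_pmf {..<n} undefined (\<lambda>_. P)"

definition avg_cost ::
    "('a \<times> 'b \<Rightarrow> real) \<Rightarrow> nat \<Rightarrow> (nat \<Rightarrow> 'a) \<times> (nat \<Rightarrow> 'b) \<Rightarrow> real" where
  "avg_cost c n = (\<lambda>(xs, ys). (\<Sum>i<n. c (xs i, ys i)) / real n)"

definition excess_prob ::
    "('a \<times> 'b \<Rightarrow> real) \<Rightarrow> 'a pmf \<Rightarrow> 'b pmf \<Rightarrow> nat \<Rightarrow> real \<Rightarrow> real" where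
  "excess_prob c P Q n \<alpha> =
     (INF R\<in>couplings (product_pmf n P) (product_pmf n Q).
        measure_pmf.prob R {z. avg_cost c n z > \<alpha>})"

definition zero_mass :: "('a::finite \<Rightarrow> real) set" where
  "zero_mass = {\<beta>. (\<Sum>x\<in>UNIV. \<beta> x) = 0}"

definition signed_couplings ::
    "('a::finite \<Rightarrow> real) \<Rightarrow> ('b::finite \<Rightarrow> real) \<Rightarrow> ('a \<times> 'b \<Rightarrow> real) set" where
  "signed_couplings \<beta>X \<beta>Y =
     {\<beta>. (\<forall>x. (\<Sum>y\<in>UNIV. \<beta> (x, y)) = \<beta>X x) \<and> (\<forall>y. (\<Sum>x\<in>UNIV. \<beta> (x, y)) = \<beta>Y y)}"

(* The set S is meant to be the support of an optimal coupling. *)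
definition theta ::
    "('a::finite \<times> 'b::finite \<Rightarrow> real) \<Rightarrow> ('a \<times> 'b) set \<Rightarrow> ('a \<Rightarrow> real) \<Rightarrow> ('b \<Rightarrow> real) \<Rightarrow> ereal" where
  "theta c S \<beta>X \<beta>Y =
     (INF \<beta>\<in>{\<beta> \<in> signed_couplings \<beta>X \<beta>Y. {z. \<beta> z < 0} \<subseteq> S}.
        ereal (\<Sum>z\<in>UNIV. \<beta> z * c z))"

definition weighted_sq :: "'a::finite pmf \<Rightarrow> ('a \<Rightarrow> real) \<Rightarrow> real" where
  "weighted_sq P \<beta> = (\<Sum>x\<in>UNIV. (\<beta> x)\<^sup>2 / pmf P x)"

definition f_tilde ::
    "('a::finite \<times> 'b::finite \<Rightarrow> real) \<Rightarrow> ('a \<times> 'b) set \<Rightarrow> 'a pmf \<Rightarrow> 'b pmf \<Rightarrow> real \<Rightarrow> ereal" where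
  "f_tilde c S P Q \<Delta> =
     (INF (\<beta>X, \<beta>Y)\<in>{(\<beta>X, \<beta>Y). \<beta>X \<in> zero_mass \<and> \<beta>Y \<in> zero_mass \<and> theta c S \<beta>X \<beta>Y \<le> ereal \<Delta>}.
        ereal (max (1/2 * weighted_sq P \<beta>X) (1/2 * weighted_sq Q \<beta>Y)))"

(* th is theta, or theta with its two arguments exchanged. *)
definition g_one_sided ::
    "(('a::finite \<Rightarrow> real) \<Rightarrow> ('b::finite \<Rightarrow> real) \<Rightarrow> ereal) \<Rightarrow> 'a pmf \<Rightarrow> 'b pmf \<Rightarrow> real \<Rightarrow> ereal" where
  "g_one_sided th P Q \<Delta> =
     (INF \<beta>1\<in>{\<beta>1 \<in> zero_mass.
               (INF \<beta>2\<in>{\<beta>2 \<in> zero_mass. weighted_sq Q \<beta>2 \<le> weighted_sq P \<beta>1}. th \<beta>1 \<beta>2) > ereal \<Delta>}.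
        ereal (1/2 * weighted_sq P \<beta>1))"

definition g_tilde ::
    "('a::finite \<times> 'b::finite \<Rightarrow> real) \<Rightarrow> ('a \<times> 'b) set \<Rightarrow> 'a pmf \<Rightarrow> 'b pmf \<Rightarrow> real \<Rightarrow> ereal" where
  "g_tilde c S P Q \<Delta> =
     min (g_one_sided (theta c S) P Q \<Delta>)
         (g_one_sided (\<lambda>\<beta>Y \<beta>X. theta c S \<beta>X \<beta>Y) Q P \<Delta>)"

(* ln 0 = 0 in the library, hence the explicit case. *)
definition neg_log :: "real \<Rightarrow> ereal" where
  "neg_log p = (if p = 0 then \<infinity> else ereal (- ln p))"

end

(* Write e n = 1 / sqrt (n a n), so that n (e n)^2 = 1 / a n, and let the deviation of a word x be (type of x - P) / e n.
   A deviation b has probability about exp (- weighted_sq P b / (2 a n)): Chernoff bounds for finitely many half-spaces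
   give the upper bound for the complement of a ball, the change of measure to P + e n * b the lower bound for a
   neighbourhood of b.

   The joint type of a pair of words minus Pstar, divided by e n, is admissible in the definition of theta, so average
   cost at most \<alpha>0 + \<Delta> e n always forces theta <= \<Delta> for the two deviations. Conversely, if theta < \<Delta> with some room,
   then one of the words can be permuted so that the average cost becomes at most \<alpha>0 + \<Delta> e n, and exchangeability of
   product laws makes such rearrangements free of charge.

   Couplings come from a Hall/Strassen theorem: the excess probability is at most d as soon as P C <= Q (N C) + d for
   all sets C of words, N C being the neighbourhood of C. For \<Delta> > 0 either C or the complement of N C keeps
   away from deviation 0, and by symmetry one may assume that C does. Its deviation b of least norm determines the
   probability of C. If this norm is below the threshold for some \<Delta>' < \<Delta>, then b has a partner of at most the same norm
   at theta-distance \<Delta>'. Shrinking the partner slightly uses up the room between \<Delta>' and \<Delta> and makes its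
   neighbourhood exponentially more likely than C. *)
theory Submission
  imports Defs "HOL-Real_Asymp.Real_Asymp"
begin

section \<open>Types of words and Chernoff bounds\<close>

text \<open>All estimates are sharp only up to factors exp (o(1) / a n), so every comparison of
  probabilities needs strict room in the exponent; where that room comes from shapes the proof. For
  \<Delta> < 0 it comes from homogeneity: multiplying a plan by t > 1 pushes a negative cost below
  \<Delta> and multiplies the squared norm by only t^2, so a genuine limit results. For \<Delta> > 0
  a deviation and its partner may have equal norms, and this tie is broken by giving away a little
  of \<Delta>; the price is the left limit. Hall's condition must hold for all sets C from some n
  on, whereas each estimate holds eventually for a fixed deviation; finite nets bridge this
  difference. Passing from real-valued plans to words costs only rounding, a bounded amount of total
  cost, while the gap available in the total cost is of order n * e n and tends to infinity.\<close>

lemma pmf_of_finite_function: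
  fixes f :: "'a \<Rightarrow> real"
  assumes "finite A" "\<And>x. 0 \<le> f x" "\<And>x. x \<notin> A \<Longrightarrow> f x = 0" "sum f A = 1"
  obtains p where "\<And>x. pmf p x = f x"
proof -
  have "(\<integral>\<^sup>+x. ennreal (f x) \<partial>count_space UNIV) = (\<Sum>x\<in>A. ennreal (f x))"
    using assms by (intro nn_integral_count_space') auto
  also have "\<dots> = 1"
    using assms by (subst sum_ennreal) auto
  finally have "pmf (embed_pmf f) x = f x" for x
    using assms by (intro pmf_embed_pmf) auto
  then show ?thesis by (rule that)
qed

lemma expectation_finite_type:
  fixes P :: "'a::finite pmf"
  shows "measure_pmf.expectation P f = (\<Sum>x\<in>UNIV. pmf P x * f x)"
  using integral_measure_pmf_real[of UNIV P f] by (simp add: mult.commute)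

lemma sum_pmf_UNIV: "(\<Sum>x\<in>UNIV. pmf (P :: 'a::finite pmf) x) = 1"
  by (rule sum_pmf_eq_1) auto

lemma finite_set_product_pmf: "finite (set_pmf (product_pmf n (P :: 'a::finite pmf)))"
  unfolding product_pmf_def by (subst set_Pi_pmf) auto

text \<open>The coefficient 1/2 has to be exact, since it becomes the 1/2 of the rate functions. The
  remainder may be crude: the exponents in use are multiples of \<open>e n\<close>, and n * (e n)^3
  is negligible against n * (e n)^2 = 1 / a n.\<close>

lemma exp_cubic_upper:
  fixes v :: real
  assumes "\<bar>v\<bar> \<le> 1"
  shows "exp v \<le> 1 + v + v\<^sup>2 / 2 + \<bar>v\<bar> ^ 3"
proof -
  obtain t where t: "\<bar>t\<bar> \<le> \<bar>v\<bar>" "exp v = (\<Sum>m<3. v ^ m / fact m) + exp t / fact 3 * v ^ 3"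
    using Maclaurin_exp_le[of v 3] by blast
  have "exp t \<le> exp 1" using t(1) assms by simp
  also have "exp 1 \<le> (3::real)" by (rule exp_le)
  finally have "exp t / 6 * \<bar>v\<bar> ^ 3 \<le> 1 * \<bar>v\<bar> ^ 3" by (intro mult_right_mono) auto
  moreover have "exp t / 6 * v ^ 3 \<le> exp t / 6 * \<bar>v\<bar> ^ 3"
    by (intro mult_left_mono) (auto simp: power_abs[symmetric])
  moreover have "exp v = 1 + v + v\<^sup>2 / 2 + exp t / 6 * v ^ 3"
    using t(2) by (simp add: eval_nat_numeral)
  ultimately show ?thesis by linarith
qed

text \<open>Exponential Markov inequality with parameter l. Replacing 1 + B by exp B turns the
  product over the n letters into a multiple of the exponent, and \<open>l * K \<le> 1\<close> keeps
  every exponent in the range of \<open>exp_cubic_upper\<close>.\<close>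

lemma chernoff:
  fixes P :: "'a::finite pmf"
  assumes w: "\<And>x. \<bar>w x\<bar> \<le> K" and l: "0 \<le> l" "l * K \<le> 1"
  shows "measure_pmf.prob (product_pmf n P) {x. s \<le> (\<Sum>i<n. w (x i))}
     \<le> exp (real n * (l * measure_pmf.expectation P w + l\<^sup>2 / 2 * measure_pmf.expectation P (\<lambda>x. (w x)\<^sup>2) + l ^ 3 * K ^ 3) - l * s)"
proof -
  let ?Q = "product_pmf n P"
  let ?B = "l * measure_pmf.expectation P w + l\<^sup>2 / 2 * measure_pmf.expectation P (\<lambda>x. (w x)\<^sup>2) + l ^ 3 * K ^ 3"
  have int: "integrable (measure_pmf ?Q) f" for f :: "_ \<Rightarrow> real"
    by (rule integrable_measure_pmf_finite) (rule finite_set_product_pmf)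
  have "measure_pmf.expectation P (\<lambda>x. exp (l * w x))
      \<le> measure_pmf.expectation P (\<lambda>x. 1 + l * w x + l\<^sup>2 / 2 * (w x)\<^sup>2 + l ^ 3 * K ^ 3)"
  proof (rule integral_mono)
    fix x
    have le: "\<bar>l * w x\<bar> \<le> l * K" using w[of x] l by (simp add: abs_mult mult_left_mono)
    then have "exp (l * w x) \<le> 1 + l * w x + (l * w x)\<^sup>2 / 2 + \<bar>l * w x\<bar> ^ 3"
      using l by (intro exp_cubic_upper) linarith
    also have "\<bar>l * w x\<bar> ^ 3 \<le> (l * K) ^ 3" using le by (intro power_mono) auto
    finally show "exp (l * w x) \<le> 1 + l * w x + l\<^sup>2 / 2 * (w x)\<^sup>2 + l ^ 3 * K ^ 3"
      by (simp add: power_mult_distrib)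
  qed (auto intro!: integrable_measure_pmf_finite)
  also have "\<dots> = 1 + ?B"
    by (simp add: integrable_measure_pmf_finite)
  also have "\<dots> \<le> exp ?B" by (rule exp_ge_add_one_self)
  finally have mgf: "measure_pmf.expectation P (\<lambda>x. exp (l * w x)) \<le> exp ?B" .
  have "measure_pmf.prob ?Q {x. s \<le> (\<Sum>i<n. w (x i))}
      = measure_pmf.expectation ?Q (indicator {x. s \<le> (\<Sum>i<n. w (x i))})"
    by simp
  also have "\<dots> \<le> measure_pmf.expectation ?Q (\<lambda>x. exp (- l * s) * (\<Prod>i<n. exp (l * w (x i))))"
  proof (rule integral_mono)
    fix x
    have "1 \<le> exp (l * ((\<Sum>i<n. w (x i)) - s))" if "s \<le> (\<Sum>i<n. w (x i))"
      using that l mult_nonneg_nonneg[of l "(\<Sum>i<n. w (x i)) - s"] by simp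
    moreover have "exp (- l * s) * (\<Prod>i<n. exp (l * w (x i))) = exp (l * ((\<Sum>i<n. w (x i)) - s))"
      unfolding exp_sum[OF finite_lessThan, symmetric] exp_add[symmetric] sum_distrib_left[symmetric]
      by (simp add: algebra_simps)
    ultimately show "indicator {x. s \<le> (\<Sum>i<n. w (x i))} x \<le> exp (- l * s) * (\<Prod>i<n. exp (l * w (x i)))"
      by (auto simp: indicator_def simp del: one_le_exp_iff)
  qed (rule int)+
  also have "\<dots> = exp (- l * s) * (\<Prod>i<n. measure_pmf.expectation P (\<lambda>x. exp (l * w x)))"
    unfolding product_pmf_def
    by (simp, subst expectation_prod_Pi_pmf) (auto intro!: integrable_measure_pmf_finite)
  also have "\<dots> \<le> exp (- l * s) * exp ?B ^ n"
    using mgf by (auto intro!: mult_left_mono power_mono)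
  also have "\<dots> = exp (real n * ?B - l * s)"
    unfolding exp_of_nat_mult[symmetric] exp_add[symmetric] by (simp add: algebra_simps)
  finally show ?thesis .
qed

text \<open>The scale is an argument and the alphabet is arbitrary, so that the same function also
  measures the joint type of two words against a coupling.\<close>

definition dev :: "(nat \<Rightarrow> real) \<Rightarrow> 'a pmf \<Rightarrow> nat \<Rightarrow> (nat \<Rightarrow> 'a) \<Rightarrow> 'a \<Rightarrow> real" where
  "dev e P n x = (\<lambda>z. (real (card {i. i < n \<and> x i = z}) / real n - pmf P z) / e n)"

lemma sum_counts:
  fixes x :: "nat \<Rightarrow> 'a::finite" and w :: "'a \<Rightarrow> real"
  shows "(\<Sum>i<n. w (x i)) = (\<Sum>z\<in>UNIV. real (card {i. i < n \<and> x i = z}) * w z)"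
proof -
  have "(\<Sum>i<n. w (x i)) = (\<Sum>i<n. \<Sum>z\<in>UNIV. if x i = z then w z else 0)"
    by simp
  also have "\<dots> = (\<Sum>z\<in>UNIV. \<Sum>i<n. if x i = z then w z else 0)"
    by (rule sum.swap)
  also have "\<dots> = (\<Sum>z\<in>UNIV. real (card {i. i < n \<and> x i = z}) * w z)"
  proof (rule sum.cong)
    fix z
    show "(\<Sum>i<n. if x i = z then w z else 0) = real (card {i. i < n \<and> x i = z}) * w z"
      by (subst sum.inter_filter[symmetric]) auto
  qed simp
  finally show ?thesis .
qed

text \<open>Linear functionals of the deviation are centred sums over the letters, the form that
  \<open>chernoff\<close> controls.\<close>

lemma sum_dev:
  fixes P :: "'a::finite pmf"
  assumes "n \<ge> 1" "e n \<noteq> 0"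
  shows "(\<Sum>z\<in>UNIV. dev e P n x z * w z)
     = ((\<Sum>i<n. w (x i)) - real n * measure_pmf.expectation P w) / (real n * e n)"
proof -
  have "(\<Sum>z\<in>UNIV. dev e P n x z * w z)
     = (\<Sum>z\<in>UNIV. (real (card {i. i < n \<and> x i = z}) * w z) / (real n * e n) - pmf P z * w z / e n)"
    by (rule sum.cong) (auto simp: dev_def diff_divide_distrib left_diff_distrib)
  also have "\<dots> = (\<Sum>i<n. w (x i)) / (real n * e n) - measure_pmf.expectation P w / e n"
    unfolding sum_counts expectation_finite_type by (simp add: sum_subtractf sum_divide_distrib)
  finally show ?thesis using assms by (simp add: field_simps)
qed

lemma dev_zero_mass:
  fixes P :: "'a::finite pmf"
  assumes "n \<ge> 1" "e n \<noteq> 0"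
  shows "dev e P n x \<in> zero_mass"
  using sum_dev[of n e P x "\<lambda>_. 1", OF assms] by (simp add: zero_mass_def)

(* One representative in every nonempty cell of a cubic grid. *)
lemma finite_net:
  fixes S :: "('a::finite \<Rightarrow> real) set"
  assumes "h > 0" and bd: "\<And>v x. v \<in> S \<Longrightarrow> \<bar>v x\<bar> \<le> K"
  obtains F where "finite F" "F \<subseteq> S" "\<And>v. v \<in> S \<Longrightarrow> \<exists>b\<in>F. \<forall>x. \<bar>v x - b x\<bar> \<le> h"
proof -
  define g where "g = (\<lambda>(v :: 'a \<Rightarrow> real) x. \<lfloor>v x / h\<rfloor>)"
  have "g v \<in> (UNIV \<rightarrow>\<^sub>E {\<lfloor>- K / h\<rfloor>..\<lfloor>K / h\<rfloor>})" if "v \<in> S" for v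
  proof -
    have "- K / h \<le> v x / h \<and> v x / h \<le> K / h" for x
    proof -
      have "- K \<le> v x" "v x \<le> K" using bd[OF that, of x] by auto
      then show ?thesis using \<open>h > 0\<close> by (intro conjI divide_right_mono) auto
    qed
    then show ?thesis by (auto simp: g_def PiE_UNIV_domain intro!: floor_mono)
  qed
  then have "g ` S \<subseteq> (UNIV \<rightarrow>\<^sub>E {\<lfloor>- K / h\<rfloor>..\<lfloor>K / h\<rfloor>})" by blast
  then have fin: "finite (g ` S)"
    by (rule finite_subset) (auto intro!: finite_PiE)
  define r where "r = inv_into S g"
  show ?thesis
  proof (rule that[of "r ` g ` S"])
    show "finite (r ` g ` S)" using fin by (rule finite_imageI)
    show "r ` g ` S \<subseteq> S" by (auto simp: r_def intro: inv_into_into)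
    fix v assume v: "v \<in> S"
    have eq: "g (r (g v)) = g v" unfolding r_def by (rule f_inv_into_f[of "g v" g S]) (use v in blast)
    have "\<bar>v x - r (g v) x\<bar> \<le> h" for x
    proof -
      have "\<lfloor>r (g v) x / h\<rfloor> = \<lfloor>v x / h\<rfloor>" using fun_cong[OF eq, of x] by (simp add: g_def)
      then have "\<bar>v x / h - r (g v) x / h\<bar> \<le> 1" by linarith
      then have "\<bar>(v x - r (g v) x) / h\<bar> \<le> 1" by (simp add: diff_divide_distrib)
      then show ?thesis using \<open>h > 0\<close> by (simp add: field_simps)
    qed
    then show "\<exists>b\<in>r ` g ` S. \<forall>x. \<bar>v x - b x\<bar> \<le> h" using v by blast
  qed
qed

section \<open>Moderate deviations\<close>

lemma prob_le_scale:
  assumes fin: "finite (set_pmf W)" "finite (set_pmf P)"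
    and le: "\<And>x. x \<in> A \<Longrightarrow> pmf W x \<le> C * pmf P x"
  shows "measure_pmf.prob W A \<le> C * measure_pmf.prob P A"
proof -
  let ?F = "A \<inter> (set_pmf W \<union> set_pmf P)"
  have "measure_pmf.prob W A = measure_pmf.prob W ?F" "measure_pmf.prob P A = measure_pmf.prob P ?F"
    by (auto intro!: measure_prob_cong_0 simp: set_pmf_iff)
  moreover have "finite ?F" using fin by auto
  ultimately show ?thesis
    using le by (auto simp: measure_measure_pmf_finite sum_distrib_left intro!: sum_mono)
qed

text \<open>For v = e n * b / P the mean of the left side under P is the entropy of the tilted law
  relative to P. The linear term averages to zero when b has total mass zero, and the quadratic one
  produces 1/2 * \<open>weighted_sq P b\<close>.\<close>

lemma entropy_integrand_bound:
  fixes d :: real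
  assumes "d > 0"
  shows "\<forall>\<^sub>F v in nhds 0. (1 + v) * ln (1 + v) \<le> v + (1 / 2 + d) * v\<^sup>2"
proof -
  have "((\<lambda>v::real. ((1 + v) * ln (1 + v) - v) / v\<^sup>2) \<longlongrightarrow> 1 / 2) (at 0)"
    by real_asymp
  then have "\<forall>\<^sub>F v in at (0::real). ((1 + v) * ln (1 + v) - v) / v\<^sup>2 < 1 / 2 + d"
    by (rule order_tendstoD) (use assms in simp)
  then have "\<forall>\<^sub>F v in at (0::real). (1 + v) * ln (1 + v) \<le> v + (1 / 2 + d) * v\<^sup>2"
    by (rule eventually_mono[OF eventually_conj[OF _ eventually_neq_at_within[of 0]]])
      (auto simp: pos_divide_less_eq)
  then show ?thesis
    by (simp add: eventually_nhds_conv_at)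
qed

section \<open>The weighted squared norm of a deviation\<close>

lemma weighted_sq_nonneg: "0 \<le> weighted_sq P b"
  by (auto simp: weighted_sq_def intro!: sum_nonneg)

lemma weighted_sq_scale: "weighted_sq P (\<lambda>x. t * b x) = t\<^sup>2 * weighted_sq P b"
  by (simp add: weighted_sq_def power_mult_distrib sum_distrib_left)

lemma sq_le_weighted_sq:
  assumes "set_pmf P = UNIV"
  shows "(b x)\<^sup>2 \<le> weighted_sq P b"
proof -
  have pos: "0 < pmf P x" using assms by (simp add: pmf_positive)
  have "(b x)\<^sup>2 * pmf P x \<le> (b x)\<^sup>2 * 1" by (intro mult_left_mono) (auto simp: pmf_le_1)
  then have "(b x)\<^sup>2 \<le> (b x)\<^sup>2 / pmf P x" using pos by (simp add: field_simps)
  also have "\<dots> \<le> weighted_sq P b"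
    unfolding weighted_sq_def by (rule member_le_sum) auto
  finally show ?thesis .
qed

text \<open>From t \<le> 1 + t^2; a bound linear in the squared norm keeps square roots out of the
  later constants.\<close>

lemma abs_le_weighted_sq:
  assumes "set_pmf P = UNIV"
  shows "\<bar>b x\<bar> \<le> 1 + weighted_sq P b"
proof (cases "\<bar>b x\<bar> \<le> 1")
  case True
  then show ?thesis using weighted_sq_nonneg[of P b] by linarith
next
  case False
  then have "\<bar>b x\<bar> * 1 \<le> \<bar>b x\<bar> * \<bar>b x\<bar>" by (intro mult_left_mono) auto
  then show ?thesis using sq_le_weighted_sq[OF assms, of b x] by (simp add: power2_eq_square)
qed

lemma weighted_sq_lipschitz:
  fixes P :: "'a::finite pmf"
  assumes P: "set_pmf P = UNIV" and L: "\<And>x. \<bar>b x\<bar> \<le> L" and r: "0 \<le> r" "r \<le> 1" and v: "\<And>x. \<bar>v x - b x\<bar> \<le> r"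
  shows "weighted_sq P b - r * (\<Sum>x\<in>UNIV. (2 * L + 1) / pmf P x) \<le> weighted_sq P v"
proof -
  have pos: "0 < pmf P x" for x using P by (simp add: pmf_positive)
  have "weighted_sq P b - weighted_sq P v = (\<Sum>x\<in>UNIV. ((b x)\<^sup>2 - (v x)\<^sup>2) / pmf P x)"
    by (simp add: weighted_sq_def sum_subtractf diff_divide_distrib)
  also have "\<dots> \<le> (\<Sum>x\<in>UNIV. r * ((2 * L + 1) / pmf P x))"
  proof (rule sum_mono)
    fix x
    have "(b x)\<^sup>2 - (v x)\<^sup>2 = (b x - v x) * (b x + v x)" by (simp add: power2_eq_square algebra_simps)
    also have "\<dots> \<le> \<bar>b x - v x\<bar> * \<bar>b x + v x\<bar>" by (metis abs_ge_self abs_mult)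
    also have "\<dots> \<le> r * (2 * L + 1)"
      using L[of x] v[of x] r by (intro mult_mono) linarith+
    finally show "((b x)\<^sup>2 - (v x)\<^sup>2) / pmf P x \<le> r * ((2 * L + 1) / pmf P x)"
      using pos[of x] by (simp add: divide_right_mono less_imp_le)
  qed
  finally show ?thesis by (simp add: sum_distrib_left)
qed

section \<open>Asymptotics at the moderate scale\<close>

locale moderate_scale =
  fixes a :: "nat \<Rightarrow> real"
  assumes a_pos: "\<And>n. n \<ge> 1 \<Longrightarrow> a n > 0"
    and a_lim: "a \<longlonglongrightarrow> 0"
    and na_lim: "filterlim (\<lambda>n. real n * a n) at_top sequentially"
begin

definition e :: "nat \<Rightarrow> real" where "e n = 1 / sqrt (real n * a n)"

lemma e_pos: "n \<ge> 1 \<Longrightarrow> e n > 0"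
  using a_pos[of n] by (simp add: e_def)

lemma n_e_sq: "n \<ge> 1 \<Longrightarrow> real n * (e n)\<^sup>2 = 1 / a n"
  using a_pos[of n] by (simp add: e_def power_divide)

lemma e_lim: "e \<longlonglongrightarrow> 0"
proof -
  have "filterlim (\<lambda>n. sqrt (real n * a n)) at_top sequentially"
    by (rule filterlim_compose[OF sqrt_at_top na_lim])
  then show ?thesis unfolding e_def by (rule tendsto_divide_0[OF tendsto_const filterlim_at_top_imp_at_infinity])
qed

lemma ev_ge1: "\<forall>\<^sub>F n in sequentially. n \<ge> (1::nat)"
  by (rule eventually_ge_at_top)

lemma inverse_a_at_top: "filterlim (\<lambda>n. 1 / a n) at_top sequentially"
proof -
  have "\<forall>\<^sub>F n in sequentially. 0 < a n"
    using ev_ge1 by eventually_elim (rule a_pos)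
  then show ?thesis
    using filterlim_inverse_at_top[OF a_lim] by (simp add: inverse_eq_divide)
qed

lemma ev_e_small: "d > 0 \<Longrightarrow> \<forall>\<^sub>F n in sequentially. C * e n < d"
  by (rule order_tendstoD(2)[OF tendsto_mult_right_zero[OF e_lim]])

lemma ev_exp_small:
  assumes "k > 0" "d > 0"
  shows "\<forall>\<^sub>F n in sequentially. exp (- k / a n) \<le> d"
proof -
  have "\<forall>\<^sub>F n in sequentially. - ln d / k \<le> 1 / a n"
    using inverse_a_at_top by (auto simp: filterlim_at_top)
  then show ?thesis
  proof eventually_elim
    case (elim n)
    then have "- k / a n \<le> ln d" using \<open>k > 0\<close> by (simp add: field_simps)
    then show ?case using \<open>d > 0\<close> by (simp add: ln_ge_iff)
  qed
qed

text \<open>Constant factors disappear after an arbitrarily small loss in the rate, because 1 / a n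
  tends to infinity. This pays for all finite union bounds.\<close>

lemma ev_exp_absorb:
  assumes "l < l'" "C > 0"
  shows "\<forall>\<^sub>F n in sequentially. C * exp (- l' / a n) \<le> exp (- l / a n)"
  using ev_exp_small[of "l' - l" "1 / C"] assms
proof (simp, elim eventually_mono)
  fix n assume "exp ((l - l') / a n) \<le> 1 / C"
  then have "C * exp ((l - l') / a n) * exp (- l / a n) \<le> 1 * exp (- l / a n)"
    using assms by (intro mult_right_mono) (auto simp: field_simps)
  then show "C * exp (- (l' / a n)) \<le> exp (- (l / a n))"
    by (simp add: mult.assoc exp_add[symmetric] diff_divide_distrib)
qed

text \<open>A weak law for triangular arrays in which the permitted deviation \<open>e n * t\<close>
  shrinks with n. The total n * e n * t still exceeds fluctuations of order sqrt n, because n * (e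
  n)^2 tends to infinity.\<close>

lemma array_lln:
  fixes W :: "nat \<Rightarrow> 'a::finite pmf"
  assumes w: "\<forall>\<^sub>F n in sequentially. \<forall>x. \<bar>w n x\<bar> \<le> K"
    and mu: "\<forall>\<^sub>F n in sequentially. measure_pmf.expectation (W n) (w n) \<le> mu n"
    and t: "t > 0" and d: "d > 0"
  shows "\<forall>\<^sub>F n in sequentially. measure_pmf.prob (product_pmf n (W n))
     {x. real n * (mu n + e n * t) \<le> (\<Sum>i<n. w n (x i))} \<le> d"
proof -
  define M where "M = max 1 K"
  have M: "M \<ge> 1" "K \<le> M" by (auto simp: M_def)
  \<comment> \<open>This k minimises k^2 * M^2 / 2 - k * t, with value - k * t / 2. Half of the
    value is kept as the final exponent and half absorbs the cubic term.\<close>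
  define k where "k = t / M\<^sup>2"
  have k: "k > 0" using t M by (simp add: k_def)
  have kM: "k * M\<^sup>2 = t" using M by (simp add: k_def)
  have "\<forall>\<^sub>F n in sequentially. k * M * e n < 1" "\<forall>\<^sub>F n in sequentially. k ^ 3 * M ^ 3 * e n < k * t / 4"
    "\<forall>\<^sub>F n in sequentially. exp (- (k * t / 4) / a n) \<le> d"
    using k t d by (intro ev_e_small ev_exp_small; simp)+
  then show ?thesis using w mu ev_ge1
  proof eventually_elim
    case (elim n)
    let ?E1 = "measure_pmf.expectation (W n) (w n)"
    let ?E2 = "measure_pmf.expectation (W n) (\<lambda>x. (w n x)\<^sup>2)"
    define l where "l = k * e n"
    have e: "e n > 0" and an: "a n > 0" using elim e_pos a_pos by auto
    have wM: "\<bar>w n x\<bar> \<le> M" for x using elim(4) M order.trans by blast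
    have E2: "?E2 \<le> M\<^sup>2"
    proof -
      have "?E2 \<le> measure_pmf.expectation (W n) (\<lambda>x. M\<^sup>2)"
        using power_mono[OF wM, of _ 2] by (intro integral_mono) (auto intro!: integrable_measure_pmf_finite)
      then show ?thesis by simp
    qed
    have l: "0 \<le> l" "l * M \<le> 1" using k e elim(1) by (auto simp: l_def mult_ac)
    have "measure_pmf.prob (product_pmf n (W n)) {x. real n * (mu n + e n * t) \<le> (\<Sum>i<n. w n (x i))}
       \<le> exp (real n * (l * ?E1 + l\<^sup>2 / 2 * ?E2 + l ^ 3 * M ^ 3) - l * (real n * (mu n + e n * t)))"
      using wM l by (rule chernoff)
    also have "\<dots> \<le> exp (- (k * t / 4) / a n)"
    proof (subst exp_le_cancel_iff)
      have "l * ?E1 + l\<^sup>2 / 2 * ?E2 + l ^ 3 * M ^ 3 - l * (mu n + e n * t)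
          \<le> l * mu n + l\<^sup>2 / 2 * M\<^sup>2 + l ^ 3 * M ^ 3 - l * (mu n + e n * t)"
        using elim(5) E2 l by (intro add_mono diff_right_mono mult_left_mono) auto
      also have "\<dots> = (e n)\<^sup>2 * (k * (k * M\<^sup>2) / 2 + k ^ 3 * M ^ 3 * e n - k * t)"
        by (simp add: l_def power2_eq_square eval_nat_numeral algebra_simps)
      also have "\<dots> \<le> (e n)\<^sup>2 * (- (k * t / 4))"
        using elim(2) unfolding kM by (intro mult_left_mono) auto
      finally have "real n * (l * ?E1 + l\<^sup>2 / 2 * ?E2 + l ^ 3 * M ^ 3 - l * (mu n + e n * t))
          \<le> real n * ((e n)\<^sup>2 * (- (k * t / 4)))"
        by (intro mult_left_mono) auto
      also have "\<dots> = - (k * t / 4) / a n"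
        using n_e_sq[OF elim(6)] by (simp flip: mult.assoc)
      finally show "real n * (l * ?E1 + l\<^sup>2 / 2 * ?E2 + l ^ 3 * M ^ 3) - l * (real n * (mu n + e n * t))
          \<le> - (k * t / 4) / a n"
        by (simp add: algebra_simps)
    qed
    finally show ?case using elim(3) by linarith
  qed
qed

text \<open>The Chernoff parameter is \<open>e n\<close> itself, so the tilt is carried by the
  normalisation of w. The choice is optimal for s = V, where the rate is V / 2.\<close>

lemma halfspace_tail:
  fixes P :: "'a::finite pmf"
  assumes w0: "measure_pmf.expectation P w = 0" and V: "measure_pmf.expectation P (\<lambda>x. (w x)\<^sup>2) = V"
    and h: "h > 0"
  shows "\<forall>\<^sub>F n in sequentially. measure_pmf.prob (product_pmf n P)
     {x. real n * e n * s \<le> (\<Sum>i<n. w (x i))} \<le> exp (- (s - V / 2 - h) / a n)"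
proof -
  define K where "K = Max (range (\<lambda>x. \<bar>w x\<bar>))"
  have w: "\<bar>w x\<bar> \<le> K" for x unfolding K_def by (rule Max_ge) auto
  have "\<forall>\<^sub>F n in sequentially. K * e n < 1" "\<forall>\<^sub>F n in sequentially. K ^ 3 * e n < h"
    using h by (intro ev_e_small; simp)+
  then show ?thesis using ev_ge1
  proof eventually_elim
    case (elim n)
    have e: "e n > 0" and an: "a n > 0" using elim e_pos a_pos by auto
    have "measure_pmf.prob (product_pmf n P) {x. real n * e n * s \<le> (\<Sum>i<n. w (x i))}
       \<le> exp (real n * (e n * measure_pmf.expectation P w + (e n)\<^sup>2 / 2 * measure_pmf.expectation P (\<lambda>x. (w x)\<^sup>2)
               + (e n) ^ 3 * K ^ 3) - e n * (real n * e n * s))"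
      using e elim w by (intro chernoff) (auto simp: mult_ac)
    also have "\<dots> = exp ((real n * (e n)\<^sup>2) * (V / 2 + K ^ 3 * e n - s))"
      unfolding w0 V by (simp add: power2_eq_square eval_nat_numeral algebra_simps)
    also have "\<dots> \<le> exp ((1 / a n) * (V / 2 + h - s))"
      unfolding n_e_sq[OF elim(3)] using elim(2) an by (subst exp_le_cancel_iff, intro mult_left_mono) auto
    also have "(1 / a n) * (V / 2 + h - s) = - (s - V / 2 - h) / a n"
      by (simp add: diff_divide_distrib add_divide_distrib)
    finally show ?case .
  qed
qed

text \<open>For the inner product weighted by 1 / P, the tangent half-space at a point b of the
  sphere of squared norm 2 * l' consists of the v with inner product at least 2 * l' with b, and it
  has rate l'. Moved inwards by h, finitely many such half-spaces cover the outside of the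
  ball.\<close>

lemma dev_norm_tail:
  fixes P :: "'a::finite pmf"
  assumes P: "set_pmf P = UNIV" and l: "l < l'"
  shows "\<forall>\<^sub>F n in sequentially. measure_pmf.prob (product_pmf n P)
     {x. l' \<le> 1 / 2 * weighted_sq P (dev e P n x)} \<le> exp (- l / a n)"
proof (cases "l < 0")
  case True
  show ?thesis using ev_ge1
  proof eventually_elim
    case (elim n)
    have "0 \<le> - l / a n" using True a_pos[OF elim] by (simp add: divide_nonpos_pos)
    then have "1 \<le> exp (- l / a n)" by simp
    then show ?case using measure_pmf.prob_le_1 order.trans by blast
  qed
next
  case False
  then have l0: "l' > 0" using l by linarith
  have pos: "0 < pmf P x" for x using P by (simp add: pmf_positive)
  \<comment> \<open>One h is lost by moving the half-spaces inwards and one in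
    \<open>halfspace_tail\<close>; the remaining l' - 2 * h is still above l and absorbs the number
    of half-spaces.\<close>
  define h where "h = (l' - l) / 4"
  have h: "h > 0" "2 * l' - h \<ge> 0" using l False by (auto simp: h_def)
  define C where "C = (\<Sum>x\<in>UNIV. (1 + 2 * l') / pmf P x)"
  have C: "C > 0" unfolding C_def using l0 pos by (intro sum_pos) auto
  define S where "S = {v \<in> zero_mass. weighted_sq P v = 2 * l'}"
  have bd: "\<bar>v x\<bar> \<le> 1 + 2 * l'" if "v \<in> S" for v x
    using abs_le_weighted_sq[OF P, of v x] that by (simp add: S_def)
  obtain F where F: "finite F" "F \<subseteq> S" "\<And>v. v \<in> S \<Longrightarrow> \<exists>b\<in>F. \<forall>x. \<bar>v x - b x\<bar> \<le> h / C"
    using finite_net[of "h / C" S "1 + 2 * l'"] bd h C by (metis divide_pos_pos)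
  define w where "w = (\<lambda>b x. b x / pmf P x)"
  let ?H = "\<lambda>n b. {x. real n * e n * (2 * l' - h) \<le> (\<Sum>i<n. w b (x i))}"
  have Ew: "measure_pmf.expectation P (w b) = 0" "measure_pmf.expectation P (\<lambda>x. (w b x)\<^sup>2) = 2 * l'" if "b \<in> S" for b
  proof -
    have "pmf P x * w b x = b x" "pmf P x * (w b x)\<^sup>2 = (b x)\<^sup>2 / pmf P x" for x
      using pos[of x] by (auto simp: w_def power2_eq_square)
    then show "measure_pmf.expectation P (w b) = 0" "measure_pmf.expectation P (\<lambda>x. (w b x)\<^sup>2) = 2 * l'"
      using that by (auto simp: expectation_finite_type S_def zero_mass_def weighted_sq_def)
  qed
  have cover: "{x. l' \<le> 1 / 2 * weighted_sq P (dev e P n x)} \<subseteq> (\<Union>b\<in>F. ?H n b)" if n: "n \<ge> 1" for n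
  proof
    fix x assume "x \<in> {x. l' \<le> 1 / 2 * weighted_sq P (dev e P n x)}"
    then have big: "2 * l' \<le> weighted_sq P (dev e P n x)" by simp
    have en: "e n > 0" using e_pos n .
    define q where "q = weighted_sq P (dev e P n x)"
    \<comment> \<open>Radial projection onto the sphere. Since t \<le> 1 and the pairing with b
      turns out nonnegative, the half-space inequality passes from the projection u to the deviation
      itself.\<close>
    define t where "t = sqrt (2 * l' / q)"
    have t: "0 < t" "t \<le> 1" using l0 big by (auto simp: t_def q_def)
    define u where "u = (\<lambda>z. t * dev e P n x z)"
    have "t\<^sup>2 * q = 2 * l'" using l0 big by (simp add: t_def q_def)
    then have "weighted_sq P u = 2 * l'" unfolding u_def weighted_sq_scale by (simp add: q_def)
    moreover have "u \<in> zero_mass"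
      using dev_zero_mass[of n e P x] n en by (simp add: u_def zero_mass_def sum_distrib_left[symmetric])
    ultimately have uS: "u \<in> S" by (simp add: S_def)
    then obtain b where b: "b \<in> F" "\<And>z. \<bar>u z - b z\<bar> \<le> h / C" using F(3) by blast
    have "2 * l' - (\<Sum>z\<in>UNIV. u z * w b z) = (\<Sum>z\<in>UNIV. u z * (u z - b z) / pmf P z)"
      using \<open>weighted_sq P u = 2 * l'\<close>
      by (simp add: weighted_sq_def w_def sum_subtractf power2_eq_square right_diff_distrib diff_divide_distrib)
    also have "\<dots> \<le> (\<Sum>z\<in>UNIV. (1 + 2 * l') * (h / C) / pmf P z)"
    proof (rule sum_mono)
      fix z
      have "u z * (u z - b z) \<le> \<bar>u z\<bar> * \<bar>u z - b z\<bar>" by (metis abs_ge_self abs_mult)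
      also have "\<dots> \<le> (1 + 2 * l') * (h / C)" using bd[OF uS, of z] b(2)[of z] l0 by (intro mult_mono) auto
      finally show "u z * (u z - b z) / pmf P z \<le> (1 + 2 * l') * (h / C) / pmf P z"
        using pos[of z] by (intro divide_right_mono) auto
    qed
    also have "\<dots> = (\<Sum>z\<in>UNIV. (h / C) * ((1 + 2 * l') / pmf P z))" by (intro sum.cong) (auto simp: mult_ac)
    also have "\<dots> = (h / C) * C" unfolding C_def sum_distrib_left[symmetric] ..
    also have "\<dots> = h" using C by simp
    finally have "2 * l' - h \<le> (\<Sum>z\<in>UNIV. u z * w b z)" by simp
    also have "\<dots> = t * (\<Sum>z\<in>UNIV. dev e P n x z * w b z)"
      by (simp add: u_def sum_distrib_left mult_ac)
    finally have ge: "2 * l' - h \<le> t * (\<Sum>z\<in>UNIV. dev e P n x z * w b z)" .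
    then have "0 \<le> (\<Sum>z\<in>UNIV. dev e P n x z * w b z)"
      using h(2) t(1) by (meson order.trans zero_le_mult_iff not_less)
    then have "t * (\<Sum>z\<in>UNIV. dev e P n x z * w b z) \<le> (\<Sum>z\<in>UNIV. dev e P n x z * w b z)"
      using t by (simp add: mult_left_le_one_le)
    then have "2 * l' - h \<le> (\<Sum>i<n. w b (x i)) / (real n * e n)"
      using ge sum_dev[of n e P x "w b"] n en Ew(1)[of b] b(1) F(2) by auto
    then show "x \<in> (\<Union>b\<in>F. ?H n b)"
      using b(1) n en by (auto simp: field_simps intro!: bexI[of _ b])
  qed
  have "\<forall>\<^sub>F n in sequentially. \<forall>b\<in>F. measure_pmf.prob (product_pmf n P) (?H n b)
     \<le> exp (- (2 * l' - h - 2 * l' / 2 - h) / a n)"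
    using F Ew h by (intro eventually_ball_finite ballI halfspace_tail) auto
  \<comment> \<open>The summand 1 keeps the factor positive when the net is empty, as it is over an
    alphabet with one letter.\<close>
  moreover have "\<forall>\<^sub>F n in sequentially. (real (card F) + 1) * exp (- (l' - 2 * h) / a n) \<le> exp (- l / a n)"
    using l by (intro ev_exp_absorb) (auto simp: h_def field_simps)
  ultimately show ?thesis using ev_ge1
  proof eventually_elim
    case (elim n)
    have "measure_pmf.prob (product_pmf n P) {x. l' \<le> 1 / 2 * weighted_sq P (dev e P n x)}
       \<le> measure_pmf.prob (product_pmf n P) (\<Union>b\<in>F. ?H n b)"
      using cover[OF elim(3)] by (intro measure_pmf.finite_measure_mono) auto
    also have "\<dots> \<le> (\<Sum>b\<in>F. measure_pmf.prob (product_pmf n P) (?H n b))"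
      by (rule measure_pmf.finite_measure_subadditive_finite[OF F(1)]) auto
    also have "\<dots> \<le> (\<Sum>b\<in>F. exp (- (l' - 2 * h) / a n))"
      using elim(1) by (intro sum_mono) (auto simp: algebra_simps)
    also have "\<dots> \<le> (real (card F) + 1) * exp (- (l' - 2 * h) / a n)" by simp
    finally show ?case using elim(2) by linarith
  qed
qed

text \<open>Under the tilted law the mean of the logarithmic density ratio per letter is a relative
  entropy, about (e n)^2 / 2 * \<open>weighted_sq P b\<close>. Over n letters this is 1 / a n times
  a number below u, and the law of large numbers controls the fluctuation.\<close>

lemma tilted_log_likelihood:
  fixes P :: "'a::finite pmf"
  assumes P: "set_pmf P = UNIV" and u: "1 / 2 * weighted_sq P b < u" and d: "d > 0"
    and W: "\<forall>\<^sub>F n in sequentially. \<forall>x. pmf (W n) x = pmf P x + e n * b x" and b: "b \<in> zero_mass"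
  shows "\<forall>\<^sub>F n in sequentially. measure_pmf.prob (product_pmf n (W n))
     {x. u / a n \<le> (\<Sum>i<n. ln (1 + e n * b (x i) / pmf P (x i)))} \<le> d"
proof -
  have pos: "0 < pmf P x" for x using P by (simp add: pmf_positive)
  define q where "q = weighted_sq P b"
  \<comment> \<open>Chosen so that r * q uses at most half of the gap u - q / 2; the 1 in the
    denominator covers q = 0.\<close>
  define r where "r = (u - q / 2) / (2 * (1 + q))"
  have q: "q \<ge> 0" unfolding q_def by (rule weighted_sq_nonneg)
  have r: "r > 0" using u q by (simp add: r_def q_def)
  define t where "t = u - (1 / 2 + r) * q"
  have "r * q \<le> r * (1 + q)" using r by simp
  also have "\<dots> = (u - q / 2) / 2" using q by (simp add: r_def field_simps)
  finally have t: "t > 0" using u by (simp add: t_def q_def algebra_simps)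
  \<comment> \<open>Division by \<open>e n\<close> keeps the summands bounded as n grows and brings
    the threshold into the form mean plus \<open>e n * t\<close> of
    \<open>array_lln\<close>.\<close>
  define w where "w = (\<lambda>n x. ln (1 + e n * b x / pmf P x) / e n)"
  define K where "K = Max (range (\<lambda>x. \<bar>b x / pmf P x\<bar>))"
  have K: "\<bar>b x / pmf P x\<bar> \<le> K" for x unfolding K_def by (rule Max_ge) auto
  have lim: "(\<lambda>n. e n * b x / pmf P x) \<longlonglongrightarrow> 0" for x
    using tendsto_mult_left_zero[OF e_lim, of "b x / pmf P x"] by simp
  have "\<forall>\<^sub>F n in sequentially. \<forall>x. (1 + e n * b x / pmf P x) * ln (1 + e n * b x / pmf P x)
      \<le> e n * b x / pmf P x + (1 / 2 + r) * (e n * b x / pmf P x)\<^sup>2"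
    using eventually_compose_filterlim[OF entropy_integrand_bound[OF r] lim]
    by (intro eventually_all_finite) auto
  then have mu: "\<forall>\<^sub>F n in sequentially. measure_pmf.expectation (W n) (w n) \<le> e n * ((1 / 2 + r) * q)"
    using W ev_ge1
  proof eventually_elim
    case (elim n)
    have en: "e n > 0" using elim e_pos by auto
    have "measure_pmf.expectation (W n) (w n)
        = (\<Sum>x\<in>UNIV. pmf P x * ((1 + e n * b x / pmf P x) * ln (1 + e n * b x / pmf P x)) / e n)"
      unfolding expectation_finite_type
    proof (rule sum.cong)
      fix x
      have "pmf (W n) x = pmf P x * (1 + e n * b x / pmf P x)"
        using elim(2) pos[of x] by (simp add: field_simps)
      then show "pmf (W n) x * w n x = pmf P x * ((1 + e n * b x / pmf P x) * ln (1 + e n * b x / pmf P x)) / e n"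
        by (simp add: w_def)
    qed simp
    also have "\<dots> \<le> (\<Sum>x\<in>UNIV. pmf P x * (e n * b x / pmf P x + (1 / 2 + r) * (e n * b x / pmf P x)\<^sup>2) / e n)"
      using elim(1) en pos by (intro sum_mono divide_right_mono mult_left_mono) (auto simp: less_imp_le)
    also have "\<dots> = (\<Sum>x\<in>UNIV. b x + e n * ((1 / 2 + r) * ((b x)\<^sup>2 / pmf P x)))"
      using en pos by (intro sum.cong) (auto simp: field_simps power2_eq_square less_imp_neq[OF pos, symmetric])
    also have "\<dots> = e n * ((1 / 2 + r) * q)"
      using b by (simp only: sum.distrib sum_distrib_left[symmetric] zero_mass_def q_def weighted_sq_def mem_Collect_eq add_0_left)
    finally show ?case .
  qed
  have bd: "\<forall>\<^sub>F n in sequentially. \<forall>x. \<bar>w n x\<bar> \<le> 2 * K"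
    using ev_e_small[of "1 / 2" K, simplified] ev_ge1
  proof eventually_elim
    case (elim n)
    have en: "e n > 0" using elim e_pos by auto
    show ?case
    proof
      fix x
      let ?v = "e n * b x / pmf P x"
      have v: "\<bar>?v\<bar> \<le> e n * K"
        using mult_left_mono[OF K[of x], of "e n"] en by (simp add: abs_mult)
      then have v2: "\<bar>?v\<bar> \<le> 1 / 2" using elim(1) by (simp add: mult.commute)
      then have "\<bar>ln (1 + ?v) - ?v\<bar> \<le> 2 * ?v\<^sup>2" by (rule abs_ln_one_plus_x_minus_x_bound)
      also have "2 * ?v\<^sup>2 = 2 * (\<bar>?v\<bar> * \<bar>?v\<bar>)" by (simp add: power2_eq_square)
      also have "\<dots> \<le> 2 * (\<bar>?v\<bar> * (1 / 2))" using v2 by (intro mult_left_mono) auto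
      also have "\<dots> = \<bar>?v\<bar>" by simp
      finally have "\<bar>ln (1 + ?v)\<bar> - \<bar>?v\<bar> \<le> \<bar>?v\<bar>" by (rule order.trans[OF abs_triangle_ineq2])
      then have "\<bar>ln (1 + ?v)\<bar> \<le> 2 * (e n * K)" using v by argo
      then show "\<bar>w n x\<bar> \<le> 2 * K" using en by (simp add: w_def abs_divide pos_divide_le_eq mult_ac)
    qed
  qed
  from array_lln[OF bd mu t d] show ?thesis using ev_ge1
  proof eventually_elim
    case (elim n)
    have en: "e n > 0" using elim e_pos by auto
    have "real n * (e n * ((1 / 2 + r) * q) + e n * t) = (real n * (e n)\<^sup>2) * u / e n"
      using en by (simp add: t_def power2_eq_square field_simps)
    then have eq: "real n * (e n * ((1 / 2 + r) * q) + e n * t) = u / a n / e n"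
      using n_e_sq[OF elim(2)] by simp
    have "u / a n / e n \<le> y / e n \<longleftrightarrow> u / a n \<le> y" for y
      using en by (simp only: divide_le_cancel) auto
    then show ?case
      using elim(1) unfolding w_def eq sum_divide_distrib[symmetric] by simp
  qed
qed

text \<open>Each coordinate of the type is an average of indicators with mean
  \<open>pmf P z + e n * b z\<close>, that is, of deviation b z. The signs s = 1 and s = -1 below
  give the two tails.\<close>

lemma tilted_dev_lln:
  fixes P :: "'a::finite pmf"
  assumes r: "r > 0" and d: "d > 0"
    and W: "\<forall>\<^sub>F n in sequentially. \<forall>x. pmf (W n) x = pmf P x + e n * b x"
  shows "\<forall>\<^sub>F n in sequentially. measure_pmf.prob (product_pmf n (W n))
     {x. \<exists>z. \<not> \<bar>dev e P n x z - b z\<bar> \<le> r} \<le> d"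
proof -
  define N where "N = real (card (UNIV :: 'a set))"
  have N: "N > 0" by (simp add: N_def card_gt_0_iff)
  let ?D = "\<lambda>n s z. {x. real n * (measure_pmf.expectation (W n) (\<lambda>y. s * indicator {z} y) + e n * r)
       \<le> (\<Sum>i<n. s * indicator {z} (x i))}"
  have lln: "\<forall>\<^sub>F n in sequentially. \<forall>z. measure_pmf.prob (product_pmf n (W n)) (?D n s z) \<le> d / (2 * N)"
    if "\<bar>s\<bar> \<le> 1" for s :: real
    using that r d N
    by (intro eventually_all_finite array_lln[where K = 1]) (auto simp: indicator_def)
  have "\<forall>\<^sub>F n in sequentially. \<forall>z. measure_pmf.prob (product_pmf n (W n)) (?D n 1 z) \<le> d / (2 * N)"
    "\<forall>\<^sub>F n in sequentially. \<forall>z. measure_pmf.prob (product_pmf n (W n)) (?D n (- 1) z) \<le> d / (2 * N)"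
    by (intro lln; simp)+
  then show ?thesis using W ev_ge1
  proof eventually_elim
    case (elim n)
    have en: "e n > 0" and n: "real n > 0" using elim e_pos by auto
    have "{x. \<exists>z. \<not> \<bar>dev e P n x z - b z\<bar> \<le> r} \<subseteq> (\<Union>z. ?D n 1 z \<union> ?D n (- 1) z)"
    proof
      fix x assume "x \<in> {x. \<exists>z. \<not> \<bar>dev e P n x z - b z\<bar> \<le> r}"
      then obtain z where z: "r < \<bar>dev e P n x z - b z\<bar>" by (auto simp: not_le)
      define k where "k = real (card {i. i < n \<and> x i = z})"
      have k: "(\<Sum>i<n. indicator {z} (x i)) = k"
        using sum_counts[of "indicator {z}" x n] by (simp add: k_def indicator_def)
      have E: "measure_pmf.expectation (W n) (\<lambda>y. s * indicator {z} y) = s * (pmf P z + e n * b z)" for s :: real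
        using elim(3) by (simp add: expectation_finite_type indicator_def)
      have "dev e P n x z - b z = (k - real n * (pmf P z + e n * b z)) / (real n * e n)"
        using n en by (simp add: dev_def k_def field_simps)
      then have "r * (real n * e n) < \<bar>k - real n * (pmf P z + e n * b z)\<bar>"
        using z n en by (simp add: abs_divide pos_less_divide_eq)
      then have "real n * (1 * (pmf P z + e n * b z) + e n * r) \<le> 1 * k
          \<or> real n * (- 1 * (pmf P z + e n * b z) + e n * r) \<le> - 1 * k"
        by (auto simp: algebra_simps abs_if split: if_splits)
      then have "x \<in> ?D n 1 z \<or> x \<in> ?D n (- 1) z"
        unfolding mem_Collect_eq E sum_distrib_left[symmetric] k .
      then show "x \<in> (\<Union>z. ?D n 1 z \<union> ?D n (- 1) z)" by blast
    qed
    then have "measure_pmf.prob (product_pmf n (W n)) {x. \<exists>z. \<not> \<bar>dev e P n x z - b z\<bar> \<le> r}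
       \<le> measure_pmf.prob (product_pmf n (W n)) (\<Union>z. ?D n 1 z \<union> ?D n (- 1) z)"
      by (intro measure_pmf.finite_measure_mono) auto
    also have "\<dots> \<le> (\<Sum>z\<in>UNIV. measure_pmf.prob (product_pmf n (W n)) (?D n 1 z \<union> ?D n (- 1) z))"
      by (rule measure_pmf.finite_measure_subadditive_finite) auto
    also have "\<dots> \<le> (\<Sum>z\<in>(UNIV :: 'a set). d / (2 * N) + d / (2 * N))"
      using elim(1,2) by (intro sum_mono order.trans[OF measure_Un_le] add_mono) auto
    also have "\<dots> = d" using N by (simp add: N_def[symmetric])
    finally show ?case .
  qed
qed

lemma eventually_tilted_pmf:
  fixes P :: "'a::finite pmf"
  assumes P: "set_pmf P = UNIV" and b: "b \<in> zero_mass"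
  obtains W where "\<forall>\<^sub>F n in sequentially. \<forall>x. pmf (W n) x = pmf P x + e n * b x"
    "\<forall>\<^sub>F n in sequentially. \<forall>x. 0 < pmf P x + e n * b x"
proof -
  have pos: "0 < pmf P x" for x using P by (simp add: pmf_positive)
  \<comment> \<open>For small n the tilted function may take negative values; the choice is then an
    arbitrary law, which does not affect eventual statements.\<close>
  define W where "W = (\<lambda>n. SOME p. \<forall>x. pmf p x = pmf P x + e n * b x)"
  have ev: "\<forall>\<^sub>F n in sequentially. \<forall>x. 0 < pmf P x + e n * b x"
  proof (rule eventually_all_finite)
    fix x
    show "\<forall>\<^sub>F n in sequentially. 0 < pmf P x + e n * b x"
      using ev_e_small[OF pos[of x], of "- b x"] by eventually_elim (simp add: mult.commute)
  qed
  then have "\<forall>\<^sub>F n in sequentially. \<forall>x. pmf (W n) x = pmf P x + e n * b x"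
  proof eventually_elim
    case (elim n)
    have "(\<Sum>x\<in>UNIV. pmf P x + e n * b x) = 1"
      using b by (simp add: sum.distrib sum_pmf_UNIV sum_distrib_left[symmetric] zero_mass_def)
    then obtain p where "\<And>x. pmf p x = pmf P x + e n * b x"
      using pmf_of_finite_function[of UNIV "\<lambda>x. pmf P x + e n * b x"] elim by (auto simp: less_imp_le)
    then show ?case unfolding W_def by (intro someI[of "\<lambda>p. \<forall>x. pmf p x = pmf P x + e n * b x"]) auto
  qed
  with ev show ?thesis using that by blast
qed

(* Change of measure to the tilted law P + e n * b, under which the event has probability close to 1. *)
lemma dev_ball_lower:
  fixes P :: "'a::finite pmf"
  assumes P: "set_pmf P = UNIV" and u: "1 / 2 * weighted_sq P b < u" and r: "r > 0" and b: "b \<in> zero_mass"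
  shows "\<forall>\<^sub>F n in sequentially. exp (- u / a n)
     \<le> measure_pmf.prob (product_pmf n P) {x. \<forall>z. \<bar>dev e P n x z - b z\<bar> \<le> r}"
proof -
  have pos: "0 < pmf P x" for x using P by (simp add: pmf_positive)
  obtain u' where u': "1 / 2 * weighted_sq P b < u'" "u' < u" using u dense by blast
  obtain W where W: "\<forall>\<^sub>F n in sequentially. \<forall>x. pmf (W n) x = pmf P x + e n * b x"
    and W0: "\<forall>\<^sub>F n in sequentially. \<forall>x. 0 < pmf P x + e n * b x"
    using eventually_tilted_pmf[OF P b] by blast
  have "\<forall>\<^sub>F n in sequentially. 2 * exp (- u / a n) \<le> exp (- u' / a n)"
    using u' by (intro ev_exp_absorb) auto
  moreover have "\<forall>\<^sub>F n in sequentially. measure_pmf.prob (product_pmf n (W n))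
     {x. u' / a n \<le> (\<Sum>i<n. ln (1 + e n * b (x i) / pmf P (x i)))} \<le> 1 / 4"
    by (rule tilted_log_likelihood[OF P u'(1) _ W b]) simp
  moreover have "\<forall>\<^sub>F n in sequentially. measure_pmf.prob (product_pmf n (W n))
     {x. \<exists>z. \<not> \<bar>dev e P n x z - b z\<bar> \<le> r} \<le> 1 / 4"
    by (rule tilted_dev_lln[OF r _ W]) simp
  ultimately show ?thesis using W W0
  proof eventually_elim
    case (elim n)
    let ?P = "product_pmf n P" and ?W = "product_pmf n (W n)"
    let ?B = "{x. \<forall>z. \<bar>dev e P n x z - b z\<bar> \<le> r}"
    let ?L = "{x. u' / a n \<le> (\<Sum>i<n. ln (1 + e n * b (x i) / pmf P (x i)))}"
    have "1 = measure_pmf.prob ?W UNIV" by simp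
    also have "\<dots> \<le> measure_pmf.prob ?W ((?B - ?L) \<union> (?L \<union> {x. \<exists>z. \<not> \<bar>dev e P n x z - b z\<bar> \<le> r}))"
      by (intro measure_pmf.finite_measure_mono) auto
    also have "\<dots> \<le> measure_pmf.prob ?W (?B - ?L)
        + (measure_pmf.prob ?W ?L + measure_pmf.prob ?W {x. \<exists>z. \<not> \<bar>dev e P n x z - b z\<bar> \<le> r})"
      by (intro order.trans[OF measure_Un_le] add_mono) auto
    finally have half: "1 / 2 \<le> measure_pmf.prob ?W (?B - ?L)" using elim(2,3) by linarith
    have "measure_pmf.prob ?W (?B - ?L) \<le> exp (u' / a n) * measure_pmf.prob ?P (?B - ?L)"
    proof (rule prob_le_scale[OF finite_set_product_pmf finite_set_product_pmf])
      fix x assume x: "x \<in> ?B - ?L"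
      show "pmf ?W x \<le> exp (u' / a n) * pmf ?P x"
      \<comment> \<open>A function that is not \<open>undefined\<close> outside the index range has
        mass zero under both laws, so the density ratio factorises wherever it matters.\<close>
      proof (cases "\<forall>i. i \<notin> {..<n} \<longrightarrow> x i = undefined")
        case True
        have fac: "pmf (W n) z = exp (ln (1 + e n * b z / pmf P z)) * pmf P z" for z
        proof -
          have eq: "pmf P z * (1 + e n * b z / pmf P z) = pmf P z + e n * b z"
            using pos[of z] by (simp add: field_simps)
          then have "0 < 1 + e n * b z / pmf P z"
            using elim(5) pos[of z] by (metis zero_less_mult_pos)
          then show ?thesis using elim(4) eq by (simp add: mult.commute)
        qed
        have "pmf ?W x = exp (\<Sum>i<n. ln (1 + e n * b (x i) / pmf P (x i))) * pmf ?P x"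
          using True by (simp add: product_pmf_def pmf_Pi fac prod.distrib exp_sum)
        also have "\<dots> \<le> exp (u' / a n) * pmf ?P x"
          using x by (intro mult_right_mono) auto
        finally show ?thesis .
      qed (auto simp: product_pmf_def pmf_Pi)
    qed
    also have "\<dots> \<le> exp (u' / a n) * measure_pmf.prob ?P ?B"
      by (intro mult_left_mono measure_pmf.finite_measure_mono) auto
    finally have "exp (- u' / a n) * (1 / 2) \<le> exp (- u' / a n) * (exp (u' / a n) * measure_pmf.prob ?P ?B)"
      using half by (intro mult_left_mono) auto
    also have "\<dots> = measure_pmf.prob ?P ?B"
      by (simp add: mult.assoc[symmetric] exp_add[symmetric])
    finally show ?case using elim(1) by simp
  qed
qed

end

section \<open>A fractional Hall theorem and couplings\<close>

text \<open>Rows are exhausted exactly while columns are only capacities. The plan vanishes off A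
  \<times> B on the whole type, so plans on disjoint blocks can simply be added.\<close>

definition fractional_matching ::
    "'a set \<Rightarrow> 'b set \<Rightarrow> ('a \<Rightarrow> 'b \<Rightarrow> bool) \<Rightarrow> ('a \<Rightarrow> real) \<Rightarrow> ('b \<Rightarrow> real) \<Rightarrow> ('a \<Rightarrow> 'b \<Rightarrow> real) \<Rightarrow> bool" where
  "fractional_matching A B N p q f \<longleftrightarrow>
     (\<forall>x y. 0 \<le> f x y) \<and> (\<forall>x y. f x y \<noteq> 0 \<longrightarrow> x \<in> A \<and> y \<in> B \<and> N x y) \<and>
     (\<forall>x\<in>A. (\<Sum>y\<in>B. f x y) = p x) \<and> (\<forall>y\<in>B. (\<Sum>x\<in>A. f x y) \<le> q y)"

definition hall_condition ::
    "'a set \<Rightarrow> 'b set \<Rightarrow> ('a \<Rightarrow> 'b \<Rightarrow> bool) \<Rightarrow> ('a \<Rightarrow> real) \<Rightarrow> ('b \<Rightarrow> real) \<Rightarrow> bool" where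
  "hall_condition A B N p q \<longleftrightarrow>
     (\<forall>x\<in>A. 0 \<le> p x) \<and> (\<forall>y\<in>B. 0 \<le> q y) \<and>
     (\<forall>S\<subseteq>A. sum p S \<le> sum q {y \<in> B. \<exists>x\<in>S. N x y})"

text \<open>The blocks share neither rows nor columns, so each marginal is produced by one of the
  two plans alone.\<close>

lemma fractional_matching_split:
  assumes fin: "finite A" "finite B" and S: "S \<subseteq> A" and M: "M \<subseteq> B"
    and f: "fractional_matching S M N p q f" and g: "fractional_matching (A - S) (B - M) N p q g"
  shows "fractional_matching A B N p q (\<lambda>x y. f x y + g x y)"
proof -
  have f0: "f x y = 0" if "x \<notin> S \<or> y \<notin> M" for x y
    using f that by (auto simp: fractional_matching_def)
  have g0: "g x y = 0" if "x \<notin> A - S \<or> y \<notin> B - M" for x y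
    using g that unfolding fractional_matching_def by blast
  have "(\<Sum>y\<in>B. f x y + g x y) = (\<Sum>y\<in>M. f x y) + (\<Sum>y\<in>B - M. g x y)" for x
    unfolding sum.distrib using fin M f0 g0
    by (intro arg_cong2[where f = "(+)"] sum.mono_neutral_right) auto
  moreover have "(\<Sum>x\<in>A. f x y + g x y) = (\<Sum>x\<in>S. f x y) + (\<Sum>x\<in>A - S. g x y)" for y
    unfolding sum.distrib using fin S f0 g0
    by (intro arg_cong2[where f = "(+)"] sum.mono_neutral_right) auto
  moreover have "(\<Sum>y\<in>M. f x y) = 0" if "x \<notin> S" for x using f0 that by simp
  moreover have "(\<Sum>y\<in>B - M. g x y) = 0" if "x \<in> S" for x using g0 that by simp
  moreover have "(\<Sum>x\<in>S. f x y) = 0" if "y \<notin> M" for y using f0 that by simp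
  moreover have "(\<Sum>x\<in>A - S. g x y) = 0" if "y \<in> M" for y using g0 that by simp
  ultimately show ?thesis
    using f g S M unfolding fractional_matching_def
    by (smt (verit, ccfv_threshold) DiffI Diff_iff subsetD)
qed

(* Saturate the single edge (x, y) as far as the Hall condition permits: either x or y is exhausted,
   or some set becomes tight and the problem splits into two smaller ones. *)
lemma fractional_hall:
  assumes "finite A" "finite B" "hall_condition A B N p q"
  shows "\<exists>f. fractional_matching A B N p q f"
  using assms
proof (induction "card A + card B" arbitrary: A B p q rule: less_induct)
  case less
  have fin: "finite A" "finite B" by fact+
  let ?N = "\<lambda>S. {y \<in> B. \<exists>x\<in>S. N x y}"
  have drop_left: "\<exists>f. fractional_matching A B N p q f"
    if h: "hall_condition A B N p q" and x: "x \<in> A" "p x = 0" for p q x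
  proof -
    have "card (A - {x}) < card A" using fin x by (intro psubset_card_mono) auto
    moreover have "hall_condition (A - {x}) B N p q" using h by (auto simp: hall_condition_def)
    ultimately obtain f where f: "fractional_matching (A - {x}) B N p q f"
      using less.hyps[of "A - {x}" B p q] fin by auto
    have "f x y = 0" for y using f unfolding fractional_matching_def by blast
    then have x0: "(\<Sum>z\<in>A. f z y) = (\<Sum>z\<in>A - {x}. f z y)" "(\<Sum>y\<in>B. f x y) = p x" for y
      using fin x by (simp_all add: sum.remove)
    have "(\<Sum>y\<in>B. f z y) = p z" if "z \<in> A" for z
      using f x0(2) that by (cases "z = x") (auto simp: fractional_matching_def)
    moreover have "(\<Sum>z\<in>A. f z y) \<le> q y" if "y \<in> B" for y
      using f that unfolding x0(1) by (auto simp: fractional_matching_def)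
    moreover have "\<forall>x y. 0 \<le> f x y" "\<forall>x y. f x y \<noteq> 0 \<longrightarrow> x \<in> A \<and> y \<in> B \<and> N x y"
      using f by (auto simp: fractional_matching_def)
    ultimately have "fractional_matching A B N p q f" by (simp add: fractional_matching_def)
    then show ?thesis by blast
  qed
  have drop_right: "\<exists>f. fractional_matching A B N p q f"
    if h: "hall_condition A B N p q" and y: "y \<in> B" "q y = 0" for p q y
  proof -
    have "card (B - {y}) < card B" using fin y by (intro psubset_card_mono) auto
    moreover have "hall_condition A (B - {y}) N p q"
    proof -
      have "sum q {z \<in> B - {y}. \<exists>x\<in>S. N x z} = sum q (?N S)" for S
        using fin y by (intro sum.mono_neutral_left) auto
      then show ?thesis using h by (auto simp: hall_condition_def)
    qed
    ultimately obtain f where f: "fractional_matching A (B - {y}) N p q f"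
      using less.hyps[of A "B - {y}" p q] fin by auto
    have "f x y = 0" for x using f unfolding fractional_matching_def by blast
    then have y0: "(\<Sum>z\<in>B. f x z) = (\<Sum>z\<in>B - {y}. f x z)" "(\<Sum>x\<in>A. f x y) \<le> q y" for x
      using fin y by (simp_all add: sum.remove)
    have "(\<Sum>x\<in>A. f x z) \<le> q z" if "z \<in> B" for z
      using f y0(2) that by (cases "z = y") (auto simp: fractional_matching_def)
    moreover have "(\<Sum>z\<in>B. f x z) = p x" if "x \<in> A" for x
      using f that unfolding y0(1) by (auto simp: fractional_matching_def)
    moreover have "\<forall>x y. 0 \<le> f x y" "\<forall>x y. f x y \<noteq> 0 \<longrightarrow> x \<in> A \<and> y \<in> B \<and> N x y"
      using f by (auto simp: fractional_matching_def)
    ultimately have "fractional_matching A B N p q f" by (simp add: fractional_matching_def)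
    then show ?thesis by blast
  qed
  \<comment> \<open>A tight S consumes all capacity of its neighbourhood. The rest must use the
    other columns, and Hall's condition there is the condition for T \<union> S minus the equality
    for S.\<close>
  have split: "\<exists>f. fractional_matching A B N p q f"
    if h: "hall_condition A B N p q" and S: "S \<subseteq> A" "S \<noteq> {}" "S \<noteq> A" and tight: "sum q (?N S) = sum p S" for p q S
  proof -
    have finS: "finite S" "finite (?N S)" using S fin finite_subset by auto
    have "card S < card A" "card (?N S) \<le> card B"
      using S fin by (auto intro!: psubset_card_mono card_mono)
    moreover have "hall_condition S (?N S) N p q"
    proof -
      have "sum p T \<le> sum q {y \<in> ?N S. \<exists>x\<in>T. N x y}" if T: "T \<subseteq> S" for T
      proof -
        have "{y \<in> ?N S. \<exists>x\<in>T. N x y} = ?N T" using T by blast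
        moreover have "sum p T \<le> sum q (?N T)"
          using h order.trans[OF T S(1)] by (simp add: hall_condition_def)
        ultimately show ?thesis by (simp only:)
      qed
      moreover have "\<forall>x\<in>S. 0 \<le> p x" "\<forall>y\<in>?N S. 0 \<le> q y"
        using h subsetD[OF S(1)] by (simp_all add: hall_condition_def)
      ultimately show ?thesis unfolding hall_condition_def by blast
    qed
    ultimately obtain f where f: "fractional_matching S (?N S) N p q f"
      using less.hyps[of S "?N S" p q] finS by auto
    have "card (A - S) < card A" "card (B - ?N S) \<le> card B"
      using S fin by (auto intro!: psubset_card_mono card_mono)
    moreover have "hall_condition (A - S) (B - ?N S) N p q"
    proof -
      have "sum p T \<le> sum q {y \<in> B - ?N S. \<exists>x\<in>T. N x y}" if T: "T \<subseteq> A - S" for T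
      proof -
        have finT: "finite T" using T fin finite_subset by auto
        have "sum p T + sum p S = sum p (T \<union> S)"
          using T finT finS by (subst sum.union_disjoint) auto
        also have "\<dots> \<le> sum q (?N (T \<union> S))"
          using h S T unfolding hall_condition_def by (meson Diff_subset Un_least order.trans)
        also have "?N (T \<union> S) = {y \<in> B - ?N S. \<exists>x\<in>T. N x y} \<union> ?N S" by blast
        also have "sum q \<dots> = sum q {y \<in> B - ?N S. \<exists>x\<in>T. N x y} + sum q (?N S)"
          using fin by (intro sum.union_disjoint) auto
        finally show ?thesis using tight by simp
      qed
      then show ?thesis using h by (auto simp: hall_condition_def)
    qed
    ultimately obtain g where g: "fractional_matching (A - S) (B - ?N S) N p q g"
      using less.hyps[of "A - S" "B - ?N S" p q] fin by auto
    show ?thesis using fractional_matching_split[OF fin S(1) _ f g] by blast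
  qed
  show ?case
  proof (cases "\<exists>x\<in>A. p x \<noteq> 0")
    case False
    then have "fractional_matching A B N p q (\<lambda>_ _. 0)"
      using less.prems(3) by (auto simp: fractional_matching_def hall_condition_def)
    then show ?thesis by blast
  next
    case True
    then obtain x where x: "x \<in> A" "p x \<noteq> 0" by blast
    note h = less.prems(3)
    have px: "p x > 0" using x h by (auto simp: hall_condition_def less_le)
    have "sum p {x} \<le> sum q (?N {x})" using h x by (auto simp: hall_condition_def)
    then have "0 < sum q (?N {x})" using px by simp
    then have "?N {x} \<noteq> {}" using less_irrefl sum.empty by metis
    then obtain y where y: "y \<in> B" "N x y" by blast
    \<comment> \<open>These are the sets whose slack falls when mass moves along the edge: they see
      y but do not contain x. Each is nonempty and different from A, as splitting requires.\<close>
    define T where "T = {S. S \<subseteq> A \<and> x \<notin> S \<and> y \<in> ?N S}"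
    have finT: "finite T" using fin by (auto simp: T_def)
    define slack where "slack = (\<lambda>S. sum q (?N S) - sum p S)"
    define V where "V = insert (p x) (insert (q y) (slack ` T))"
    define t where "t = Min V"
    have V: "finite V" "V \<noteq> {}" using finT by (auto simp: V_def)
    have t_le: "t \<le> v" if "v \<in> V" for v unfolding t_def using V that by simp
    have t0: "t \<ge> 0" unfolding t_def using V h x y
      by (auto simp: V_def T_def slack_def hall_condition_def)
    have tx: "t \<le> p x" and ty: "t \<le> q y" and tS: "S \<in> T \<Longrightarrow> t \<le> slack S" for S
      by (auto intro: t_le simp: V_def)
    define p' where "p' = p(x := p x - t)"
    define q' where "q' = q(y := q y - t)"
    have sp: "sum p' S = sum p S - (if x \<in> S then t else 0)" if "finite S" for S
      using that by (cases "x \<in> S") (auto simp: p'_def sum.remove intro!: sum.cong)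
    have sq: "sum q' S = sum q S - (if y \<in> S then t else 0)" if "finite S" for S
      using that by (cases "y \<in> S") (auto simp: q'_def sum.remove intro!: sum.cong)
    have h': "hall_condition A B N p' q'"
    proof -
      have "sum p' S \<le> sum q' (?N S)" if S: "S \<subseteq> A" for S
      proof -
        have "finite S" using S fin finite_subset by blast
        then have eq: "sum p' S = sum p S - (if x \<in> S then t else 0)" by (rule sp)
        have eq': "sum q' (?N S) = sum q (?N S) - (if y \<in> ?N S then t else 0)" using fin by (intro sq) simp
        show ?thesis
        proof (cases "x \<notin> S \<and> y \<in> ?N S")
          case True
          then have "t \<le> slack S" using S by (intro tS) (simp add: T_def)
          then show ?thesis unfolding eq eq' using True by (simp add: slack_def)
        next
          case False
          then have "(x \<in> S) = (y \<in> ?N S)" using y by blast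
          moreover have "sum p S \<le> sum q (?N S)" using h S by (auto simp: hall_condition_def)
          ultimately show ?thesis unfolding eq eq' by (simp only: split: if_split)
        qed
      qed
      then show ?thesis using h tx ty by (auto simp: hall_condition_def p'_def q'_def)
    qed
    have "\<exists>f. fractional_matching A B N p' q' f"
    proof -
      have "t \<in> V" unfolding t_def using V by simp
      then consider "t = p x" | "t = q y" | S where "S \<in> T" "t = slack S" by (auto simp: V_def)
      then show ?thesis
      proof cases
        case 1
        then show ?thesis using drop_left[OF h' x(1)] by (simp add: p'_def)
      next
        case 2
        then show ?thesis using drop_right[OF h' y(1)] by (simp add: q'_def)
      next
        case 3
        then have S: "S \<subseteq> A" "S \<noteq> {}" "S \<noteq> A" "x \<notin> S" "y \<in> ?N S" using x by (auto simp: T_def)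
        have "finite S" using S fin finite_subset by blast
        then have "sum q' (?N S) = sum p' S"
          using sp[of S] sq[of "?N S"] S fin 3 by (simp add: slack_def)
        then show ?thesis using split[OF h' S(1-3)] by blast
      qed
    qed
    then obtain f where f: "fractional_matching A B N p' q' f" ..
    define g where "g = (\<lambda>u v. f u v + (if u = x \<and> v = y then t else 0))"
    have "(\<Sum>v\<in>B. g u v) = (\<Sum>v\<in>B. f u v) + (if u = x then t else 0)" for u
      using fin y by (cases "u = x") (auto simp: g_def sum.distrib)
    moreover have "(\<Sum>u\<in>A. g u v) = (\<Sum>u\<in>A. f u v) + (if v = y then t else 0)" for v
      using fin x by (cases "v = y") (auto simp: g_def sum.distrib)
    ultimately have "fractional_matching A B N p q g"
      using f t0 x y unfolding fractional_matching_def
      by (auto simp: g_def p'_def q'_def split: if_splits)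
    then show ?thesis by blast
  qed
qed

text \<open>The unmatched masses r on the left and s on the right have the same total T; coupling
  them independently completes the marginals, and only this part can violate N.\<close>

lemma coupling_of_fractional_matching:
  fixes P :: "'a pmf" and Q :: "'b pmf"
  assumes fin: "finite (set_pmf P)" "finite (set_pmf Q)"
    and m: "\<And>x y. 0 \<le> m x y" "\<And>x y. m x y \<noteq> 0 \<Longrightarrow> N x y"
    and r: "\<And>x. x \<in> set_pmf P \<Longrightarrow> 0 \<le> r x" "\<And>x. x \<in> set_pmf P \<Longrightarrow> (\<Sum>y\<in>set_pmf Q. m x y) + r x = pmf P x"
    and q: "\<And>y. y \<in> set_pmf Q \<Longrightarrow> (\<Sum>x\<in>set_pmf P. m x y) \<le> pmf Q y"
    and d: "(\<Sum>x\<in>set_pmf P. r x) \<le> d"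
  shows "\<exists>R\<in>couplings P Q. measure_pmf.prob R {(x, y). \<not> N x y} \<le> d"
proof -
  let ?A = "set_pmf P" and ?B = "set_pmf Q"
  define s where "s = (\<lambda>y. pmf Q y - (\<Sum>x\<in>?A. m x y))"
  define T where "T = (\<Sum>x\<in>?A. r x)"
  have s: "s y \<ge> 0" if "y \<in> ?B" for y using q[OF that] by (simp add: s_def)
  have PQ: "(\<Sum>x\<in>?A. pmf P x) = 1" "(\<Sum>y\<in>?B. pmf Q y) = 1"
    using fin by (auto intro: sum_pmf_eq_1)
  have sT: "(\<Sum>y\<in>?B. s y) = T"
  proof -
    have "(\<Sum>x\<in>?A. \<Sum>y\<in>?B. m x y) + T = 1"
      using r(2) PQ(1) by (simp add: T_def sum.distrib[symmetric])
    moreover have "(\<Sum>y\<in>?B. s y) = 1 - (\<Sum>y\<in>?B. \<Sum>x\<in>?A. m x y)"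
      using PQ(2) by (simp add: s_def sum_subtractf)
    ultimately show ?thesis using sum.swap[of m ?B ?A] by simp
  qed
  \<comment> \<open>If T = 0, division gives 0 and nonnegativity forces r to vanish, so the same
    formula for the coupling covers a perfect matching.\<close>
  have r0: "r x * T / T = r x" if "x \<in> ?A" for x
  proof (cases "T = 0")
    case True
    then have "r x = 0" unfolding T_def using r(1) fin that by (simp add: sum_nonneg_eq_0_iff)
    then show ?thesis by simp
  qed simp
  have s0: "s y * T / T = s y" if "y \<in> ?B" for y
  proof (cases "T = 0")
    case True
    then have "s y = 0" unfolding sT[symmetric] using s fin that by (simp add: sum_nonneg_eq_0_iff)
    then show ?thesis by simp
  qed simp
  define g where "g = (\<lambda>(x, y). if x \<in> ?A \<and> y \<in> ?B then m x y + r x * s y / T else 0)"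
  have T0: "T \<ge> 0" unfolding T_def using r(1) by (intro sum_nonneg) auto
  have g0: "0 \<le> g z" for z
    using m(1) r(1) s T0 by (auto simp: g_def split: prod.splits)
  have row: "(\<Sum>y\<in>?B. g (x, y)) = pmf P x" if "x \<in> ?A" for x
  proof -
    have "(\<Sum>y\<in>?B. g (x, y)) = (\<Sum>y\<in>?B. m x y) + r x * (\<Sum>y\<in>?B. s y) / T"
      using that by (simp add: g_def sum.distrib sum_distrib_left sum_divide_distrib)
    then show ?thesis unfolding sT using r0[OF that] r(2)[OF that] by simp
  qed
  have col: "(\<Sum>x\<in>?A. g (x, y)) = pmf Q y" if "y \<in> ?B" for y
  proof -
    have "(\<Sum>x\<in>?A. g (x, y)) = (\<Sum>x\<in>?A. m x y) + (\<Sum>x\<in>?A. s y * r x / T)"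
      using that by (simp add: g_def sum.distrib mult.commute)
    also have "(\<Sum>x\<in>?A. s y * r x / T) = s y * T / T"
      by (simp add: T_def sum_distrib_left sum_divide_distrib)
    finally show ?thesis using s0[OF that] by (simp add: s_def)
  qed
  have "sum g (?A \<times> ?B) = (\<Sum>x\<in>?A. \<Sum>y\<in>?B. g (x, y))"
    unfolding sum.cartesian_product by simp
  also have "\<dots> = 1" using row PQ(1) by simp
  finally have "sum g (?A \<times> ?B) = 1" .
  moreover have "g z = 0" if "z \<notin> ?A \<times> ?B" for z
    using that by (cases z) (auto simp: g_def)
  ultimately obtain R where R: "\<And>z. pmf R z = g z"
    using pmf_of_finite_function[of "?A \<times> ?B" g] g0 fin by blast
  have supp: "z \<in> ?A \<times> ?B" if "z \<in> set_pmf R" for z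
    using that R[of z] by (auto simp: set_pmf_iff g_def split: if_splits prod.splits)
  have prob: "measure_pmf.prob R E = sum g (E \<inter> ?A \<times> ?B)" for E
  proof -
    have "measure_pmf.prob R E = measure_pmf.prob R (E \<inter> ?A \<times> ?B)"
      using supp by (intro measure_prob_cong_0) (auto simp: set_pmf_iff)
    then show ?thesis using fin R by (simp add: measure_measure_pmf_finite)
  qed
  have "map_pmf fst R = P"
  proof (rule pmf_eqI)
    fix x
    have "pmf (map_pmf fst R) x = sum g ((fst -` {x}) \<inter> ?A \<times> ?B)" by (simp add: pmf_map prob)
    also have "\<dots> = pmf P x"
    proof (cases "x \<in> ?A")
      case True
      then have "(fst -` {x}) \<inter> ?A \<times> ?B = Pair x ` ?B" by auto
      then show ?thesis using row[OF True] by (simp add: sum.reindex inj_on_def)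
    next
      case False
      then have "(fst -` {x}) \<inter> ?A \<times> ?B = {}" by auto
      then show ?thesis using False by (simp only: sum.empty) (simp add: set_pmf_iff)
    qed
    finally show "pmf (map_pmf fst R) x = pmf P x" .
  qed
  moreover have "map_pmf snd R = Q"
  proof (rule pmf_eqI)
    fix y
    have "pmf (map_pmf snd R) y = sum g ((snd -` {y}) \<inter> ?A \<times> ?B)" by (simp add: pmf_map prob)
    also have "\<dots> = pmf Q y"
    proof (cases "y \<in> ?B")
      case True
      then have "(snd -` {y}) \<inter> ?A \<times> ?B = (\<lambda>x. (x, y)) ` ?A" by auto
      then show ?thesis using col[OF True] by (simp add: sum.reindex inj_on_def)
    next
      case False
      then have "(snd -` {y}) \<inter> ?A \<times> ?B = {}" by auto
      then show ?thesis using False by (simp only: sum.empty) (simp add: set_pmf_iff)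
    qed
    finally show "pmf (map_pmf snd R) y = pmf Q y" .
  qed
  moreover have "measure_pmf.prob R {(x, y). \<not> N x y} \<le> d"
  proof -
    let ?E = "{(x, y). \<not> N x y} \<inter> ?A \<times> ?B"
    have "m x y = 0" if "\<not> N x y" for x y using m(2) that by blast
    then have "sum g ?E = (\<Sum>(x, y)\<in>?E. r x * s y / T)"
      by (intro sum.cong) (auto simp: g_def)
    also have "\<dots> \<le> (\<Sum>(x, y)\<in>?A \<times> ?B. r x * s y / T)"
      using fin r(1) s T0 by (intro sum_mono2) auto
    also have "\<dots> = (\<Sum>x\<in>?A. r x * T / T)"
      unfolding sum.cartesian_product[symmetric] sum_divide_distrib[symmetric] sum_distrib_left[symmetric] sT ..
    also have "\<dots> = T" unfolding T_def[symmetric] using r0 by (simp add: T_def)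
    finally show ?thesis using d by (simp add: prob T_def)
  qed
  ultimately show ?thesis by (auto simp: couplings_def)
qed

text \<open>The defect d becomes the capacity of an additional right vertex \<open>None\<close> that
  is related to every left vertex; whatever is sent there counts as unmatched.\<close>

lemma strassen_finite:
  fixes P :: "'a pmf" and Q :: "'b pmf"
  assumes fin: "finite (set_pmf P)" "finite (set_pmf Q)" and d: "d \<ge> 0"
    and hall: "\<And>C. C \<subseteq> set_pmf P \<Longrightarrow> measure_pmf.prob P C \<le> measure_pmf.prob Q {y. \<exists>x\<in>C. N x y} + d"
  shows "\<exists>R\<in>couplings P Q. measure_pmf.prob R {(x, y). \<not> N x y} \<le> d"
proof -
  let ?A = "set_pmf P" and ?B = "insert None (Some ` set_pmf Q)"
  let ?N = "\<lambda>x z. case z of None \<Rightarrow> True | Some y \<Rightarrow> N x y"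
  let ?q = "\<lambda>z. case z of None \<Rightarrow> d | Some y \<Rightarrow> pmf Q y"
  have finB: "finite ?B" using fin by auto
  have "sum (pmf P) S \<le> sum ?q {z \<in> ?B. \<exists>x\<in>S. ?N x z}" if S: "S \<subseteq> ?A" for S
  proof (cases "S = {}")
    case False
    let ?M = "{y \<in> set_pmf Q. \<exists>x\<in>S. N x y}"
    have eq: "{z \<in> ?B. \<exists>x\<in>S. ?N x z} = insert None (Some ` ?M)"
      using False by (auto split: option.splits)
    have "sum (pmf P) S = measure_pmf.prob P S"
      using S fin finite_subset by (subst measure_measure_pmf_finite) auto
    also have "\<dots> \<le> measure_pmf.prob Q {y. \<exists>x\<in>S. N x y} + d" by (rule hall[OF S])
    also have "measure_pmf.prob Q {y. \<exists>x\<in>S. N x y} = measure_pmf.prob Q ?M"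
      by (intro measure_prob_cong_0) (auto simp: set_pmf_iff)
    also have "\<dots> = sum (pmf Q) ?M" using fin by (subst measure_measure_pmf_finite) auto
    finally show ?thesis unfolding eq using fin
      by (subst sum.insert) (auto simp: sum.reindex)
  qed simp
  then have "hall_condition ?A ?B ?N (pmf P) ?q"
    using d by (auto simp: hall_condition_def)
  then obtain f where f: "fractional_matching ?A ?B ?N (pmf P) ?q f"
    using fractional_hall fin finB by blast
  have sum_B: "sum h ?B = h None + (\<Sum>y\<in>set_pmf Q. h (Some y))" for h :: "'b option \<Rightarrow> real"
    using fin by (subst sum.insert) (auto simp: sum.reindex)
  show ?thesis
  proof (rule coupling_of_fractional_matching[OF fin, where m = "\<lambda>x y. f x (Some y)" and r = "\<lambda>x. f x None"])
    fix x y
    show "0 \<le> f x (Some y)" "0 \<le> f x None" using f by (auto simp: fractional_matching_def)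
    show "N x y" if "f x (Some y) \<noteq> 0"
      using f that unfolding fractional_matching_def by (metis option.case(2))
    show "(\<Sum>y\<in>set_pmf Q. f x (Some y)) + f x None = pmf P x" if "x \<in> set_pmf P"
      using f that sum_B[of "f x"] by (simp add: fractional_matching_def)
    show "(\<Sum>x\<in>set_pmf P. f x (Some y)) \<le> pmf Q y" if "y \<in> set_pmf Q"
      using f that by (auto simp: fractional_matching_def)
    show "(\<Sum>x\<in>set_pmf P. f x None) \<le> d"
      using f by (auto simp: fractional_matching_def)
  qed
qed

section \<open>Rearranging words\<close>

text \<open>Permuting one word suffices, because a common permutation of both leaves the average
  cost unchanged; for the same reason the relation is symmetric in the two words.\<close>

definition rearranged :: "('a \<times> 'b \<Rightarrow> real) \<Rightarrow> nat \<Rightarrow> real \<Rightarrow> (nat \<Rightarrow> 'a) \<Rightarrow> (nat \<Rightarrow> 'b) \<Rightarrow> bool" where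
  "rearranged c n \<alpha> x y \<longleftrightarrow> (\<exists>\<sigma>. \<sigma> permutes {..<n} \<and> avg_cost c n (x, y \<circ> \<sigma>) \<le> \<alpha>)"

lemma product_pmf_permute:
  assumes "\<sigma> permutes {..<n}"
  shows "map_pmf (\<lambda>x. x \<circ> \<sigma>) (product_pmf n P) = product_pmf n P"
  unfolding product_pmf_def
  using assms permutes_in_image[OF assms]
  by (intro Pi_pmf_bij_betw[symmetric] permutes_imp_bij) auto

lemma avg_cost_permute:
  assumes "\<sigma> permutes {..<n}"
  shows "avg_cost c n (x \<circ> \<sigma>, y \<circ> \<sigma>) = avg_cost c n (x, y)"
  using sum.permute[OF assms, of "\<lambda>i. c (x i, y i)"] by (simp add: avg_cost_def o_def)

lemma excess_prob_le:
  assumes "R \<in> couplings (product_pmf n P) (product_pmf n Q)"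
  shows "excess_prob c P Q n \<alpha> \<le> measure_pmf.prob R {z. avg_cost c n z > \<alpha>}"
  unfolding excess_prob_def by (rule cINF_lower[OF _ assms]) (auto intro!: bdd_belowI[of _ 0])

lemma couplings_nonempty: "couplings P Q \<noteq> {}"
proof -
  have "pair_pmf P Q \<in> couplings P Q" by (simp add: couplings_def map_fst_pair_pmf map_snd_pair_pmf)
  then show ?thesis by blast
qed

lemma excess_prob_ge:
  assumes "\<And>R. R \<in> couplings (product_pmf n P) (product_pmf n Q) \<Longrightarrow> d \<le> measure_pmf.prob R {z. avg_cost c n z > \<alpha>}"
  shows "d \<le> excess_prob c P Q n \<alpha>"
  unfolding excess_prob_def using couplings_nonempty assms by (rule cINF_greatest)

lemma prob_bind_pmf:
  "measure_pmf.prob (bind_pmf p f) X = measure_pmf.expectation p (\<lambda>x. measure_pmf.prob (f x) X)"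
proof -
  have eq: "measure_pmf.prob q X = pmf (map_pmf (\<lambda>z. z \<in> X) q) True" for q
    by (simp add: pmf_map vimage_def)
  show ?thesis unfolding eq map_bind_pmf pmf_bind ..
qed

(* Rearranging the second word as a function of the pair and then permuting both words by a common
   uniformly random permutation restores the marginals, since product laws are exchangeable. *)
lemma excess_prob_le_not_rearranged:
  fixes P :: "'a pmf" and Q :: "'b pmf"
  assumes R: "R \<in> couplings (product_pmf n P) (product_pmf n Q)"
  shows "excess_prob c P Q n \<alpha> \<le> measure_pmf.prob R {(x, y). \<not> rearranged c n \<alpha> x y}"
proof -
  let ?G = "{\<sigma>. \<sigma> permutes {..<n}}"
  define u where "u = pmf_of_set ?G"
  have G: "finite ?G" "?G \<noteq> {}" by (auto simp: finite_permutations intro: permutes_id)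
  have u: "set_pmf u = ?G" unfolding u_def using G by (simp add: set_pmf_of_set)
  have "\<exists>\<sigma>. \<sigma> permutes {..<n} \<and> (rearranged c n \<alpha> x y \<longrightarrow> avg_cost c n (x, y \<circ> \<sigma>) \<le> \<alpha>)" for x y
    unfolding rearranged_def using permutes_id[of "{..<n}"] by blast
  then obtain s where s: "\<And>x y. s x y permutes {..<n}"
    "\<And>x y. rearranged c n \<alpha> x y \<Longrightarrow> avg_cost c n (x, y \<circ> s x y) \<le> \<alpha>" by metis
  define T where "T = bind_pmf R (\<lambda>(x, y). map_pmf (\<lambda>\<tau>. (x \<circ> \<tau>, y \<circ> s x y \<circ> \<tau>)) u)"
  \<comment> \<open>Translation invariance of the uniform law on the symmetric group is what saves
    the second marginal: it erases \<open>s x y\<close>, although this permutation depends on both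
    words.\<close>
  have shift: "map_pmf (\<lambda>\<tau>. \<sigma> \<circ> \<tau>) u = u" if "\<sigma> permutes {..<n}" for \<sigma>
  proof -
    have "bij_betw (\<lambda>\<tau>. \<sigma> \<circ> \<tau>) ?G ?G"
      by (rule bij_betwI[where g = "\<lambda>\<tau>. inv \<sigma> \<circ> \<tau>"])
        (use that in \<open>auto simp: permutes_compose permutes_inv o_assoc permutes_inv_o\<close>)
    then show ?thesis unfolding u_def using G by (intro map_pmf_of_set_bij_betw)
  qed
  have inv: "bind_pmf (product_pmf n D) (\<lambda>x. map_pmf (\<lambda>\<tau>. x \<circ> \<tau>) u) = product_pmf n D" for D :: "'c pmf"
  proof -
    have "bind_pmf (product_pmf n D) (\<lambda>x. map_pmf (\<lambda>\<tau>. x \<circ> \<tau>) u)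
        = bind_pmf u (\<lambda>\<tau>. map_pmf (\<lambda>x. x \<circ> \<tau>) (product_pmf n D))"
      unfolding map_pmf_def by (rule bind_commute_pmf)
    also have "\<dots> = bind_pmf u (\<lambda>\<tau>. product_pmf n D)"
      using u by (intro bind_pmf_cong refl product_pmf_permute) auto
    finally show ?thesis by simp
  qed
  have RX: "map_pmf fst R = product_pmf n P" and RY: "map_pmf snd R = product_pmf n Q"
    using R by (auto simp: couplings_def)
  have "map_pmf fst T = bind_pmf R (\<lambda>z. map_pmf (\<lambda>\<tau>. fst z \<circ> \<tau>) u)"
    unfolding T_def map_bind_pmf by (intro bind_pmf_cong refl) (auto simp: map_pmf_comp split: prod.splits)
  also have "\<dots> = bind_pmf (map_pmf fst R) (\<lambda>x. map_pmf (\<lambda>\<tau>. x \<circ> \<tau>) u)"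
    by (simp add: bind_map_pmf)
  finally have TX: "map_pmf fst T = product_pmf n P" unfolding RX inv .
  have "map_pmf snd T = bind_pmf R (\<lambda>z. map_pmf (\<lambda>\<tau>. snd z \<circ> \<tau>) u)"
    unfolding T_def map_bind_pmf
  proof (intro bind_pmf_cong refl)
    fix z :: "(nat \<Rightarrow> 'a) \<times> (nat \<Rightarrow> 'b)"
    obtain x y where z: "z = (x, y)" by fastforce
    have "map_pmf snd (case z of (x, y) \<Rightarrow> map_pmf (\<lambda>\<tau>. (x \<circ> \<tau>, y \<circ> s x y \<circ> \<tau>)) u)
       = map_pmf (\<lambda>\<tau>. y \<circ> \<tau>) (map_pmf (\<lambda>\<tau>. s x y \<circ> \<tau>) u)"
      by (simp add: z map_pmf_comp o_assoc)
    then show "map_pmf snd (case z of (x, y) \<Rightarrow> map_pmf (\<lambda>\<tau>. (x \<circ> \<tau>, y \<circ> s x y \<circ> \<tau>)) u) = map_pmf (\<lambda>\<tau>. snd z \<circ> \<tau>) u"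
      unfolding shift[OF s(1)] by (simp add: z)
  qed
  also have "\<dots> = bind_pmf (map_pmf snd R) (\<lambda>x. map_pmf (\<lambda>\<tau>. x \<circ> \<tau>) u)"
    by (simp add: bind_map_pmf)
  finally have TY: "map_pmf snd T = product_pmf n Q" unfolding RY inv .
  have "T \<in> couplings (product_pmf n P) (product_pmf n Q)"
    using TX TY by (simp add: couplings_def)
  then have "excess_prob c P Q n \<alpha> \<le> measure_pmf.prob T {z. avg_cost c n z > \<alpha>}"
    by (rule excess_prob_le)
  also have "\<dots> = measure_pmf.expectation R
      (\<lambda>(x, y). measure_pmf.prob (map_pmf (\<lambda>\<tau>. (x \<circ> \<tau>, y \<circ> s x y \<circ> \<tau>)) u) {z. avg_cost c n z > \<alpha>})"
    unfolding T_def prob_bind_pmf by (simp add: case_prod_unfold)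
  also have "\<dots> \<le> measure_pmf.expectation R (indicator {(x, y). \<not> rearranged c n \<alpha> x y})"
  proof (intro integral_mono)
    show "integrable (measure_pmf R) (\<lambda>(x, y). measure_pmf.prob (map_pmf (\<lambda>\<tau>. (x \<circ> \<tau>, y \<circ> s x y \<circ> \<tau>)) u) {z. avg_cost c n z > \<alpha>})"
      by (rule measure_pmf.integrable_const_bound[where B = 1]) (auto split: prod.splits)
    show "integrable (measure_pmf R) (indicator {(x, y). \<not> rearranged c n \<alpha> x y} :: _ \<Rightarrow> real)"
      by (rule measure_pmf.integrable_const_bound[where B = 1]) (auto simp: indicator_def)
    fix z :: "(nat \<Rightarrow> 'a) \<times> (nat \<Rightarrow> 'b)"
    obtain x y where z: "z = (x, y)" by fastforce
    have "measure_pmf.prob (map_pmf (\<lambda>\<tau>. (x \<circ> \<tau>, y \<circ> s x y \<circ> \<tau>)) u) {z. avg_cost c n z > \<alpha>} = 0"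
      if "rearranged c n \<alpha> x y"
      unfolding measure_pmf_zero_iff
      using u s(2)[OF that] by (auto simp: avg_cost_permute)
    then show "(case z of (x, y) \<Rightarrow> measure_pmf.prob (map_pmf (\<lambda>\<tau>. (x \<circ> \<tau>, y \<circ> s x y \<circ> \<tau>)) u) {z. avg_cost c n z > \<alpha>})
        \<le> indicator {(x, y). \<not> rearranged c n \<alpha> x y} z"
      by (auto simp: z indicator_def)
  qed
  also have "\<dots> = measure_pmf.prob R {(x, y). \<not> rearranged c n \<alpha> x y}" by simp
  finally show ?thesis .
qed

lemma excess_prob_le_hall:
  fixes P :: "'a::finite pmf" and Q :: "'b::finite pmf"
  assumes "d \<ge> 0"
    and "\<And>C. C \<subseteq> set_pmf (product_pmf n P) \<Longrightarrow>
      measure_pmf.prob (product_pmf n P) C \<le> measure_pmf.prob (product_pmf n Q) {y. \<exists>x\<in>C. rearranged c n \<alpha> x y} + d"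
  shows "excess_prob c P Q n \<alpha> \<le> d"
  using strassen_finite[OF finite_set_product_pmf finite_set_product_pmf assms] excess_prob_le_not_rearranged order.trans
  by blast

text \<open>Greedy construction: match one pair of positions with a demanded pair of letters, remove
  both positions, and lower that demand by one. Requiring only inequalities lets the surplus
  positions be matched arbitrarily at the end.\<close>

lemma bij_with_prescribed_pairs:
  fixes k :: "'a::finite \<times> 'b::finite \<Rightarrow> nat"
  assumes "finite I" "finite J" "card I = card J"
    and "\<And>a. (\<Sum>b\<in>UNIV. k (a, b)) \<le> card {i \<in> I. x i = a}"
    and "\<And>b. (\<Sum>a\<in>UNIV. k (a, b)) \<le> card {j \<in> J. y j = b}"
  shows "\<exists>\<sigma>. bij_betw \<sigma> I J \<and> (\<forall>a b. k (a, b) \<le> card {i \<in> I. x i = a \<and> y (\<sigma> i) = b})"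
  using assms
proof (induction "\<Sum>z\<in>UNIV. k z" arbitrary: k I J)
  case 0
  then have "k z = 0" for z by (cases z) simp
  moreover obtain \<sigma> where "bij_betw \<sigma> I J" using 0 finite_same_card_bij by blast
  ultimately show ?case by auto
next
  case (Suc m)
  then obtain z where "k z \<noteq> 0" by (metis nat.distinct(1) sum.neutral)
  then obtain a b where ab: "k (a, b) > 0" by (cases z) auto
  have "k (a, b) \<le> (\<Sum>b\<in>UNIV. k (a, b))" "k (a, b) \<le> (\<Sum>a\<in>UNIV. k (a, b))"
    by (auto intro: member_le_sum)
  then have "card {i \<in> I. x i = a} > 0" "card {j \<in> J. y j = b} > 0"
    using ab Suc.prems(4)[of a] Suc.prems(5)[of b] by linarith+
  then obtain i j where i: "i \<in> I" "x i = a" and j: "j \<in> J" "y j = b"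
    unfolding card_gt_0_iff by blast
  define k' where "k' = k((a, b) := k (a, b) - 1)"
  have "(\<Sum>z\<in>UNIV. k z) = k (a, b) + (\<Sum>z\<in>UNIV - {(a, b)}. k z)" by (simp add: sum.remove)
  moreover have "(\<Sum>z\<in>UNIV. k' z) = k' (a, b) + (\<Sum>z\<in>UNIV - {(a, b)}. k' z)" by (simp add: sum.remove)
  moreover have "(\<Sum>z\<in>UNIV - {(a, b)}. k' z) = (\<Sum>z\<in>UNIV - {(a, b)}. k z)"
    by (intro sum.cong) (auto simp: k'_def)
  ultimately have m: "m = (\<Sum>z\<in>UNIV. k' z)" using Suc.hyps(2) ab by (simp add: k'_def)
  have row: "(\<Sum>b'\<in>UNIV. k' (a', b')) = (\<Sum>b'\<in>UNIV. k (a', b')) - (if a' = a then 1 else 0)" for a'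
  proof (cases "a' = a")
    case True
    have "(\<Sum>b'\<in>UNIV. k (a, b')) = k (a, b) + (\<Sum>b'\<in>UNIV - {b}. k (a, b'))" by (simp add: sum.remove)
    moreover have "(\<Sum>b'\<in>UNIV. k' (a, b')) = k' (a, b) + (\<Sum>b'\<in>UNIV - {b}. k' (a, b'))" by (simp add: sum.remove)
    moreover have "(\<Sum>b'\<in>UNIV - {b}. k' (a, b')) = (\<Sum>b'\<in>UNIV - {b}. k (a, b'))"
      by (intro sum.cong) (auto simp: k'_def)
    ultimately show ?thesis using ab True by (simp add: k'_def)
  qed (auto simp: k'_def intro!: sum.cong)
  have col: "(\<Sum>a'\<in>UNIV. k' (a', b')) = (\<Sum>a'\<in>UNIV. k (a', b')) - (if b' = b then 1 else 0)" for b'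
  proof (cases "b' = b")
    case True
    have "(\<Sum>a'\<in>UNIV. k (a', b)) = k (a, b) + (\<Sum>a'\<in>UNIV - {a}. k (a', b))" by (simp add: sum.remove)
    moreover have "(\<Sum>a'\<in>UNIV. k' (a', b)) = k' (a, b) + (\<Sum>a'\<in>UNIV - {a}. k' (a', b))" by (simp add: sum.remove)
    moreover have "(\<Sum>a'\<in>UNIV - {a}. k' (a', b)) = (\<Sum>a'\<in>UNIV - {a}. k (a', b))"
      by (intro sum.cong) (auto simp: k'_def)
    ultimately show ?thesis using ab True by (simp add: k'_def)
  qed (auto simp: k'_def intro!: sum.cong)
  have I: "card {i' \<in> I - {i}. x i' = a'} = card {i \<in> I. x i = a'} - (if a' = a then 1 else 0)" for a'
  proof (cases "a' = a")
    case True
    then have "{i' \<in> I - {i}. x i' = a'} = {i \<in> I. x i = a'} - {i}" by auto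
    then show ?thesis using i True by simp
  next
    case False
    then have "{i' \<in> I - {i}. x i' = a'} = {i \<in> I. x i = a'}" using i by auto
    then show ?thesis using False by simp
  qed
  have J: "card {j' \<in> J - {j}. y j' = b'} = card {j \<in> J. y j = b'} - (if b' = b then 1 else 0)" for b'
  proof (cases "b' = b")
    case True
    then have "{j' \<in> J - {j}. y j' = b'} = {j \<in> J. y j = b'} - {j}" by auto
    then show ?thesis using j True by simp
  next
    case False
    then have "{j' \<in> J - {j}. y j' = b'} = {j \<in> J. y j = b'}" using j by auto
    then show ?thesis using False by simp
  qed
  have "\<exists>\<sigma>. bij_betw \<sigma> (I - {i}) (J - {j}) \<and> (\<forall>a b. k' (a, b) \<le> card {i' \<in> I - {i}. x i' = a \<and> y (\<sigma> i') = b})"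
    using Suc.prems i j by (intro Suc.hyps(1) m) (auto simp only: row col I J finite_Diff card_Diff_singleton intro!: diff_le_mono)
  then obtain \<sigma> where \<sigma>: "bij_betw \<sigma> (I - {i}) (J - {j})"
    "\<And>a b. k' (a, b) \<le> card {i' \<in> I - {i}. x i' = a \<and> y (\<sigma> i') = b}" by blast
  define \<tau> where "\<tau> = \<sigma>(i := j)"
  have \<tau>\<sigma>: "bij_betw \<tau> (I - {i}) (J - {j})"
    using \<sigma>(1) by (subst bij_betw_cong[of _ _ \<sigma>]) (auto simp: \<tau>_def)
  have "bij_betw \<tau> (I - {i} \<union> {i}) (J - {j} \<union> {\<tau> i})"
    by (rule notIn_Un_bij_betw[OF _ _ \<tau>\<sigma>]) (auto simp: \<tau>_def)
  then have "bij_betw \<tau> I J" using i j by (simp add: \<tau>_def insert_absorb)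
  moreover have "k (a', b') \<le> card {i \<in> I. x i = a' \<and> y (\<tau> i) = b'}" for a' b'
  proof (cases "(a', b') = (a, b)")
    case True
    have "{i \<in> I. x i = a \<and> y (\<tau> i) = b} = insert i {i' \<in> I - {i}. x i' = a \<and> y (\<sigma> i') = b}"
      using i j by (auto simp: \<tau>_def)
    then have "card {i \<in> I. x i = a \<and> y (\<tau> i) = b} = Suc (card {i' \<in> I - {i}. x i' = a \<and> y (\<sigma> i') = b})"
      using Suc.prems(1) by simp
    then show ?thesis using True \<sigma>(2)[of a b] by (simp add: k'_def)
  next
    case False
    have "k (a', b') = k' (a', b')" using False by (auto simp: k'_def)
    also have "\<dots> \<le> card {i' \<in> I - {i}. x i' = a' \<and> y (\<sigma> i') = b'}" by (rule \<sigma>(2))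
    also have "\<dots> \<le> card {i \<in> I. x i = a' \<and> y (\<tau> i) = b'}"
      using Suc.prems(1) by (intro card_mono) (auto simp: \<tau>_def)
    finally show ?thesis .
  qed
  ultimately show ?case by blast
qed

(* Every entry of n * \<pi> is rounded down; the remaining positions are matched arbitrarily. *)
lemma rearrangement_of_plan:
  fixes x :: "nat \<Rightarrow> 'a::finite" and y :: "nat \<Rightarrow> 'b::finite"
  assumes \<pi>: "\<And>z. 0 \<le> \<pi> z"
    and row: "\<And>a. real n * (\<Sum>b\<in>UNIV. \<pi> (a, b)) = real (card {i. i < n \<and> x i = a})"
    and col: "\<And>b. real n * (\<Sum>a\<in>UNIV. \<pi> (a, b)) = real (card {i. i < n \<and> y i = b})"
    and c: "\<And>z. \<bar>c z\<bar> \<le> K"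
  shows "\<exists>\<sigma>. \<sigma> permutes {..<n} \<and>
     (\<Sum>i<n. c (x i, y (\<sigma> i))) \<le> real n * (\<Sum>z\<in>UNIV. \<pi> z * c z) + 2 * real CARD('a \<times> 'b) * K"
proof -
  define k where "k = (\<lambda>z. nat \<lfloor>real n * \<pi> z\<rfloor>)"
  have k: "real (k z) \<le> real n * \<pi> z" "real n * \<pi> z \<le> real (k z) + 1" for z
    using \<pi>[of z] by (simp_all add: k_def)
  have set_eq: "{i \<in> {..<n}. Q i} = {i. i < n \<and> Q i}" for Q by auto
  have "real (\<Sum>b\<in>UNIV. k (a, b)) \<le> real (card {i. i < n \<and> x i = a})" for a
    unfolding row[symmetric] of_nat_sum sum_distrib_left by (intro sum_mono k)
  moreover have "real (\<Sum>a\<in>UNIV. k (a, b)) \<le> real (card {i. i < n \<and> y i = b})" for b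
    unfolding col[symmetric] of_nat_sum sum_distrib_left by (intro sum_mono k)
  ultimately obtain \<sigma> where \<sigma>: "bij_betw \<sigma> {..<n} {..<n}"
    "\<And>a b. k (a, b) \<le> card {i \<in> {..<n}. x i = a \<and> y (\<sigma> i) = b}"
    using bij_with_prescribed_pairs[of "{..<n}" "{..<n}" k x y] unfolding set_eq of_nat_le_iff by auto
  define \<tau> where "\<tau> = (\<lambda>i. if i < n then \<sigma> i else i)"
  have "bij_betw \<tau> {..<n} {..<n}" using \<sigma>(1) by (subst bij_betw_cong[of _ _ \<sigma>]) (auto simp: \<tau>_def)
  then have perm: "\<tau> permutes {..<n}" by (rule bij_imp_permutes) (auto simp: \<tau>_def)
  define N where "N = (\<lambda>z. real (card {i. i < n \<and> (x i, y (\<tau> i)) = z}))"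
  have N: "real n * \<pi> z \<le> N z + 1" for z
  proof -
    obtain a b where z: "z = (a, b)" by fastforce
    have "{i \<in> {..<n}. x i = a \<and> y (\<sigma> i) = b} = {i. i < n \<and> (x i, y (\<tau> i)) = z}"
      by (auto simp: z \<tau>_def)
    then have "real (k z) \<le> N z" using \<sigma>(2)[of a b] by (simp add: N_def z)
    then show ?thesis using k(2)[of z] by linarith
  qed
  have cost: "(\<Sum>i<n. w (x i, y (\<tau> i))) = (\<Sum>z\<in>UNIV. N z * w z)" for w
    using sum_counts[of w "\<lambda>i. (x i, y (\<tau> i))" n] by (simp add: N_def)
  have tot: "(\<Sum>z\<in>UNIV. N z) = real n * (\<Sum>z\<in>UNIV. \<pi> z)"
  proof -
    have "(\<Sum>z\<in>UNIV. \<pi> z) = (\<Sum>a\<in>UNIV. \<Sum>b\<in>UNIV. \<pi> (a, b))"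
      unfolding sum.cartesian_product by simp
    then have "real n * (\<Sum>z\<in>UNIV. \<pi> z) = (\<Sum>a\<in>UNIV. real (card {i. i < n \<and> x i = a}))"
      using row by (simp add: sum_distrib_left)
    also have "\<dots> = real n" using sum_counts[of "\<lambda>_. 1" x n] by simp
    finally have "real n * (\<Sum>z\<in>UNIV. \<pi> z) = real n" .
    moreover have "(\<Sum>z\<in>UNIV. N z) = real n" using cost[of "\<lambda>_. 1"] by simp
    ultimately show ?thesis by (simp only:)
  qed
  have "(\<Sum>z\<in>UNIV. N z * c z) - real n * (\<Sum>z\<in>UNIV. \<pi> z * c z) = (\<Sum>z\<in>UNIV. (N z - real n * \<pi> z) * c z)"
    by (simp add: sum_distrib_left sum_subtractf left_diff_distrib mult.assoc)
  \<comment> \<open>A number t \<ge> -1 satisfies |t| \<le> t + 2. The one-sided bound on N thus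
    suffices, because the sums of N and of n * \<pi> agree and cancel.\<close>
  also have "\<dots> \<le> (\<Sum>z\<in>UNIV. (N z - real n * \<pi> z + 2) * K)"
  proof (rule sum_mono)
    fix z
    have "(N z - real n * \<pi> z) * c z \<le> \<bar>N z - real n * \<pi> z\<bar> * \<bar>c z\<bar>" by (metis abs_ge_self abs_mult)
    also have "\<dots> \<le> (N z - real n * \<pi> z + 2) * K"
      using N[of z] c[of z] by (intro mult_mono) auto
    finally show "(N z - real n * \<pi> z) * c z \<le> (N z - real n * \<pi> z + 2) * K" .
  qed
  also have "\<dots> = ((\<Sum>z\<in>UNIV. N z) - real n * (\<Sum>z\<in>UNIV. \<pi> z)) * K + (\<Sum>z\<in>(UNIV :: ('a \<times> 'b) set). 2 * K)"
    by (simp only: sum_distrib_right[symmetric] sum.distrib sum_subtractf sum_distrib_left[symmetric] distrib_right)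
  also have "\<dots> = 2 * real CARD('a \<times> 'b) * K" using tot by simp
  finally show ?thesis using perm cost[of c] by (intro exI[of _ \<tau>]) auto
qed

section \<open>Signed couplings\<close>

lemma prob_coupling_fst:
  assumes "R \<in> couplings P Q"
  shows "measure_pmf.prob R {z. fst z \<in> A} = measure_pmf.prob P A"
  using assms by (auto simp: couplings_def vimage_def)

lemma prob_coupling_snd:
  assumes "R \<in> couplings P Q"
  shows "measure_pmf.prob R {z. snd z \<in> A} = measure_pmf.prob Q A"
  using assms by (auto simp: couplings_def vimage_def)

lemma coupling_row_sum:
  fixes R :: "('a::finite \<times> 'b::finite) pmf"
  assumes "R \<in> couplings P Q"
  shows "(\<Sum>y\<in>UNIV. pmf R (x, y)) = pmf P x"
proof -
  have "pmf P x = measure_pmf.prob R (fst -` {x})"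
    using assms by (auto simp: couplings_def pmf_map)
  also have "fst -` {x} = Pair x ` UNIV" by auto
  finally show ?thesis by (simp add: measure_measure_pmf_finite sum.reindex inj_on_def)
qed

lemma coupling_col_sum:
  fixes R :: "('a::finite \<times> 'b::finite) pmf"
  assumes "R \<in> couplings P Q"
  shows "(\<Sum>x\<in>UNIV. pmf R (x, y)) = pmf Q y"
proof -
  have "pmf Q y = measure_pmf.prob R (snd -` {y})"
    using assms by (auto simp: couplings_def pmf_map)
  also have "snd -` {y} = (\<lambda>x. (x, y)) ` UNIV" by auto
  finally show ?thesis by (simp add: measure_measure_pmf_finite sum.reindex inj_on_def)
qed

lemma sum_pair: "(\<Sum>z\<in>UNIV. f z) = (\<Sum>a\<in>(UNIV :: 'a::finite set). \<Sum>b\<in>(UNIV :: 'b::finite set). f (a, b))"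
  unfolding sum.cartesian_product by simp

lemma full_support_lower_bound:
  fixes P :: "'a::finite pmf"
  assumes "set_pmf P = UNIV"
  obtains m where "m > 0" "\<And>x. m \<le> pmf P x"
proof (rule that[of "Min (range (pmf P))"])
  show "Min (range (pmf P)) > 0" using assms by (subst Min_gr_iff) (auto simp: pmf_positive)
qed auto

lemma signed_couplings_add:
  assumes "g \<in> signed_couplings bX bY" "h \<in> signed_couplings dX dY"
  shows "(\<lambda>z. g z + h z) \<in> signed_couplings (\<lambda>x. bX x + dX x) (\<lambda>y. bY y + dY y)"
  using assms by (simp add: signed_couplings_def sum.distrib)

text \<open>The sign constraint in \<open>theta\<close> describes a convex cone, so admissible plans
  for different marginals can be added.\<close>

lemma negative_part_add:
  fixes g h :: "'a \<Rightarrow> real"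
  assumes "{z. g z < 0} \<subseteq> S" "{z. h z < 0} \<subseteq> S"
  shows "{z. g z + h z < 0} \<subseteq> S"
proof
  fix z assume "z \<in> {z. g z + h z < 0}"
  then have "g z < 0 \<or> h z < 0" by auto
  then show "z \<in> S" using assms by blast
qed

lemma signed_couplings_scale:
  assumes "g \<in> signed_couplings bX bY"
  shows "(\<lambda>z. t * g z) \<in> signed_couplings (\<lambda>x. t * bX x) (\<lambda>y. t * bY y)"
  using assms by (simp add: signed_couplings_def sum_distrib_left[symmetric])

lemma zero_mass_scale: "b \<in> zero_mass \<Longrightarrow> (\<lambda>x. t * b x) \<in> zero_mass"
  by (simp add: zero_mass_def sum_distrib_left[symmetric])

lemma zero_mass_diff: "b \<in> zero_mass \<Longrightarrow> d \<in> zero_mass \<Longrightarrow> (\<lambda>x. b x - d x) \<in> zero_mass"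
  by (simp add: zero_mass_def sum_subtractf)

lemma signed_couplings_swap:
  "(\<lambda>z. g (prod.swap z)) \<in> signed_couplings bY bX \<longleftrightarrow> g \<in> signed_couplings bX bY"
  by (auto simp: signed_couplings_def)

lemma sum_swap_UNIV: "(\<Sum>z\<in>UNIV. f (prod.swap z)) = (\<Sum>z\<in>UNIV. f z)"
  using sum.reindex_bij_betw[OF bij_swap, of f] by simp

lemma theta_swap:
  "theta (\<lambda>z. c (prod.swap z)) (prod.swap ` S) bY bX = theta c S bX bY"
proof -
  have "{g \<in> signed_couplings bY bX. {z. g z < 0} \<subseteq> prod.swap ` S}
      = (\<lambda>g z. g (prod.swap z)) ` {g \<in> signed_couplings bX bY. {z. g z < 0} \<subseteq> S}"
  proof (intro equalityI subsetI)
    fix g assume g: "g \<in> {g \<in> signed_couplings bY bX. {z. g z < 0} \<subseteq> prod.swap ` S}"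
    then have "(\<lambda>z. g (prod.swap z)) \<in> {g \<in> signed_couplings bX bY. {z. g z < 0} \<subseteq> S}"
      by (force simp: signed_couplings_swap)
    then have "(\<lambda>z. (\<lambda>z. g (prod.swap z)) (prod.swap z)) \<in> (\<lambda>g z. g (prod.swap z)) ` {g \<in> signed_couplings bX bY. {z. g z < 0} \<subseteq> S}"
      by (rule imageI)
    then show "g \<in> (\<lambda>g z. g (prod.swap z)) ` {g \<in> signed_couplings bX bY. {z. g z < 0} \<subseteq> S}" by simp
  qed (force simp: signed_couplings_swap)
  then show ?thesis
    unfolding theta_def by (simp add: image_image sum_swap_UNIV[of "\<lambda>z. _ z * c z"])
qed

section \<open>Signed couplings around a fixed coupling\<close>

locale transport_scale = moderate_scale a for a :: "nat \<Rightarrow> real" +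
  fixes PX :: "'x::finite pmf" and PY :: "'y::finite pmf"
    and c :: "'x \<times> 'y \<Rightarrow> real" and Pstar :: "('x \<times> 'y) pmf"
  assumes PX: "set_pmf PX = UNIV" and PY: "set_pmf PY = UNIV"
    and Pstar: "Pstar \<in> couplings PX PY"
begin

abbreviation "S \<equiv> set_pmf Pstar"

definition cost :: "('x \<times> 'y \<Rightarrow> real) \<Rightarrow> real" where "cost g = (\<Sum>z\<in>UNIV. g z * c z)"

definition alpha :: real where "alpha = cost (pmf Pstar)"

definition excess :: "real \<Rightarrow> nat \<Rightarrow> real" where
  "excess \<Delta> n = excess_prob c PX PY n (alpha + \<Delta> * e n)"

abbreviation "close_to \<equiv> \<lambda>\<Delta> n. rearranged c n (alpha + \<Delta> * e n)"

abbreviation "devX \<equiv> dev e PX"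
abbreviation "devY \<equiv> dev e PY"

lemma e_nz: "n \<ge> 1 \<Longrightarrow> e n \<noteq> 0"
  using e_pos[of n] by simp

lemma cost_add: "cost (\<lambda>z. g z + h z) = cost g + cost h"
  by (simp add: cost_def sum.distrib distrib_right)

lemma cost_scale: "cost (\<lambda>z. t * g z) = t * cost g"
  by (simp add: cost_def sum_distrib_left mult.assoc)

lemma theta_less_iff:
  "theta c S bX bY < ereal m \<longleftrightarrow> (\<exists>g\<in>signed_couplings bX bY. {z. g z < 0} \<subseteq> S \<and> cost g < m)"
  by (auto simp: theta_def INF_less_iff cost_def)

lemma theta_le:
  "g \<in> signed_couplings bX bY \<Longrightarrow> {z. g z < 0} \<subseteq> S \<Longrightarrow> theta c S bX bY \<le> ereal (cost g)"
  unfolding theta_def cost_def by (rule INF_lower) auto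

(* The difference between an independent coupling of slightly perturbed marginals and Pstar. *)
lemma bounded_signed_coupling:
  obtains B where "B > 0"
    "\<And>r dX dY. r \<ge> 0 \<Longrightarrow> dX \<in> zero_mass \<Longrightarrow> dY \<in> zero_mass \<Longrightarrow> (\<And>x. \<bar>dX x\<bar> \<le> r) \<Longrightarrow> (\<And>y. \<bar>dY y\<bar> \<le> r) \<Longrightarrow>
      \<exists>g\<in>signed_couplings dX dY. {z. g z < 0} \<subseteq> S \<and> (\<forall>z. \<bar>g z\<bar> \<le> B * r)"
proof -
  obtain m1 where m1: "m1 > 0" "\<And>x. m1 \<le> pmf PX x" using full_support_lower_bound[OF PX] by blast
  obtain m2 where m2: "m2 > 0" "\<And>y. m2 \<le> pmf PY y" using full_support_lower_bound[OF PY] by blast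
  define m where "m = min m1 m2"
  have m: "m > 0" "\<And>x. m \<le> pmf PX x" "\<And>y. m \<le> pmf PY y"
    using m1 m2 by (auto simp: m_def min_le_iff_disj)
  show ?thesis
  proof (rule that[of "1 / m"])
    fix r :: real and dX :: "'x \<Rightarrow> real" and dY :: "'y \<Rightarrow> real"
    assume r: "r \<ge> 0" and z: "dX \<in> zero_mass" "dY \<in> zero_mass"
      and bd: "\<And>x. \<bar>dX x\<bar> \<le> r" "\<And>y. \<bar>dY y\<bar> \<le> r"
    show "\<exists>g\<in>signed_couplings dX dY. {z. g z < 0} \<subseteq> S \<and> (\<forall>z. \<bar>g z\<bar> \<le> 1 / m * r)"
    proof (cases "r = 0")
      case True
      then show ?thesis using bd by (intro bexI[of _ "\<lambda>_. 0"]) (auto simp: signed_couplings_def)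
    next
      case False
      \<comment> \<open>With this s the perturbations dX / s and dY / s stay below the smallest atom
        m, so p and q are probability vectors; multiplying the difference of the couplings by s
        restores dX and dY as marginals.\<close>
      define s where "s = r / m"
      have s: "s > 0" using False r m by (simp add: s_def)
      define p where "p = (\<lambda>x. pmf PX x + dX x / s)"
      define q where "q = (\<lambda>y. pmf PY y + dY y / s)"
      have le: "\<bar>d / s\<bar> \<le> m" if "\<bar>d\<bar> \<le> r" for d :: real
        using that s m by (simp add: abs_divide s_def field_simps abs_mult)
      have p: "p x \<ge> 0" for x using le[OF bd(1), of x] m(2)[of x] unfolding p_def by linarith
      have q: "q y \<ge> 0" for y using le[OF bd(2), of y] m(3)[of y] unfolding q_def by linarith
      have sp: "sum p UNIV = 1" "sum q UNIV = 1"
        using z by (auto simp: p_def q_def sum.distrib sum_pmf_UNIV sum_divide_distrib[symmetric] zero_mass_def)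
      have p1: "p x \<le> 1" for x using member_le_sum[of x UNIV p] p sp by simp
      have q1: "q y \<le> 1" for y using member_le_sum[of y UNIV q] q sp by simp
      define g where "g = (\<lambda>(x, y). s * (p x * q y - pmf Pstar (x, y)))"
      have "(\<Sum>y\<in>UNIV. g (x, y)) = dX x" for x
        using s by (simp add: g_def sum_distrib_left[symmetric] sum_subtractf coupling_row_sum[OF Pstar] sp p_def)
      moreover have "(\<Sum>x\<in>UNIV. g (x, y)) = dY y" for y
        using s by (simp add: g_def sum_distrib_left[symmetric] sum_distrib_right[symmetric] sum_subtractf coupling_col_sum[OF Pstar] sp q_def)
      moreover have "\<bar>g z\<bar> \<le> 1 / m * r" for z
      proof -
        obtain x y where xy: "z = (x, y)" by fastforce
        have "0 \<le> p x * q y" "p x * q y \<le> 1" using p q p1 q1 by (auto intro: mult_le_one)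
        then have "\<bar>p x * q y - pmf Pstar z\<bar> \<le> 1"
          using pmf_nonneg[of Pstar z] pmf_le_1[of Pstar z] by linarith
        then have "\<bar>g z\<bar> \<le> s * 1" using s unfolding g_def xy by (simp add: abs_mult)
        then show ?thesis by (simp add: s_def)
      qed
      moreover have "z \<in> S" if "g z < 0" for z
      proof (rule ccontr)
        assume "z \<notin> S"
        obtain x y where xy: "z = (x, y)" by fastforce
        have "g z = s * (p x * q y)" using \<open>z \<notin> S\<close> by (simp add: g_def xy set_pmf_iff)
        then show False using that s p[of x] q[of y] by (simp add: mult_less_0_iff not_less[symmetric])
      qed
      ultimately show ?thesis by (intro bexI[of _ g]) (auto simp: signed_couplings_def)
    qed
  qed (use m in simp)
qed

text \<open>Added to an admissible plan, such a g moves the marginals by r while changing the cost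
  upwards by at most B * r. In this form the Lipschitz continuity of \<open>theta\<close> is used;
  one constant serves for entries and cost.\<close>

lemma small_signed_coupling:
  obtains B where "B > 0"
    "\<And>r dX dY. r \<ge> 0 \<Longrightarrow> dX \<in> zero_mass \<Longrightarrow> dY \<in> zero_mass \<Longrightarrow> (\<And>x. \<bar>dX x\<bar> \<le> r) \<Longrightarrow> (\<And>y. \<bar>dY y\<bar> \<le> r) \<Longrightarrow>
      \<exists>g\<in>signed_couplings dX dY. {z. g z < 0} \<subseteq> S \<and> (\<forall>z. \<bar>g z\<bar> \<le> B * r) \<and> cost g \<le> B * r"
proof -
  obtain B where B: "B > 0" "\<And>r dX dY. r \<ge> 0 \<Longrightarrow> dX \<in> zero_mass \<Longrightarrow> dY \<in> zero_mass \<Longrightarrow> (\<And>x. \<bar>dX x\<bar> \<le> r) \<Longrightarrow> (\<And>y. \<bar>dY y\<bar> \<le> r) \<Longrightarrow>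
      \<exists>g\<in>signed_couplings dX dY. {z. g z < 0} \<subseteq> S \<and> (\<forall>z. \<bar>g z\<bar> \<le> B * r)"
    using bounded_signed_coupling by blast
  define M where "M = 1 + (\<Sum>z\<in>UNIV. \<bar>c z\<bar>)"
  have M: "M \<ge> 1" by (auto simp: M_def intro: sum_nonneg)
  show ?thesis
  proof (rule that[of "B * M"])
    show "B * M > 0" using B M by simp
    fix r :: real and dX :: "'x \<Rightarrow> real" and dY :: "'y \<Rightarrow> real"
    assume r: "r \<ge> 0" and z: "dX \<in> zero_mass" "dY \<in> zero_mass" "\<And>x. \<bar>dX x\<bar> \<le> r" "\<And>y. \<bar>dY y\<bar> \<le> r"
    obtain g where g: "g \<in> signed_couplings dX dY" "{z. g z < 0} \<subseteq> S" "\<And>z. \<bar>g z\<bar> \<le> B * r"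
      using B(2)[OF r z] by blast
    have Br: "0 \<le> B * r" using B r by simp
    have "cost g \<le> (\<Sum>z\<in>UNIV. B * r * \<bar>c z\<bar>)"
      unfolding cost_def
    proof (rule sum_mono)
      fix z
      have "g z * c z \<le> \<bar>g z\<bar> * \<bar>c z\<bar>" by (metis abs_ge_self abs_mult)
      also have "\<dots> \<le> B * r * \<bar>c z\<bar>" using g(3)[of z] by (intro mult_right_mono) auto
      finally show "g z * c z \<le> B * r * \<bar>c z\<bar>" .
    qed
    also have "\<dots> \<le> B * r * M" unfolding sum_distrib_left[symmetric] using Br by (intro mult_left_mono) (auto simp: M_def)
    finally have "cost g \<le> B * M * r" by (simp add: mult_ac)
    moreover have "\<bar>g z\<bar> \<le> B * M * r" for z
      using g(3)[of z] mult_left_mono[OF M Br] by (simp add: mult_ac)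
    ultimately show "\<exists>g\<in>signed_couplings dX dY. {z. g z < 0} \<subseteq> S \<and> (\<forall>z. \<bar>g z\<bar> \<le> B * M * r) \<and> cost g \<le> B * M * r"
      using g by blast
  qed
qed

text \<open>Outside S the coupling \<open>Pstar\<close> has no mass, so there the joint deviation is
  a count divided by n * e n and cannot be negative. This is the origin of the sign
  constraint.\<close>

lemma theta_dev_le:
  assumes n: "n \<ge> 1"
  shows "theta c S (devX n x) (devY n y) \<le> ereal ((avg_cost c n (x, y) - alpha) / e n)"
proof -
  let ?g = "dev e Pstar n (\<lambda>i. (x i, y i))"
  note sd = sum_dev[of n e Pstar "\<lambda>i. (x i, y i)", OF n e_nz[OF n]]
  have sum_if: "(\<Sum>i<n. if Q i then 1 else 0) = real (card {i. i < n \<and> Q i})" for Q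
    by (simp add: sum.If_cases Int_def)
  have "(\<Sum>b\<in>UNIV. ?g (a, b)) = devX n x a" for a
  proof -
    have "(\<Sum>b\<in>UNIV. ?g (a, b)) = (\<Sum>z\<in>UNIV. ?g z * (if fst z = a then 1 else 0))"
      unfolding sum_pair by (simp add: sum.delta' if_distrib[of "\<lambda>t. _ * t"] sum.swap[of _ UNIV UNIV] cong: if_cong)
    also have "\<dots> = (real (card {i. i < n \<and> x i = a}) - real n * pmf PX a) / (real n * e n)"
      unfolding sd expectation_finite_type sum_pair
      by (simp add: sum_if if_distrib[of "\<lambda>t. _ * t"] sum.swap[of _ UNIV UNIV] coupling_row_sum[OF Pstar] cong: if_cong)
    also have "\<dots> = devX n x a" using n by (simp add: dev_def field_simps)
    finally show ?thesis .
  qed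
  moreover have "(\<Sum>a\<in>UNIV. ?g (a, b)) = devY n y b" for b
  proof -
    have "(\<Sum>a\<in>UNIV. ?g (a, b)) = (\<Sum>z\<in>UNIV. ?g z * (if snd z = b then 1 else 0))"
      unfolding sum_pair by (simp add: if_distrib[of "\<lambda>t. _ * t"] cong: if_cong)
    also have "\<dots> = (real (card {i. i < n \<and> y i = b}) - real n * pmf PY b) / (real n * e n)"
      unfolding sd expectation_finite_type sum_pair
      by (simp add: sum_if if_distrib[of "\<lambda>t. _ * t"] coupling_col_sum[OF Pstar] cong: if_cong)
    also have "\<dots> = devY n y b" using n by (simp add: dev_def field_simps)
    finally show ?thesis .
  qed
  ultimately have "?g \<in> signed_couplings (devX n x) (devY n y)" by (simp add: signed_couplings_def)
  moreover have "{z. ?g z < 0} \<subseteq> S"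
  proof (safe, rule ccontr)
    fix z1 z2 assume "?g (z1, z2) < 0" "(z1, z2) \<notin> S"
    then show False using e_pos[OF n] by (simp add: dev_def set_pmf_iff divide_less_0_iff)
  qed
  ultimately have "theta c S (devX n x) (devY n y) \<le> ereal (cost ?g)" by (rule theta_le)
  also have "cost ?g = (avg_cost c n (x, y) - alpha) / e n"
    unfolding cost_def sd using n e_nz[OF n]
    by (simp add: avg_cost_def alpha_def cost_def expectation_finite_type field_simps)
  finally show ?thesis .
qed

(* The radius depends on the gap h only, not on the plan g. *)
lemma eventually_close_to:
  assumes h: "h > 0"
  obtains r where "r > 0"
    "\<And>bX bY g r'. bX \<in> zero_mass \<Longrightarrow> bY \<in> zero_mass \<Longrightarrow> g \<in> signed_couplings bX bY \<Longrightarrow> {z. g z < 0} \<subseteq> S \<Longrightarrow>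
      cost g \<le> \<Delta> - h \<Longrightarrow> r' \<le> r \<Longrightarrow> 0 \<le> r' \<Longrightarrow>
      \<forall>\<^sub>F n in sequentially. \<forall>x y. (\<forall>z. \<bar>devX n x z - bX z\<bar> \<le> r') \<longrightarrow> (\<forall>z. \<bar>devY n y z - bY z\<bar> \<le> r') \<longrightarrow> close_to \<Delta> n x y"
proof -
  obtain B where B: "B > 0" "\<And>r dX dY. r \<ge> 0 \<Longrightarrow> dX \<in> zero_mass \<Longrightarrow> dY \<in> zero_mass \<Longrightarrow> (\<And>x. \<bar>dX x\<bar> \<le> r) \<Longrightarrow> (\<And>y. \<bar>dY y\<bar> \<le> r) \<Longrightarrow>
      \<exists>g\<in>signed_couplings dX dY. {z. g z < 0} \<subseteq> S \<and> (\<forall>z. \<bar>g z\<bar> \<le> B * r) \<and> cost g \<le> B * r"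
    using small_signed_coupling by blast
  define K where "K = Max (range (\<lambda>z. \<bar>c z\<bar>))"
  have K: "\<bar>c z\<bar> \<le> K" for z unfolding K_def by (rule Max_ge) auto
  define D where "D = 2 * real CARD('x \<times> 'y) * K"
  show ?thesis
  proof (rule that[of "h / (2 * B)"])
    show "h / (2 * B) > 0" using h B by simp
    fix bX :: "'x \<Rightarrow> real" and bY :: "'y \<Rightarrow> real" and g :: "'x \<times> 'y \<Rightarrow> real" and r' :: real
    assume b: "bX \<in> zero_mass" "bY \<in> zero_mass" and g: "g \<in> signed_couplings bX bY" "{z. g z < 0} \<subseteq> S"
      "cost g \<le> \<Delta> - h" and r': "r' \<le> h / (2 * B)" "0 \<le> r'"
    have Br: "B * r' \<le> h / 2" using r' B by (simp add: field_simps)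
    define G where "G = Max (range (\<lambda>z. \<bar>g z\<bar>)) + B * r'"
    have G: "\<bar>g z\<bar> + B * r' \<le> G" for z unfolding G_def by (intro add_right_mono Max_ge) auto
    have "\<forall>\<^sub>F n in sequentially. \<forall>z\<in>S. G * e n < pmf Pstar z"
      by (intro eventually_ball_finite ballI ev_e_small) (auto simp: pmf_positive)
    moreover have "\<forall>\<^sub>F n in sequentially. D * e n < h / 2" using h by (intro ev_e_small) auto
    moreover have "\<forall>\<^sub>F n in sequentially. 1 \<le> 1 / a n"
      using inverse_a_at_top by (auto simp: filterlim_at_top)
    ultimately show "\<forall>\<^sub>F n in sequentially. \<forall>x y. (\<forall>z. \<bar>devX n x z - bX z\<bar> \<le> r') \<longrightarrow> (\<forall>z. \<bar>devY n y z - bY z\<bar> \<le> r') \<longrightarrow> close_to \<Delta> n x y"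
      using ev_ge1
    proof (eventually_elim, intro allI impI)
      fix n x y
      assume S: "\<forall>z\<in>S. G * e n < pmf Pstar z" and D: "D * e n < h / 2" and an: "1 \<le> 1 / a n" and n: "n \<ge> 1"
        and x: "\<forall>z. \<bar>devX n x z - bX z\<bar> \<le> r'" and y: "\<forall>z. \<bar>devY n y z - bY z\<bar> \<le> r'"
      have en: "e n > 0" using e_pos[OF n] .
      obtain d where d: "d \<in> signed_couplings (\<lambda>z. devX n x z - bX z) (\<lambda>z. devY n y z - bY z)"
        "{z. d z < 0} \<subseteq> S" "\<And>z. \<bar>d z\<bar> \<le> B * r'" "cost d \<le> B * r'"
        using B(2)[OF r'(2) zero_mass_diff[OF dev_zero_mass[of n e, OF n e_nz[OF n]] b(1)] zero_mass_diff[OF dev_zero_mass[of n e, OF n e_nz[OF n]] b(2)]] x y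
        by blast
      define f where "f = (\<lambda>z. g z + d z)"
      have f: "f \<in> signed_couplings (devX n x) (devY n y)"
        using signed_couplings_add[OF g(1) d(1)] by (simp add: f_def)
      have cf: "cost f \<le> \<Delta> - h / 2" using g(3) d(4) Br by (simp add: f_def cost_add)
      \<comment> \<open>A plan with exactly the two types as marginals. On S the positive atoms of
        \<open>Pstar\<close> absorb e n * f once n is large; off S both g and d are
        nonnegative.\<close>
      define w where "w = (\<lambda>z. pmf Pstar z + e n * f z)"
      have w0: "0 \<le> w z" for z
      proof (cases "z \<in> S")
        case True
        have "\<bar>f z\<bar> \<le> G" using G[of z] d(3)[of z] by (simp add: f_def)
        then have "e n * (- f z) \<le> e n * G" using en by (intro mult_left_mono) auto
        moreover have "G * e n < pmf Pstar z" using S True by blast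
        ultimately show ?thesis by (simp add: w_def mult.commute)
      next
        case False
        then have "0 \<le> g z" "0 \<le> d z" using g(2) d(2) by (auto simp: not_less[symmetric])
        then show ?thesis using en by (simp add: w_def f_def)
      qed
      have "real n * (\<Sum>b\<in>UNIV. w (a, b)) = real (card {i. i < n \<and> x i = a})" for a
      proof -
        have "(\<Sum>b\<in>UNIV. w (a, b)) = pmf PX a + e n * devX n x a"
          using f by (simp add: w_def sum.distrib coupling_row_sum[OF Pstar] sum_distrib_left[symmetric] signed_couplings_def)
        then show ?thesis using n en by (simp add: dev_def)
      qed
      moreover have "real n * (\<Sum>a\<in>UNIV. w (a, b)) = real (card {i. i < n \<and> y i = b})" for b
      proof -
        have "(\<Sum>a\<in>UNIV. w (a, b)) = pmf PY b + e n * devY n y b"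
          using f by (simp add: w_def sum.distrib coupling_col_sum[OF Pstar] sum_distrib_left[symmetric] signed_couplings_def)
        then show ?thesis using n en by (simp add: dev_def)
      qed
      ultimately obtain \<sigma> where \<sigma>: "\<sigma> permutes {..<n}" "(\<Sum>i<n. c (x i, y (\<sigma> i))) \<le> real n * cost w + D"
        using rearrangement_of_plan[of w n x y c K, OF w0 _ _ K] unfolding D_def cost_def by blast
      have "cost w = alpha + e n * cost f" unfolding w_def cost_add cost_scale alpha_def ..
      also have "\<dots> \<le> alpha + e n * (\<Delta> - h / 2)" using cf en by simp
      finally have cw: "cost w \<le> alpha + e n * (\<Delta> - h / 2)" .
      have "D * e n \<le> h / 2 * (1 / a n)"
        using mult_left_mono[OF an, of "h / 2"] D h by linarith
      also have "\<dots> = (h / 2 * real n * e n) * e n" using n_e_sq[OF n] by (simp add: power2_eq_square mult_ac)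
      finally have "D \<le> h / 2 * real n * e n" using en by simp
      then have "(\<Sum>i<n. c (x i, y (\<sigma> i))) \<le> real n * (alpha + e n * (\<Delta> - h / 2)) + h / 2 * real n * e n"
        using \<sigma>(2) mult_left_mono[OF cw, of "real n"] by linarith
      also have "\<dots> = real n * (alpha + \<Delta> * e n)" by (simp add: algebra_simps)
      finally have "avg_cost c n (x, y \<circ> \<sigma>) \<le> alpha + \<Delta> * e n"
        using n by (simp add: avg_cost_def pos_divide_le_eq mult.commute)
      then show "close_to \<Delta> n x y" using \<sigma>(1) by (auto simp: rearranged_def)
    qed
  qed
qed

end

section \<open>Bounds on the excess probability\<close>

lemma excess_prob_swap_le:
  "excess_prob (\<lambda>z. c (prod.swap z)) Q P n \<alpha> \<le> excess_prob c P Q n \<alpha>"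
proof (rule excess_prob_ge)
  fix R assume R: "R \<in> couplings (product_pmf n P) (product_pmf n Q)"
  have "map_pmf prod.swap R \<in> couplings (product_pmf n Q) (product_pmf n P)"
    using R by (auto simp: couplings_def map_pmf_comp)
  then have "excess_prob (\<lambda>z. c (prod.swap z)) Q P n \<alpha>
      \<le> measure_pmf.prob (map_pmf prod.swap R) {z. avg_cost (\<lambda>z. c (prod.swap z)) n z > \<alpha>}"
    by (rule excess_prob_le)
  also have "\<dots> = measure_pmf.prob R {z. avg_cost c n z > \<alpha>}"
    by (simp add: vimage_def avg_cost_def case_prod_unfold)
  finally show "excess_prob (\<lambda>z. c (prod.swap z)) Q P n \<alpha> \<le> measure_pmf.prob R {z. avg_cost c n z > \<alpha>}" .
qed

lemma excess_prob_swap: "excess_prob (\<lambda>z. c (prod.swap z)) Q P n \<alpha> = excess_prob c P Q n \<alpha>"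
  using excess_prob_swap_le[of c Q P n \<alpha>] excess_prob_swap_le[of "\<lambda>z. c (prod.swap z)" P Q n \<alpha>]
  by simp

lemma rearranged_swapD:
  assumes "rearranged (\<lambda>z. c (prod.swap z)) n \<alpha> y x"
  shows "rearranged c n \<alpha> x y"
proof -
  obtain \<sigma> where \<sigma>: "\<sigma> permutes {..<n}" "avg_cost (\<lambda>z. c (prod.swap z)) n (y, x \<circ> \<sigma>) \<le> \<alpha>"
    using assms by (auto simp: rearranged_def)
  have "avg_cost (\<lambda>z. c (prod.swap z)) n (y, x \<circ> \<sigma>) = avg_cost c n (x \<circ> \<sigma>, y)"
    by (simp add: avg_cost_def)
  also have "\<dots> = avg_cost c n (x \<circ> \<sigma> \<circ> inv \<sigma>, y \<circ> inv \<sigma>)"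
    by (rule avg_cost_permute[OF permutes_inv[OF \<sigma>(1)], symmetric])
  also have "x \<circ> \<sigma> \<circ> inv \<sigma> = x" using permutes_inv_o(1)[OF \<sigma>(1)] by (simp add: comp_assoc)
  finally have "avg_cost c n (x, y \<circ> inv \<sigma>) \<le> \<alpha>" using \<sigma>(2) by (simp only:)
  then show ?thesis using permutes_inv[OF \<sigma>(1)] unfolding rearranged_def by blast
qed

lemma rearranged_swap: "rearranged (\<lambda>z. c (prod.swap z)) n \<alpha> y x \<longleftrightarrow> rearranged c n \<alpha> x y"
  using rearranged_swapD[of c n \<alpha> y x] rearranged_swapD[of "\<lambda>z. c (prod.swap z)" n \<alpha> x y] by auto

lemma excess_prob_le_1: "excess_prob c P Q n \<alpha> \<le> 1"
proof -
  obtain R where "R \<in> couplings (product_pmf n P) (product_pmf n Q)" using couplings_nonempty by blast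
  from excess_prob_le[OF this, of c \<alpha>] show ?thesis
    using measure_pmf.prob_le_1 order.trans by blast
qed

context transport_scale
begin

lemma theta_cost_le_dev:
  assumes "n \<ge> 1" "avg_cost c n (x, y) \<le> alpha + \<Delta> * e n"
  shows "theta c S (devX n x) (devY n y) \<le> ereal \<Delta>"
proof -
  have "theta c S (devX n x) (devY n y) \<le> ereal ((avg_cost c n (x, y) - alpha) / e n)"
    by (rule theta_dev_le[OF assms(1)])
  also have "\<dots> \<le> ereal \<Delta>"
    using assms e_pos by (simp add: pos_divide_le_eq)
  finally show ?thesis .
qed

text \<open>Under every coupling a cheap pair has deviations with \<open>theta\<close> at most
  \<Delta>, so one of the two norms is large. A union bound over the two marginal tails explains the
  maximum in \<open>f_tilde\<close>.\<close>

lemma complement_excess_upper: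
  assumes "ereal l < f_tilde c S PX PY \<Delta>"
  shows "\<forall>\<^sub>F n in sequentially. 1 - excess \<Delta> n \<le> exp (- l / a n)"
proof -
  obtain l' where l': "l < l'" "ereal l' < f_tilde c S PX PY \<Delta>"
    using ereal_dense2[OF assms] by auto
  obtain m where m: "l < m" "m < l'" using l'(1) dense by blast
  have key: "l' \<le> 1 / 2 * weighted_sq PX bX \<or> l' \<le> 1 / 2 * weighted_sq PY bY"
    if "bX \<in> zero_mass" "bY \<in> zero_mass" "theta c S bX bY \<le> ereal \<Delta>" for bX bY
  proof -
    have "f_tilde c S PX PY \<Delta> \<le> ereal (max (1 / 2 * weighted_sq PX bX) (1 / 2 * weighted_sq PY bY))"
      unfolding f_tilde_def using that by (intro INF_lower2[of "(bX, bY)"]) auto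
    then have "ereal l' < ereal (max (1 / 2 * weighted_sq PX bX) (1 / 2 * weighted_sq PY bY))"
      using l'(2) less_le_trans by blast
    then show ?thesis by (auto simp: less_max_iff_disj)
  qed
  have "\<forall>\<^sub>F n in sequentially. 2 * exp (- m / a n) \<le> exp (- l / a n)"
    by (rule ev_exp_absorb) (use m in auto)
  then show ?thesis
    using dev_norm_tail[OF PX m(2)] dev_norm_tail[OF PY m(2)] ev_ge1
  proof eventually_elim
    case (elim n)
    let ?EX = "{x. l' \<le> 1 / 2 * weighted_sq PX (devX n x)}"
    let ?EY = "{y. l' \<le> 1 / 2 * weighted_sq PY (devY n y)}"
    have "1 - exp (- l / a n) \<le> excess \<Delta> n"
      unfolding excess_def
    proof (rule excess_prob_ge)
      fix R assume R: "R \<in> couplings (product_pmf n PX) (product_pmf n PY)"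
      let ?A = "{z. avg_cost c n z > alpha + \<Delta> * e n}"
      have "UNIV \<subseteq> ?A \<union> ({z. fst z \<in> ?EX} \<union> {z. snd z \<in> ?EY})"
      proof
        fix z :: "(nat \<Rightarrow> 'x) \<times> (nat \<Rightarrow> 'y)"
        obtain x y where z: "z = (x, y)" by fastforce
        have "l' \<le> 1 / 2 * weighted_sq PX (devX n x) \<or> l' \<le> 1 / 2 * weighted_sq PY (devY n y)"
          if "avg_cost c n z \<le> alpha + \<Delta> * e n"
          using elim(4) that z by (intro key dev_zero_mass e_nz theta_cost_le_dev) auto
        then show "z \<in> ?A \<union> ({z. fst z \<in> ?EX} \<union> {z. snd z \<in> ?EY})"
          by (force simp: z)
      qed
      then have "1 \<le> measure_pmf.prob R (?A \<union> ({z. fst z \<in> ?EX} \<union> {z. snd z \<in> ?EY}))"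
        by (simp add: top.extremum_unique)
      also have "\<dots> \<le> measure_pmf.prob R ?A + (measure_pmf.prob R {z. fst z \<in> ?EX} + measure_pmf.prob R {z. snd z \<in> ?EY})"
        by (intro order.trans[OF measure_Un_le] add_mono) auto
      finally show "1 - exp (- l / a n) \<le> measure_pmf.prob R ?A"
        unfolding prob_coupling_fst[OF R] prob_coupling_snd[OF R] using elim(1-3) by linarith
    qed
    then show ?case by linarith
  qed
qed

text \<open>The constraint gives only \<open>theta\<close> \<le> \<Delta>, without room. As \<Delta>
  is negative, scaling both deviations by t > 1 creates room, and t^2 * q stays below u for t close
  to 1.\<close>

lemma complement_excess_lower:
  assumes D: "\<Delta> < 0" and u: "f_tilde c S PX PY \<Delta> < ereal u"
  shows "\<forall>\<^sub>F n in sequentially. exp (- u / a n) \<le> 1 - excess \<Delta> n"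
proof -
  obtain bX bY where b: "bX \<in> zero_mass" "bY \<in> zero_mass" "theta c S bX bY \<le> ereal \<Delta>"
    "max (1 / 2 * weighted_sq PX bX) (1 / 2 * weighted_sq PY bY) < u"
    using u unfolding f_tilde_def INF_less_iff by auto
  define q where "q = max (1 / 2 * weighted_sq PX bX) (1 / 2 * weighted_sq PY bY)"
  have q: "0 \<le> q" "q < u" using b(4) weighted_sq_nonneg[of PX bX] by (auto simp: q_def)
  define t where "t = sqrt (1 + (u - q) / (2 * (1 + q)))"
  have t: "t > 1" using q by (simp add: t_def)
  have tq: "t\<^sup>2 * q < u"
  proof -
    have "t\<^sup>2 * q = q + (u - q) / 2 * (q / (1 + q))"
      using q by (simp add: t_def field_simps)
    also have "\<dots> \<le> q + (u - q) / 2 * 1" using q by (intro add_left_mono mult_left_mono) auto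
    also have "\<dots> < u" using q by argo
    finally show ?thesis .
  qed
  have "\<Delta> * t < \<Delta> * 1" using D t by (intro mult_strict_left_mono_neg) auto
  then have "\<Delta> < \<Delta> / t" using t by (simp add: pos_less_divide_eq)
  then have "theta c S bX bY < ereal (\<Delta> / t)" using b(3) le_less_trans by fastforce
  then obtain g where g: "g \<in> signed_couplings bX bY" "{z. g z < 0} \<subseteq> S" "cost g < \<Delta> / t"
    unfolding theta_less_iff by blast
  define h where "h = \<Delta> - t * cost g"
  have h: "h > 0" using g(3) t by (simp add: h_def pos_less_divide_eq mult.commute)
  obtain r where r: "r > 0" "\<And>bX bY g r'. bX \<in> zero_mass \<Longrightarrow> bY \<in> zero_mass \<Longrightarrow> g \<in> signed_couplings bX bY \<Longrightarrow> {z. g z < 0} \<subseteq> S \<Longrightarrow>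
      cost g \<le> \<Delta> - h \<Longrightarrow> r' \<le> r \<Longrightarrow> 0 \<le> r' \<Longrightarrow>
      \<forall>\<^sub>F n in sequentially. \<forall>x y. (\<forall>z. \<bar>devX n x z - bX z\<bar> \<le> r') \<longrightarrow> (\<forall>z. \<bar>devY n y z - bY z\<bar> \<le> r') \<longrightarrow> close_to \<Delta> n x y"
    by (rule eventually_close_to[OF h, of \<Delta>]) (rule that)
  let ?bX = "\<lambda>x. t * bX x" and ?bY = "\<lambda>y. t * bY y"
  have "{z. t * g z < 0} \<subseteq> S" using g(2) t by (auto simp: mult_less_0_iff)
  then have ev: "\<forall>\<^sub>F n in sequentially. \<forall>x y. (\<forall>z. \<bar>devX n x z - ?bX z\<bar> \<le> r) \<longrightarrow> (\<forall>z. \<bar>devY n y z - ?bY z\<bar> \<le> r) \<longrightarrow> close_to \<Delta> n x y"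
    using r(1)
    by (intro r(2)[OF zero_mass_scale[OF b(1)] zero_mass_scale[OF b(2)] signed_couplings_scale[OF g(1), of t]])
      (auto simp: cost_scale h_def)
  have "1 / 2 * weighted_sq PX ?bX \<le> t\<^sup>2 * q" "1 / 2 * weighted_sq PY ?bY \<le> t\<^sup>2 * q"
    using mult_left_mono[of "1 / 2 * weighted_sq PX bX" q "t\<^sup>2"] mult_left_mono[of "1 / 2 * weighted_sq PY bY" q "t\<^sup>2"]
    by (simp_all add: weighted_sq_scale q_def)
  then have "1 / 2 * weighted_sq PX ?bX < u" "1 / 2 * weighted_sq PY ?bY < u" using tq by linarith+
  from dev_ball_lower[OF PX this(1) r(1) zero_mass_scale[OF b(1)]]
    dev_ball_lower[OF PY this(2) r(1) zero_mass_scale[OF b(2)]] ev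
  show ?thesis
  proof eventually_elim
    case (elim n)
    let ?A = "{x. \<forall>z. \<bar>devX n x z - ?bX z\<bar> \<le> r}" and ?B = "{y. \<forall>z. \<bar>devY n y z - ?bY z\<bar> \<le> r}"
    have "excess \<Delta> n \<le> 1 - exp (- u / a n)"
      unfolding excess_def
    proof (rule excess_prob_le_hall)
      show "0 \<le> 1 - exp (- u / a n)"
        using elim(1) measure_pmf.prob_le_1[of "product_pmf n PX" ?A] by linarith
      fix C
      show "measure_pmf.prob (product_pmf n PX) C
         \<le> measure_pmf.prob (product_pmf n PY) {y. \<exists>x\<in>C. close_to \<Delta> n x y} + (1 - exp (- u / a n))"
      \<comment> \<open>All of ?A is related to all of ?B, and each ball has probability at least
        exp (- u / a n). So C either misses ?A, and is small enough, or has all of ?B among its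
        neighbours.\<close>
      proof (cases "C \<inter> ?A = {}")
        case True
        then have "measure_pmf.prob (product_pmf n PX) C + measure_pmf.prob (product_pmf n PX) ?A
            = measure_pmf.prob (product_pmf n PX) (C \<union> ?A)"
          by (intro measure_pmf.finite_measure_Union[symmetric]) auto
        also have "\<dots> \<le> 1" by (rule measure_pmf.prob_le_1)
        finally show ?thesis
          using elim(1) measure_nonneg[of "product_pmf n PY" "{y. \<exists>x\<in>C. close_to \<Delta> n x y}"] by linarith
      next
        case False
        then have "?B \<subseteq> {y. \<exists>x\<in>C. close_to \<Delta> n x y}" using elim(3) by blast
        then have "measure_pmf.prob (product_pmf n PY) ?B \<le> measure_pmf.prob (product_pmf n PY) {y. \<exists>x\<in>C. close_to \<Delta> n x y}"
          by (intro measure_pmf.finite_measure_mono) auto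
        then show ?thesis
          using elim(2) measure_pmf.prob_le_1[of "product_pmf n PX" C] by linarith
      qed
    qed
    then show ?case by linarith
  qed
qed

text \<open>Words near b are too expensive to pair with any word of norm up to slightly more than
  that of b. Words of still larger norm are exponentially rarer than the ball around b, so no
  coupling can use them to serve the whole ball.\<close>

lemma excess_lower_one_sided:
  assumes D: "\<Delta> > 0" and u: "g_one_sided (theta c S) PX PY \<Delta> < ereal u"
  shows "\<forall>\<^sub>F n in sequentially. exp (- u / a n) \<le> excess \<Delta> n"
proof -
  obtain b where b: "b \<in> zero_mass" "1 / 2 * weighted_sq PX b < u"
    and inf: "ereal \<Delta> < (INF b'\<in>{b' \<in> zero_mass. weighted_sq PY b' \<le> weighted_sq PX b}. theta c S b b')"
    using u unfolding g_one_sided_def INF_less_iff by auto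
  obtain m where m: "\<Delta> < m" "ereal m < (INF b'\<in>{b' \<in> zero_mass. weighted_sq PY b' \<le> weighted_sq PX b}. theta c S b b')"
    using ereal_dense2[OF inf] by auto
  have far: "\<not> theta c S b b' < ereal m" if "b' \<in> zero_mass" "weighted_sq PY b' \<le> weighted_sq PX b" for b'
    using that by (intro leD less_imp_le[OF less_le_trans[OF m(2)]] INF_lower) auto
  define q where "q = weighted_sq PX b"
  \<comment> \<open>For b = 0 the zero partner and the zero plan would give \<open>theta\<close>
    \<le> 0 < m. Positivity makes t^2 * q strictly larger than q below.\<close>
  have q: "q > 0"
  proof (rule ccontr)
    assume "\<not> q > 0"
    then have "q = 0" using weighted_sq_nonneg[of PX b] by (simp add: q_def)
    then have "b x = 0" for x using sq_le_weighted_sq[OF PX, of b x] by (simp add: q_def)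
    then have "(\<lambda>_. 0) \<in> signed_couplings b (\<lambda>_. 0)" by (simp add: signed_couplings_def)
    then have "theta c S b (\<lambda>_. 0) \<le> ereal (cost (\<lambda>_. 0))" by (rule theta_le) auto
    also have "\<dots> < ereal m" using m(1) D by (simp add: cost_def)
    finally show False using far[of "\<lambda>_. 0"] weighted_sq_nonneg[of PX b]
      by (simp add: zero_mass_def weighted_sq_def[of PY])
  qed
  obtain B where B: "B > 0" "\<And>r dX dY. r \<ge> 0 \<Longrightarrow> dX \<in> zero_mass \<Longrightarrow> dY \<in> zero_mass \<Longrightarrow> (\<And>x. \<bar>dX x\<bar> \<le> r) \<Longrightarrow> (\<And>y. \<bar>dY y\<bar> \<le> r) \<Longrightarrow>
      \<exists>g\<in>signed_couplings dX dY. {z. g z < 0} \<subseteq> S \<and> (\<forall>z. \<bar>g z\<bar> \<le> B * r) \<and> cost g \<le> B * r"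
    using small_signed_coupling by blast
  \<comment> \<open>Half of the room m - \<Delta> pays for correcting the marginals to b and the
    scaled partner; the other half is left for a plan that only approximates the infimum.\<close>
  define r where "r = (m - \<Delta>) / (2 * B)"
  have r: "r > 0" "B * r = (m - \<Delta>) / 2" using B m by (auto simp: r_def)
  \<comment> \<open>Dividing a deviation by t brings its norm down to that of b and moves each
    coordinate by at most (t - 1) * (1 + q) = r.\<close>
  define t where "t = 1 + r / (1 + q)"
  have t: "t > 1" using r q by (simp add: t_def)
  have t1: "(t - 1) * (1 + q) = r" using q by (simp add: t_def)
  have large: "avg_cost c n (x, y) > alpha + \<Delta> * e n"
    if n: "n \<ge> 1" and x: "\<forall>z. \<bar>devX n x z - b z\<bar> \<le> r" and y: "weighted_sq PY (devY n y) < t\<^sup>2 * q" for n x y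
  proof (rule ccontr)
    assume "\<not> ?thesis"
    then have "theta c S (devX n x) (devY n y) \<le> ereal \<Delta>" using n by (intro theta_cost_le_dev) auto
    also have "\<dots> < ereal (\<Delta> + (m - \<Delta>) / 2)" using m by simp
    finally obtain g where g: "g \<in> signed_couplings (devX n x) (devY n y)" "{z. g z < 0} \<subseteq> S" "cost g < \<Delta> + (m - \<Delta>) / 2"
      unfolding theta_less_iff by blast
    define bY where "bY = (\<lambda>z. 1 / t * devY n y z)"
    have zX: "devX n x \<in> zero_mass" and zY: "devY n y \<in> zero_mass" using n e_nz by (auto intro: dev_zero_mass)
    have bY: "bY \<in> zero_mass" unfolding bY_def by (rule zero_mass_scale[OF zY])
    have "weighted_sq PY bY = (1 / t)\<^sup>2 * weighted_sq PY (devY n y)" unfolding bY_def by (rule weighted_sq_scale)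
    also have "\<dots> \<le> (1 / t)\<^sup>2 * (t\<^sup>2 * q)" using y by (intro mult_left_mono) auto
    also have "\<dots> = q" using t by (simp add: power_divide)
    finally have bYq: "weighted_sq PY bY \<le> q" .
    have "\<bar>bY z - devY n y z\<bar> \<le> r" for z
    proof -
      have "devY n y z = t * bY z" using t by (simp add: bY_def)
      then have "bY z - devY n y z = - ((t - 1) * bY z)" by (simp add: algebra_simps)
      then have "\<bar>bY z - devY n y z\<bar> = (t - 1) * \<bar>bY z\<bar>" using t by (simp add: abs_mult)
      also have "\<dots> \<le> (t - 1) * (1 + q)"
        using abs_le_weighted_sq[OF PY, of bY z] bYq t by (intro mult_left_mono) auto
      finally show ?thesis unfolding t1 .
    qed
    moreover have "\<bar>b z - devX n x z\<bar> \<le> r" for z using x by (simp add: abs_minus_commute)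
    ultimately obtain d where d: "d \<in> signed_couplings (\<lambda>z. b z - devX n x z) (\<lambda>z. bY z - devY n y z)"
      "{z. d z < 0} \<subseteq> S" "cost d \<le> B * r"
      using B(2)[OF less_imp_le[OF r(1)] zero_mass_diff[OF b(1) zX] zero_mass_diff[OF bY zY]] by blast
    have "(\<lambda>z. g z + d z) \<in> signed_couplings b bY" using signed_couplings_add[OF g(1) d(1)] by simp
    moreover have "{z. g z + d z < 0} \<subseteq> S" by (rule negative_part_add[OF g(2) d(2)])
    moreover have "cost (\<lambda>z. g z + d z) < m" unfolding cost_add using g(3) d(3) r(2) by argo
    ultimately have "theta c S b bY < ereal m" unfolding theta_less_iff by (intro bexI[of _ "\<lambda>z. g z + d z"] conjI)
    then show False using far[OF bY] bYq by (simp add: q_def)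
  qed
  have "q * 1 < q * t\<^sup>2" using q t by (intro mult_strict_left_mono) auto
  then have "1 / 2 * q < min u (1 / 2 * (t\<^sup>2 * q))" using b(2) by (auto simp: q_def mult.commute)
  \<comment> \<open>The order q / 2 < u1 < u2 < t^2 * q / 2 makes the ball around b at least twice
    as likely as the tail of the other word; u1 < u keeps half of the ball's probability above the
    target.\<close>
  then obtain u1 where u1: "1 / 2 * q < u1" "u1 < min u (1 / 2 * (t\<^sup>2 * q))" using dense by blast
  then obtain u2 where u2: "u1 < u2" "u2 < 1 / 2 * (t\<^sup>2 * q)" using dense[of u1 "1 / 2 * (t\<^sup>2 * q)"] by auto
  have "\<forall>\<^sub>F n in sequentially. 2 * exp (- u / a n) \<le> exp (- u1 / a n)"
    "\<forall>\<^sub>F n in sequentially. 2 * exp (- u2 / a n) \<le> exp (- u1 / a n)"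
    using u1 u2 by (intro ev_exp_absorb; simp)+
  then show ?thesis
    using dev_ball_lower[OF PX u1(1)[unfolded q_def] r(1) b(1)] dev_norm_tail[OF PY u2(2)] ev_ge1
  proof eventually_elim
    case (elim n)
    let ?A = "{x. \<forall>z. \<bar>devX n x z - b z\<bar> \<le> r}"
    let ?T = "{y. 1 / 2 * (t\<^sup>2 * q) \<le> 1 / 2 * weighted_sq PY (devY n y)}"
    show ?case
      unfolding excess_def
    proof (rule excess_prob_ge)
      fix R assume R: "R \<in> couplings (product_pmf n PX) (product_pmf n PY)"
      let ?E = "{z. avg_cost c n z > alpha + \<Delta> * e n}"
      have "{z. fst z \<in> ?A} \<subseteq> ?E \<union> {z. snd z \<in> ?T}"
        using large[OF elim(5)] by (auto simp: not_le)
      then have "measure_pmf.prob R {z. fst z \<in> ?A} \<le> measure_pmf.prob R (?E \<union> {z. snd z \<in> ?T})"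
        by (intro measure_pmf.finite_measure_mono) auto
      also have "\<dots> \<le> measure_pmf.prob R ?E + measure_pmf.prob R {z. snd z \<in> ?T}"
        by (intro measure_Un_le) auto
      finally show "exp (- u / a n) \<le> measure_pmf.prob R ?E"
        unfolding prob_coupling_fst[OF R] prob_coupling_snd[OF R] using elim(1-4) by linarith
    qed
  qed
qed

(* Lowering the target from \<Delta> to \<Delta>' leaves room to shrink the partner of b by a factor 1 - s. The partner then has
   strictly smaller norm than b, so it is exponentially more likely than b. *)
lemma shrunk_partner:
  assumes g: "ereal l' < g_one_sided (theta c S) PX PY \<Delta>'" and h: "h > 0" and L: "L \<ge> 1"
  obtains s where "0 < s" "s \<le> 1"
    "\<And>b. b \<in> zero_mass \<Longrightarrow> 1 / 2 * weighted_sq PX b \<le> l' \<Longrightarrow> 1 + weighted_sq PX b \<le> L \<Longrightarrow>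
      \<exists>bY g. bY \<in> zero_mass \<and> g \<in> signed_couplings b bY \<and> {z. g z < 0} \<subseteq> S \<and> cost g \<le> \<Delta>' + 2 * h
        \<and> weighted_sq PY bY \<le> (1 - s) * weighted_sq PX b"
proof -
  obtain B where B: "B > 0" "\<And>r dX dY. r \<ge> 0 \<Longrightarrow> dX \<in> zero_mass \<Longrightarrow> dY \<in> zero_mass \<Longrightarrow> (\<And>x. \<bar>dX x\<bar> \<le> r) \<Longrightarrow> (\<And>y. \<bar>dY y\<bar> \<le> r) \<Longrightarrow>
      \<exists>g\<in>signed_couplings dX dY. {z. g z < 0} \<subseteq> S \<and> (\<forall>z. \<bar>g z\<bar> \<le> B * r) \<and> cost g \<le> B * r"
    using small_signed_coupling by blast
  \<comment> \<open>Subtracting s * b' changes entries by at most s * L and so costs at most B * s *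
    L \<le> h. The other h in the conclusion pays for approximating the infimum.\<close>
  define s where "s = min 1 (h / (B * L))"
  have BL: "B * L > 0" using B L by simp
  have s: "0 < s" "s \<le> 1" using h BL by (auto simp: s_def)
  have "s * (B * L) \<le> h / (B * L) * (B * L)" using BL by (intro mult_right_mono) (auto simp: s_def)
  then have Bs: "B * (s * L) \<le> h" using B L by (simp add: mult_ac)
  show ?thesis
  proof (rule that[OF s])
    fix b assume b: "b \<in> zero_mass" "1 / 2 * weighted_sq PX b \<le> l'" "1 + weighted_sq PX b \<le> L"
    have "\<not> ereal \<Delta>' < (INF b'\<in>{b' \<in> zero_mass. weighted_sq PY b' \<le> weighted_sq PX b}. theta c S b b')"
    proof
      assume "ereal \<Delta>' < (INF b'\<in>{b' \<in> zero_mass. weighted_sq PY b' \<le> weighted_sq PX b}. theta c S b b')"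
      then have "g_one_sided (theta c S) PX PY \<Delta>' \<le> ereal (1 / 2 * weighted_sq PX b)"
        unfolding g_one_sided_def using b(1) by (intro INF_lower) auto
      also have "\<dots> \<le> ereal l'" using b(2) by simp
      finally show False using g by simp
    qed
    then have "(INF b'\<in>{b' \<in> zero_mass. weighted_sq PY b' \<le> weighted_sq PX b}. theta c S b b') < ereal (\<Delta>' + h)"
      using h by (meson ereal_less_eq(3) le_less_trans less_add_same_cancel1 less_ereal.simps(1) not_less)
    then obtain b' where b': "b' \<in> zero_mass" "weighted_sq PY b' \<le> weighted_sq PX b" "theta c S b b' < ereal (\<Delta>' + h)"
      unfolding INF_less_iff by auto
    then obtain g where g: "g \<in> signed_couplings b b'" "{z. g z < 0} \<subseteq> S" "cost g < \<Delta>' + h"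
      unfolding theta_less_iff by blast
    have "\<bar>- s * b' y\<bar> \<le> s * L" for y
    proof -
      have "\<bar>b' y\<bar> \<le> L" using abs_le_weighted_sq[OF PY, of b' y] b'(2) b(3) by linarith
      then show ?thesis using s by (simp add: abs_mult)
    qed
    moreover have "\<bar>0 :: real\<bar> \<le> s * L" using s L by simp
    moreover have "(\<lambda>_. 0) \<in> zero_mass" by (simp add: zero_mass_def)
    ultimately obtain d where d: "d \<in> signed_couplings (\<lambda>_. 0) (\<lambda>y. - s * b' y)" "{z. d z < 0} \<subseteq> S" "cost d \<le> B * (s * L)"
      using B(2)[of "s * L" "\<lambda>_. 0" "\<lambda>y. - s * b' y"] zero_mass_scale[OF b'(1), of "- s"] s L by auto
    let ?bY = "\<lambda>y. (1 - s) * b' y"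
    have "(\<lambda>z. g z + d z) \<in> signed_couplings b ?bY"
      using signed_couplings_add[OF g(1) d(1)] by (simp add: algebra_simps)
    moreover have "{z. g z + d z < 0} \<subseteq> S" by (rule negative_part_add[OF g(2) d(2)])
    moreover have "cost (\<lambda>z. g z + d z) \<le> \<Delta>' + 2 * h" unfolding cost_add using g(3) d(3) Bs by linarith
    moreover have "weighted_sq PY ?bY \<le> (1 - s) * weighted_sq PX b"
    proof -
      have "(1 - s)\<^sup>2 \<le> 1 - s" using s by (simp add: power2_eq_square mult_left_le_one_le)
      then have "(1 - s)\<^sup>2 * weighted_sq PY b' \<le> (1 - s) * weighted_sq PX b"
        using b'(2) s weighted_sq_nonneg by (intro mult_mono) auto
      then show ?thesis by (simp add: weighted_sq_scale)
    qed
    moreover have "?bY \<in> zero_mass" by (rule zero_mass_scale[OF b'(1)])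
    ultimately show "\<exists>bY g. bY \<in> zero_mass \<and> g \<in> signed_couplings b bY \<and> {z. g z < 0} \<subseteq> S \<and> cost g \<le> \<Delta>' + 2 * h
        \<and> weighted_sq PY bY \<le> (1 - s) * weighted_sq PX b" by blast
  qed
qed

text \<open>The lower bound q0 makes the gain from shrinking the partner uniform, and the net over
  bounded deviations makes the threshold on n independent of C. If even the least norm in C exceeds
  the bound, the additive term alone dominates C.\<close>

lemma hall_one_sided:
  assumes g: "ereal l' < g_one_sided (theta c S) PX PY \<Delta>'" and D: "\<Delta>' < \<Delta>" and q0: "q0 > 0" and l: "l < l'"
  shows "\<forall>\<^sub>F n in sequentially. \<forall>C. finite C \<longrightarrow> (\<forall>x\<in>C. q0 \<le> weighted_sq PX (devX n x)) \<longrightarrow>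
     measure_pmf.prob (product_pmf n PX) C
       \<le> measure_pmf.prob (product_pmf n PY) {y. \<exists>x\<in>C. close_to \<Delta> n x y} + exp (- l / a n)"
proof -
  define L where "L = 1 + 2 * \<bar>l'\<bar>"
  have L: "L \<ge> 1" by (simp add: L_def)
  define h where "h = (\<Delta> - \<Delta>') / 3"
  have h: "h > 0" "\<Delta>' + 2 * h = \<Delta> - h" using D by (auto simp: h_def field_simps)
  obtain s where s: "0 < s" "s \<le> 1"
    "\<And>b. b \<in> zero_mass \<Longrightarrow> 1 / 2 * weighted_sq PX b \<le> l' \<Longrightarrow> 1 + weighted_sq PX b \<le> L \<Longrightarrow>
      \<exists>bY g. bY \<in> zero_mass \<and> g \<in> signed_couplings b bY \<and> {z. g z < 0} \<subseteq> S \<and> cost g \<le> \<Delta> - h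
        \<and> weighted_sq PY bY \<le> (1 - s) * weighted_sq PX b"
    using shrunk_partner[OF g h(1) L] unfolding h(2) by metis
  obtain r where r: "r > 0" "\<And>bX bY g r'. bX \<in> zero_mass \<Longrightarrow> bY \<in> zero_mass \<Longrightarrow> g \<in> signed_couplings bX bY \<Longrightarrow> {z. g z < 0} \<subseteq> S \<Longrightarrow>
      cost g \<le> \<Delta> - h \<Longrightarrow> r' \<le> r \<Longrightarrow> 0 \<le> r' \<Longrightarrow>
      \<forall>\<^sub>F n in sequentially. \<forall>x y. (\<forall>z. \<bar>devX n x z - bX z\<bar> \<le> r') \<longrightarrow> (\<forall>z. \<bar>devY n y z - bY z\<bar> \<le> r') \<longrightarrow> close_to \<Delta> n x y"
    by (rule eventually_close_to[OF h(1), of \<Delta>]) (rule that)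
  define W where "W = (\<Sum>x\<in>UNIV. (2 * L + 1) / pmf PX x)"
  have W: "W > 0" unfolding W_def using L PX by (intro sum_pos) (auto simp: pmf_positive)
  \<comment> \<open>Shrinking gains at least s * q0 / 2 = 4 * k in the exponent. The level u lies 2
    * k below that of b; the tail of C starts at most k below b, which leaves strict room on both
    sides of u.\<close>
  define k where "k = s * q0 / 8"
  have k: "k > 0" using s q0 by (simp add: k_def)
  define \<rho> where "\<rho> = min (min r 1) (2 * k / W)"
  have \<rho>: "\<rho> > 0" "\<rho> \<le> r" "\<rho> \<le> 1" using r(1) k W by (auto simp: \<rho>_def)
  have \<rho>W: "\<rho> * W \<le> 2 * k"
    using mult_right_mono[of \<rho> "2 * k / W" W] W by (simp add: \<rho>_def)
  define N where "N = {v \<in> zero_mass. q0 \<le> weighted_sq PX v \<and> 1 / 2 * weighted_sq PX v \<le> l'}"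
  have N_L: "1 + weighted_sq PX v \<le> L" if "v \<in> N" for v using that by (auto simp: N_def L_def)
  have bd: "\<bar>v x\<bar> \<le> L" if "v \<in> N" for v x
    using abs_le_weighted_sq[OF PX, of v x] N_L[OF that] by linarith
  obtain F where F: "finite F" "F \<subseteq> N" "\<And>v. v \<in> N \<Longrightarrow> \<exists>b\<in>F. \<forall>x. \<bar>v x - b x\<bar> \<le> \<rho>"
    using finite_net[OF \<rho>(1), of N L] bd by metis
  have "\<forall>\<^sub>F n in sequentially. \<forall>b\<in>F. \<forall>x. (\<forall>z. \<bar>devX n x z - b z\<bar> \<le> \<rho>) \<longrightarrow>
     measure_pmf.prob (product_pmf n PX) {x'. weighted_sq PX (devX n x) \<le> weighted_sq PX (devX n x')}
       \<le> measure_pmf.prob (product_pmf n PY) {y. close_to \<Delta> n x y}"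
  proof (intro eventually_ball_finite F(1) ballI)
    fix b assume "b \<in> F"
    then have bN: "b \<in> N" using F(2) by blast
    then have b: "b \<in> zero_mass" "q0 \<le> weighted_sq PX b" "1 / 2 * weighted_sq PX b \<le> l'" by (auto simp: N_def)
    obtain bY g where bY: "bY \<in> zero_mass" and g: "g \<in> signed_couplings b bY" "{z. g z < 0} \<subseteq> S" "cost g \<le> \<Delta> - h"
      and wY: "weighted_sq PY bY \<le> (1 - s) * weighted_sq PX b"
      using s(3)[OF b(1,3) N_L[OF bN]] by blast
    define u where "u = 1 / 2 * weighted_sq PX b - 2 * k"
    have "s * q0 \<le> s * weighted_sq PX b" using s b by (intro mult_left_mono) auto
    then have uY: "1 / 2 * weighted_sq PY bY < u" using wY k by (simp add: u_def k_def algebra_simps)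
    have "u < 1 / 2 * weighted_sq PX b - k" using k by (simp add: u_def)
    from dev_norm_tail[OF PX this] dev_ball_lower[OF PY uY \<rho>(1) bY] r(2)[OF b(1) bY g \<rho>(2) less_imp_le[OF \<rho>(1)]]
    show "\<forall>\<^sub>F n in sequentially. \<forall>x. (\<forall>z. \<bar>devX n x z - b z\<bar> \<le> \<rho>) \<longrightarrow>
     measure_pmf.prob (product_pmf n PX) {x'. weighted_sq PX (devX n x) \<le> weighted_sq PX (devX n x')}
       \<le> measure_pmf.prob (product_pmf n PY) {y. close_to \<Delta> n x y}"
    proof (eventually_elim, intro allI impI)
      fix n x
      assume tail: "measure_pmf.prob (product_pmf n PX) {x. 1 / 2 * weighted_sq PX b - k \<le> 1 / 2 * weighted_sq PX (devX n x)} \<le> exp (- u / a n)"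
        and ball: "exp (- u / a n) \<le> measure_pmf.prob (product_pmf n PY) {y. \<forall>z. \<bar>devY n y z - bY z\<bar> \<le> \<rho>}"
        and close: "\<forall>x y. (\<forall>z. \<bar>devX n x z - b z\<bar> \<le> \<rho>) \<longrightarrow> (\<forall>z. \<bar>devY n y z - bY z\<bar> \<le> \<rho>) \<longrightarrow> close_to \<Delta> n x y"
        and x: "\<forall>z. \<bar>devX n x z - b z\<bar> \<le> \<rho>"
      have "weighted_sq PX b - \<rho> * W \<le> weighted_sq PX (devX n x)"
        unfolding W_def using bd[OF bN] \<rho> x by (intro weighted_sq_lipschitz[OF PX]) auto
      then have "weighted_sq PX b - 2 * k \<le> weighted_sq PX (devX n x)" using \<rho>W by linarith
      then have "measure_pmf.prob (product_pmf n PX) {x'. weighted_sq PX (devX n x) \<le> weighted_sq PX (devX n x')}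
          \<le> measure_pmf.prob (product_pmf n PX) {x. 1 / 2 * weighted_sq PX b - k \<le> 1 / 2 * weighted_sq PX (devX n x)}"
        by (intro measure_pmf.finite_measure_mono) auto
      also have "\<dots> \<le> measure_pmf.prob (product_pmf n PY) {y. \<forall>z. \<bar>devY n y z - bY z\<bar> \<le> \<rho>}"
        using tail ball by linarith
      also have "\<dots> \<le> measure_pmf.prob (product_pmf n PY) {y. close_to \<Delta> n x y}"
        using close x by (intro measure_pmf.finite_measure_mono) auto
      finally show "measure_pmf.prob (product_pmf n PX) {x'. weighted_sq PX (devX n x) \<le> weighted_sq PX (devX n x')}
          \<le> measure_pmf.prob (product_pmf n PY) {y. close_to \<Delta> n x y}" .
    qed
  qed
  then show ?thesis
    using dev_norm_tail[OF PX l] ev_ge1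
  proof (eventually_elim, intro allI impI)
    fix n and C :: "(nat \<Rightarrow> 'x) set"
    assume near: "\<forall>b\<in>F. \<forall>x. (\<forall>z. \<bar>devX n x z - b z\<bar> \<le> \<rho>) \<longrightarrow>
       measure_pmf.prob (product_pmf n PX) {x'. weighted_sq PX (devX n x) \<le> weighted_sq PX (devX n x')}
         \<le> measure_pmf.prob (product_pmf n PY) {y. close_to \<Delta> n x y}"
      and tail: "measure_pmf.prob (product_pmf n PX) {x. l' \<le> 1 / 2 * weighted_sq PX (devX n x)} \<le> exp (- l / a n)"
      and n: "n \<ge> 1" and C: "finite C" "\<forall>x\<in>C. q0 \<le> weighted_sq PX (devX n x)"
    let ?N = "{y. \<exists>x\<in>C. close_to \<Delta> n x y}"
    show "measure_pmf.prob (product_pmf n PX) C \<le> measure_pmf.prob (product_pmf n PY) ?N + exp (- l / a n)"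
    proof (cases "C = {}")
      case False
      then have "Min ((\<lambda>x. weighted_sq PX (devX n x)) ` C) \<in> (\<lambda>x. weighted_sq PX (devX n x)) ` C"
        using C by (intro Min_in) auto
      then obtain x where x: "x \<in> C" "weighted_sq PX (devX n x) = Min ((\<lambda>x. weighted_sq PX (devX n x)) ` C)" by auto
      have min: "weighted_sq PX (devX n x) \<le> weighted_sq PX (devX n x')" if "x' \<in> C" for x'
        unfolding x(2) using C that by (intro Min_le) auto
      show ?thesis
      proof (cases "l' \<le> 1 / 2 * weighted_sq PX (devX n x)")
        case True
        have "measure_pmf.prob (product_pmf n PX) C
            \<le> measure_pmf.prob (product_pmf n PX) {x. l' \<le> 1 / 2 * weighted_sq PX (devX n x)}"
          using min True by (intro measure_pmf.finite_measure_mono) force+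
        then show ?thesis using tail measure_nonneg[of "product_pmf n PY" ?N] by linarith
      next
        case False
        have "devX n x \<in> zero_mass" using n e_nz by (intro dev_zero_mass) auto
        then have "devX n x \<in> N" using False C x by (auto simp: N_def)
        then obtain b where b: "b \<in> F" "\<forall>z. \<bar>devX n x z - b z\<bar> \<le> \<rho>" using F(3) by blast
        have "measure_pmf.prob (product_pmf n PX) C
            \<le> measure_pmf.prob (product_pmf n PX) {x'. weighted_sq PX (devX n x) \<le> weighted_sq PX (devX n x')}"
          using min by (intro measure_pmf.finite_measure_mono) auto
        also have "\<dots> \<le> measure_pmf.prob (product_pmf n PY) {y. close_to \<Delta> n x y}" using near b by blast
        also have "\<dots> \<le> measure_pmf.prob (product_pmf n PY) ?N"
          using x by (intro measure_pmf.finite_measure_mono) auto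
        finally show ?thesis using exp_ge_zero[of "- l / a n"] by linarith
      qed
    qed simp
  qed
qed

section \<open>Combining the two one-sided bounds\<close>

lemma swapped: "transport_scale a PY PX (map_pmf prod.swap Pstar)"
proof unfold_locales
  show "map_pmf prod.swap Pstar \<in> couplings PY PX"
    using Pstar by (auto simp: couplings_def map_pmf_comp)
qed (rule PX PY)+

interpretation sw: transport_scale a PY PX "\<lambda>z. c (prod.swap z)" "map_pmf prod.swap Pstar"
  by (rule swapped)

lemma swapped_alpha: "sw.alpha = alpha"
proof -
  have "pmf (map_pmf prod.swap Pstar) (prod.swap z) = pmf Pstar z" for z
    by (rule pmf_map_inj') simp
  then show ?thesis
    using sum_swap_UNIV[of "\<lambda>z. pmf (map_pmf prod.swap Pstar) z * c (prod.swap z)"]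
    by (simp add: sw.alpha_def sw.cost_def alpha_def cost_def)
qed

lemma swapped_excess: "sw.excess \<Delta> n = excess \<Delta> n"
  by (simp add: sw.excess_def excess_def swapped_alpha excess_prob_swap)

lemma swapped_theta: "theta (\<lambda>z. c (prod.swap z)) (set_pmf (map_pmf prod.swap Pstar)) = (\<lambda>bY bX. theta c S bX bY)"
  by (simp add: theta_swap fun_eq_iff)

lemma excess_lower:
  assumes D: "\<Delta> > 0" and u: "g_tilde c S PX PY \<Delta> < ereal u"
  shows "\<forall>\<^sub>F n in sequentially. exp (- u / a n) \<le> excess \<Delta> n"
  using u excess_lower_one_sided[OF D, of u] sw.excess_lower_one_sided[OF D, of u]
  unfolding g_tilde_def min_less_iff_disj swapped_theta swapped_excess by blast

lemma excess_upper:
  assumes D: "\<Delta> > 0" "\<Delta>' < \<Delta>" and g: "ereal l' < g_tilde c S PX PY \<Delta>'" and l: "l < l'"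
  shows "\<forall>\<^sub>F n in sequentially. excess \<Delta> n \<le> exp (- l / a n)"
proof -
  have gX: "ereal l' < g_one_sided (theta c S) PX PY \<Delta>'"
    and gY: "ereal l' < g_one_sided (\<lambda>bY bX. theta c S bX bY) PY PX \<Delta>'"
    using g by (auto simp: g_tilde_def)
  have D2: "\<Delta> / 2 > 0" using D by simp
  obtain r where r: "r > 0" "\<And>bX bY g r'. bX \<in> zero_mass \<Longrightarrow> bY \<in> zero_mass \<Longrightarrow> g \<in> signed_couplings bX bY \<Longrightarrow> {z. g z < 0} \<subseteq> S \<Longrightarrow>
      cost g \<le> \<Delta> - \<Delta> / 2 \<Longrightarrow> r' \<le> r \<Longrightarrow> 0 \<le> r' \<Longrightarrow>
      \<forall>\<^sub>F n in sequentially. \<forall>x y. (\<forall>z. \<bar>devX n x z - bX z\<bar> \<le> r') \<longrightarrow> (\<forall>z. \<bar>devY n y z - bY z\<bar> \<le> r') \<longrightarrow> close_to \<Delta> n x y"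
    by (rule eventually_close_to[OF D2, of \<Delta>]) (rule that)
  \<comment> \<open>Here \<Delta> > 0 enters: the zero plan has cost 0, below \<Delta> by more than
    \<Delta> / 2, so any two words of nearly typical type are related.\<close>
  have "\<forall>\<^sub>F n in sequentially. \<forall>x y. (\<forall>z. \<bar>devX n x z - 0\<bar> \<le> r) \<longrightarrow> (\<forall>z. \<bar>devY n y z - 0\<bar> \<le> r) \<longrightarrow> close_to \<Delta> n x y"
    using r(1) D by (intro r(2)[of "\<lambda>_. 0" "\<lambda>_. 0" "\<lambda>_. 0"]) (auto simp: zero_mass_def signed_couplings_def cost_def)
  moreover have q0: "r\<^sup>2 > 0" using r(1) by simp
  note hall_one_sided[OF gX D(2) q0 l]
    sw.hall_one_sided[OF gY[folded swapped_theta] D(2) q0 l, unfolded swapped_alpha rearranged_swap]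
  ultimately show ?thesis
  proof eventually_elim
    case (elim n)
    let ?PX = "product_pmf n PX" and ?PY = "product_pmf n PY"
    have small: "\<bar>t\<bar> \<le> r" if "t\<^sup>2 \<le> q" "\<not> r\<^sup>2 \<le> q" for t q :: real
      using that r(1) abs_le_square_iff[of t r] by simp
    show ?case
      unfolding excess_def
    proof (rule excess_prob_le_hall)
      fix C assume C: "C \<subseteq> set_pmf ?PX"
      let ?N = "{y. \<exists>x\<in>C. close_to \<Delta> n x y}"
      show "measure_pmf.prob ?PX C \<le> measure_pmf.prob ?PY ?N + exp (- l / a n)"
      proof (cases "\<forall>x\<in>C. r\<^sup>2 \<le> weighted_sq PX (devX n x)")
        case True
        then show ?thesis using elim(2) finite_subset[OF C finite_set_product_pmf] by blast
      next
        case False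
        then obtain x where x: "x \<in> C" "\<not> r\<^sup>2 \<le> weighted_sq PX (devX n x)" by blast
        \<comment> \<open>Hall's condition is self-dual: the neighbours of ?E lie outside C, so the
          bound for ?E in the exchanged problem becomes the bound for C on taking complements. The
          typical word x in C keeps ?E away from deviation 0.\<close>
        let ?E = "set_pmf ?PY - ?N"
        have "r\<^sup>2 \<le> weighted_sq PY (devY n y)" if "y \<in> ?E" for y
        proof (rule ccontr)
          assume "\<not> r\<^sup>2 \<le> weighted_sq PY (devY n y)"
          then have "close_to \<Delta> n x y"
            using elim(1) small[OF sq_le_weighted_sq[OF PX] x(2)] small[OF sq_le_weighted_sq[OF PY]] by simp
          then show False using that x by blast
        qed
        then have "measure_pmf.prob ?PY ?E \<le> measure_pmf.prob ?PX {x. \<exists>y\<in>?E. close_to \<Delta> n x y} + exp (- l / a n)"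
          using elim(3) finite_set_product_pmf[of n PY] by blast
        also have "measure_pmf.prob ?PX {x. \<exists>y\<in>?E. close_to \<Delta> n x y} \<le> measure_pmf.prob ?PX (- C)"
          by (intro measure_pmf.finite_measure_mono) auto
        also have "\<dots> = 1 - measure_pmf.prob ?PX C"
          using measure_pmf.prob_compl[of C ?PX] by (simp add: Compl_eq_Diff_UNIV)
        also have "measure_pmf.prob ?PY ?E = measure_pmf.prob ?PY (- ?N)"
          by (intro measure_prob_cong_0) (auto simp: set_pmf_iff)
        also have "\<dots> = 1 - measure_pmf.prob ?PY ?N"
          using measure_pmf.prob_compl[of ?N ?PY] by (simp add: Compl_eq_Diff_UNIV)
        finally show ?thesis by linarith
      qed
    qed simp
  qed
qed

end

section \<open>From probability bounds to limits of logarithms\<close>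

lemma neg_log_ge:
  assumes "a > 0" "0 \<le> p" "p \<le> exp (- l / a)"
  shows "ereal l \<le> ereal a * neg_log p"
proof (cases "p = 0")
  case False
  then have "ln p \<le> ln (exp (- l / a))" using assms by (subst ln_le_cancel_iff) auto
  then have "l \<le> a * - ln p" using assms(1) by (simp add: field_simps)
  then show ?thesis using False by (simp add: neg_log_def)
qed (use assms in \<open>simp add: neg_log_def\<close>)

lemma neg_log_le:
  assumes "a > 0" "exp (- u / a) \<le> p"
  shows "ereal a * neg_log p \<le> ereal u"
proof -
  have p: "p > 0" using assms(2) exp_gt_zero less_le_trans by blast
  then have "ln (exp (- u / a)) \<le> ln p" using assms by (subst ln_le_cancel_iff) auto
  then have "a * - ln p \<le> u" using assms(1) by (simp add: field_simps)
  then show ?thesis using p by (simp add: neg_log_def)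
qed

lemma g_one_sided_mono: "\<Delta>1 \<le> \<Delta>2 \<Longrightarrow> g_one_sided th P Q \<Delta>1 \<le> g_one_sided th P Q \<Delta>2"
  unfolding g_one_sided_def
  by (intro INF_superset_mono) (auto intro: le_less_trans[of "ereal \<Delta>1" "ereal \<Delta>2"])

lemma g_tilde_mono: "mono (g_tilde c S P Q)"
  unfolding g_tilde_def by (intro monoI min.mono g_one_sided_mono)

lemma mono_tendsto_at_left_SUP:
  fixes f :: "real \<Rightarrow> ereal"
  assumes "mono f"
  shows "(f \<longlongrightarrow> (SUP t\<in>{..<x}. f t)) (at_left x)"
proof (rule order_tendstoI)
  fix y assume "y < (SUP t\<in>{..<x}. f t)"
  then obtain t where t: "t < x" "y < f t" unfolding less_SUP_iff by auto
  then show "\<forall>\<^sub>F s in at_left x. y < f s"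
    unfolding eventually_at_left_field using monoD[OF assms] by (meson less_imp_le less_le_trans)
next
  fix y assume y: "(SUP t\<in>{..<x}. f t) < y"
  have "f s < y" if "s < x" for s
    using that by (intro le_less_trans[OF _ y] SUP_upper) auto
  then show "\<forall>\<^sub>F s in at_left x. f s < y"
    unfolding eventually_at_left_field by (meson lt_ex)
qed

theorem theorem5:
  fixes PX :: "'x::finite pmf" and PY :: "'y::finite pmf"
    and c :: "'x \<times> 'y \<Rightarrow> real"
    and Pstar :: "('x \<times> 'y) pmf"
    and a :: "nat \<Rightarrow> real"
    and \<alpha>0 \<Delta> :: real
  assumes "set_pmf PX = UNIV" and "set_pmf PY = UNIV"
    and "\<And>z. 0 \<le> c z"
    and "\<alpha>0 = transport_cost c PX PY"
    and "Min (range c) < \<alpha>0" and "\<alpha>0 < Max (range c)"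
    and "optimal_coupling c PX PY Pstar"
    and "\<And>n. n \<ge> 1 \<Longrightarrow> a n > 0"
    and "a \<longlonglongrightarrow> 0"
    and "filterlim (\<lambda>n. real n * a n) at_top sequentially"
  shows "(\<Delta> < 0 \<longrightarrow>
            (\<lambda>n. ereal (a n) * neg_log (1 - excess_prob c PX PY n (\<alpha>0 + \<Delta> / sqrt (real n * a n))))
              \<longlonglongrightarrow> f_tilde c (set_pmf Pstar) PX PY \<Delta>)
       \<and> (\<Delta> > 0 \<longrightarrow>
            (\<exists>L. ((\<lambda>\<Delta>'. g_tilde c (set_pmf Pstar) PX PY \<Delta>') \<longlongrightarrow> L) (at_left \<Delta>)
               \<and> L \<le> liminf (\<lambda>n. ereal (a n) * neg_log (excess_prob c PX PY n (\<alpha>0 + \<Delta> / sqrt (real n * a n)))))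
          \<and> liminf (\<lambda>n. ereal (a n) * neg_log (excess_prob c PX PY n (\<alpha>0 + \<Delta> / sqrt (real n * a n))))
              \<le> limsup (\<lambda>n. ereal (a n) * neg_log (excess_prob c PX PY n (\<alpha>0 + \<Delta> / sqrt (real n * a n))))
          \<and> limsup (\<lambda>n. ereal (a n) * neg_log (excess_prob c PX PY n (\<alpha>0 + \<Delta> / sqrt (real n * a n))))
              \<le> g_tilde c (set_pmf Pstar) PX PY \<Delta>)"
proof -
  interpret transport_scale a PX PY c Pstar
    by unfold_locales (use assms in \<open>auto simp: optimal_coupling_def\<close>)
  have "alpha = \<alpha>0"
    using assms(4,7) by (simp add: alpha_def cost_def optimal_coupling_def expectation_finite_type)
  then have excess: "excess_prob c PX PY n (\<alpha>0 + \<Delta> / sqrt (real n * a n)) = excess \<Delta> n" for n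
    by (simp add: excess_def e_def)
  have excess0: "0 \<le> excess \<Delta> n" "excess \<Delta> n \<le> 1" for n
    unfolding excess_def by (auto intro: excess_prob_ge excess_prob_le_1)
  have "(\<lambda>n. ereal (a n) * neg_log (1 - excess \<Delta> n)) \<longlonglongrightarrow> f_tilde c S PX PY \<Delta>" if D: "\<Delta> < 0"
  proof (rule order_tendstoI)
    fix y assume "y < f_tilde c S PX PY \<Delta>"
    then obtain l where l: "y < ereal l" "ereal l < f_tilde c S PX PY \<Delta>" using ereal_dense2 by blast
    show "\<forall>\<^sub>F n in sequentially. y < ereal (a n) * neg_log (1 - excess \<Delta> n)"
      using complement_excess_upper[OF l(2)] ev_ge1
    proof eventually_elim
      case (elim n)
      then have "ereal l \<le> ereal (a n) * neg_log (1 - excess \<Delta> n)"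
        using excess0 by (intro neg_log_ge a_pos) auto
      then show ?case using l(1) by (rule less_le_trans[rotated])
    qed
  next
    fix y assume "f_tilde c S PX PY \<Delta> < y"
    then obtain u where u: "f_tilde c S PX PY \<Delta> < ereal u" "ereal u < y" using ereal_dense2 by blast
    show "\<forall>\<^sub>F n in sequentially. ereal (a n) * neg_log (1 - excess \<Delta> n) < y"
      using complement_excess_lower[OF D u(1)] ev_ge1
    proof eventually_elim
      case (elim n)
      then have "ereal (a n) * neg_log (1 - excess \<Delta> n) \<le> ereal u" by (intro neg_log_le a_pos) auto
      then show ?case using u(2) by (rule le_less_trans)
    qed
  qed
  moreover have "(SUP t\<in>{..<\<Delta>}. g_tilde c S PX PY t) \<le> liminf (\<lambda>n. ereal (a n) * neg_log (excess \<Delta> n))" if D: "\<Delta> > 0"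
  proof (rule dense_le)
    \<comment> \<open>The left limit of the monotone function \<open>g_tilde\<close> is this
      supremum, so y is already exceeded at some t < \<Delta>, which serves as the lowered target in
      \<open>excess_upper\<close>.\<close>
    fix y assume "y < (SUP t\<in>{..<\<Delta>}. g_tilde c S PX PY t)"
    then obtain t where t: "t < \<Delta>" "y < g_tilde c S PX PY t" unfolding less_SUP_iff by auto
    obtain l where l: "y < ereal l" "ereal l < g_tilde c S PX PY t" using ereal_dense2[OF t(2)] by blast
    obtain l' where l': "ereal l < ereal l'" "ereal l' < g_tilde c S PX PY t" using ereal_dense2[OF l(2)] by blast
    have "l < l'" using l'(1) by simp
    from excess_upper[OF D t(1) l'(2) this] ev_ge1
    have "\<forall>\<^sub>F n in sequentially. y \<le> ereal (a n) * neg_log (excess \<Delta> n)"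
    proof eventually_elim
      case (elim n)
      then have "ereal l \<le> ereal (a n) * neg_log (excess \<Delta> n)"
        using excess0 by (intro neg_log_ge a_pos) auto
      then show ?case using l(1) by (meson less_imp_le order.trans)
    qed
    then show "y \<le> liminf (\<lambda>n. ereal (a n) * neg_log (excess \<Delta> n))" by (rule Liminf_bounded)
  qed
  moreover have "limsup (\<lambda>n. ereal (a n) * neg_log (excess \<Delta> n)) \<le> g_tilde c S PX PY \<Delta>" if D: "\<Delta> > 0"
  proof (rule dense_ge)
    fix y assume "g_tilde c S PX PY \<Delta> < y"
    then obtain u where u: "g_tilde c S PX PY \<Delta> < ereal u" "ereal u < y" using ereal_dense2 by blast
    have "\<forall>\<^sub>F n in sequentially. ereal (a n) * neg_log (excess \<Delta> n) \<le> y"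
      using excess_lower[OF D u(1)] ev_ge1
    proof eventually_elim
      case (elim n)
      then have "ereal (a n) * neg_log (excess \<Delta> n) \<le> ereal u" by (intro neg_log_le a_pos) auto
      then show ?case using u(2) by (meson less_imp_le order.trans)
    qed
    then show "limsup (\<lambda>n. ereal (a n) * neg_log (excess \<Delta> n)) \<le> y" by (rule Limsup_bounded)
  qed
  moreover have "liminf (\<lambda>n. ereal (a n) * neg_log (excess \<Delta> n)) \<le> limsup (\<lambda>n. ereal (a n) * neg_log (excess \<Delta> n))"
    by (rule Liminf_le_Limsup) simp
  ultimately show ?thesis
    unfolding excess using mono_tendsto_at_left_SUP[OF g_tilde_mono, of c S PX PY \<Delta>] by blast
qed

end
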